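(* Suppose that $U_{-1},U_0$ are Jordan domains in $\mathbb{C}$ and $g:U_{-1}\to U_0$ is a proper holomorphic map of degree $d\ge 2$ which extends to a BI map $g:\bigcup_{i\ge 1}U_{-i}\to\bigcup_{i\ge 0}U_{-i}$. Let $K\subset\bigcap_{i\ge 0}U_{-i}$ be a full compact set which is completely invariant ($g^{-1}(K)=K$) and such that $P_g\subset K$. For $n\in\mathbb{N}$ let $$R_n=\{z\in U_{-n}\cap U_0: g^n(z)=z,\ |(g^n)'(z)|>1\},$$ and let $R'$ be the set of all $z\in\mathbb{C}$ for which there exist $n_i\to\infty$ and $z_i\in R_{n_i}$ with $z_i\to z$. Then $R'$ has no points in $U_0\setminus K$.
   Context: A Jordan domain is the bounded domain enclosed by a Jordan curve in $\mathbb{C}$. Let $g:U_{-1}\to U_0$ be a proper holomorphic map of degree $d\ge 2$ between Jordan domains, and $C_g=\{z\in U_{-1}: g'(z)=0\}$ its (nonempty) critical set. BI (backward invariant) map: $g$ extends to a BI map if there exist a sequence $U_0,U_{-1},\dots,U_{-n},\dots$ of Jordan domains and a holomorphic extension $g:\bigcup_{i\ge 1}U_{-i}\to\bigcup_{i\ge 0}U_{-i}$ of $g:U_{-1}\to U_0$ such that for every $i\ge 0$: (i) $g(U_{-i-1})=U_{-i}$ and $g:U_{-i-1}\to U_{-i}$ is proper of degree $d$; (ii) $C_g\subset U_{-i-1}$ and $P_g\subset U_{-i}$, where $P_g=\overline{\bigcup_{n>0}g^n(C_g)}$ is the postcritical set. Moreover it is required that if $P_g$ is a singleton $\{c\}$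 then $g^{-1}(c)\ne\{c\}$. (It follows that all maps $g:U_{-i-1}\to U_{-i}$ have the same critical set $C_g$ and that $P_g$ is well defined.) For a set $Y$, $g^{-1}(Y)$ denotes the preimage under $g:\bigcup_{i\ge 1}U_{-i}\to\bigcup_{i\ge 0}U_{-i}$. On $U_{-n}$, $g^n$ denotes the composition $U_{-n}\to U_{-n+1}\to\dots\to U_0$, a proper map of degree $d^n$. A compact set $K\subset\mathbb{C}$ is full if $\mathbb{C}\setminus K$ is connected. *)

theory Defs
  imports "HOL-Complex_Analysis.Complex_Analysis"
begin

definition jordan_domain :: "complex set \<Rightarrow> bool" where
  "jordan_domain U \<longleftrightarrow>
     (\<exists>\<gamma>. simple_path \<gamma> \<and> pathfinish \<gamma> = pathstart \<gamma> \<and> U = inside (path_image \<gamma>))"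

(* The degree is the number of preimages of any point of V, counted with multiplicity.
   Finiteness of the fibres makes f - w nonvanishing near each of its zeros,
   so that zorder is the usual multiplicity. *)
definition proper_holomorphic_degree ::
    "nat \<Rightarrow> (complex \<Rightarrow> complex) \<Rightarrow> complex set \<Rightarrow> complex set \<Rightarrow> bool" where
  "proper_holomorphic_degree d f U V \<longleftrightarrow>
     f holomorphic_on U \<and>
     proper_map (top_of_set U) (top_of_set V) f \<and>
     (\<forall>w\<in>V. finite {z \<in> U. f z = w} \<and>
            (\<Sum>z\<in>{z \<in> U. f z = w}. zorder (\<lambda>x. f x - w) z) = int d)"

definition critical_set :: "(complex \<Rightarrow> complex) \<Rightarrow> complex set \<Rightarrow> complex set" where
  "critical_set g U = {z \<in> U. deriv g z = 0}"

(* Here and below a sequence of domains is indexed so that U i stands for U_{-i}. *)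
definition postcritical_set :: "(complex \<Rightarrow> complex) \<Rightarrow> (nat \<Rightarrow> complex set) \<Rightarrow> complex set" where
  "postcritical_set g U = closure (\<Union>n\<in>{0<..}. (g ^^ n) ` critical_set g (U 1))"

definition preimage_BI ::
    "(complex \<Rightarrow> complex) \<Rightarrow> (nat \<Rightarrow> complex set) \<Rightarrow> complex set \<Rightarrow> complex set" where
  "preimage_BI g U Y = {z \<in> (\<Union>i\<in>{1..}. U i). g z \<in> Y}"

(* The function g is total in HOL; only its values on the union of the U i, i >= 1, matter.
   Every iterate (g ^^ n) used here is taken at points whose orbit stays in that union:
   at points of U n, and at critical points, whose orbits lie in every U i by the
   condition on the postcritical set. *)
definition BI_map :: "nat \<Rightarrow> (complex \<Rightarrow> complex) \<Rightarrow> (nat \<Rightarrow> complex set) \<Rightarrow> bool" where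
  "BI_map d g U \<longleftrightarrow>
     (\<forall>i. jordan_domain (U i)) \<and>
     g holomorphic_on (\<Union>i\<in>{1..}. U i) \<and>
     (\<forall>i. g ` U (Suc i) = U i \<and> proper_holomorphic_degree d g (U (Suc i)) (U i)) \<and>
     (\<forall>i. critical_set g (U 1) \<subseteq> U (Suc i) \<and> postcritical_set g U \<subseteq> U i) \<and>
     (\<forall>c. postcritical_set g U = {c} \<longrightarrow> preimage_BI g U {c} \<noteq> {c})"

definition full_compact :: "complex set \<Rightarrow> bool" where
  "full_compact K \<longleftrightarrow> compact K \<and> connected (- K)"

definition repelling_set ::
    "(complex \<Rightarrow> complex) \<Rightarrow> (nat \<Rightarrow> complex set) \<Rightarrow> nat \<Rightarrow> complex set" where
  "repelling_set g U n =
     {z \<in> U n \<inter> U 0. (g ^^ n) z = z \<and> norm (deriv (g ^^ n) z) > 1}"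

definition repelling_limit_set ::
    "(complex \<Rightarrow> complex) \<Rightarrow> (nat \<Rightarrow> complex set) \<Rightarrow> complex set" where
  "repelling_limit_set g U =
     {z. \<exists>m \<zeta>. filterlim m at_top sequentially \<and>
            (\<forall>i. \<zeta> i \<in> repelling_set g U (m i)) \<and> \<zeta> \<longlonglongrightarrow> z}"

end

theory Submission
  imports Defs
begin

text \<open>
  Away from \<open>K\<close> the iterates of \<open>g\<close> are coverings, and their inverse branches omit the values in \<open>K\<close>.
  Suppose that periodic points \<open>\<zeta>\<^sub>i\<close> accumulate at \<open>z \<in> U\<^sub>0 - K\<close>. The branches near \<open>z\<close> that fix the \<open>\<zeta>\<^sub>i\<close>
  form a normal family; pass to a limit \<open>\<phi>\<close>.

  If \<open>\<phi>\<close> is not constant, then composing iterates with later branches yields inverse branches of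
  positive iterates that converge to the identity. By Vitali's theorem they do so along a loop around \<open>K\<close>,
  whose lift under \<open>g\<^sup>l\<close> is then closed and has winding number 1 around \<open>K\<close>, whereas its image must have
  winding number \<open>d\<^sup>l\<close>.

  If \<open>\<phi>\<close> is constant, then the lifts of the loop cannot close up, so for every \<open>m\<close> some iterate has at least \<open>m\<close>
  branches with values near \<open>z\<close> over every point of a disc \<open>D\<close> close to \<open>K\<close>. A smooth count of the preimages near
  \<open>z\<close> is large on \<open>D\<close> and constant near \<open>K\<close>, while by a change of variables its Dirichlet energy is bounded
  by the area around \<open>z\<close>. This contradicts the positive capacity of \<open>K\<close>, which comes from the backward random
  walk of \<open>g \<circ> g\<close> on \<open>K\<close>: its distributions decay on balls like a power of the radius, because the preimages
  of a point under \<open>g \<circ> g\<close> never cluster.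
\<close>

section \<open>Holomorphic functions that omit two values\<close>

text \<open>Nothing in the hypotheses nests the domains \<open>U n\<close> or bounds them uniformly,
  so no hyperbolic contraction is at hand. The uniform control over inverse branches comes from the
  values in \<open>K\<close>, of which there are at least two: Schottky's theorem turns their
  omission into local bounds as soon as the values at one point are bounded. For
  \<open>g ^^ n\<close> to be a covering outside \<open>K\<close>, the critical points on every
  level have to lie in \<open>K\<close>: the Riemann-Hurwitz count is d - 1 on each level, and the
  critical points of \<open>U 1\<close> already exhaust it. The same count limits total ramification
  to one point, which is why two steps of \<open>g\<close>, and not one, are taken before no fibre
  can cluster. A plain count F of preimages would have an energy that grows with their number; sqrt
  (1 + F) has bounded energy and still becomes arbitrarily large, and this is what the capacity
  estimate forbids.\<close>

lemma omitting_two_values_bounded: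
  fixes a b w :: complex
  assumes "a \<noteq> b" "0 \<le> t" "t < 1" "0 < R"
  obtains B where "\<And>f z. \<lbrakk>f holomorphic_on ball w R; \<And>x. x \<in> ball w R \<Longrightarrow> f x \<noteq> a \<and> f x \<noteq> b;
      norm (f w) \<le> r; dist w z \<le> t * R\<rbrakk> \<Longrightarrow> norm (f z) \<le> B"
proof -
  \<comment> \<open>\<open>Schottky\<close> concerns the closed unit disc and the omitted values 0
    and 1. A disc of radius \<open>s * R\<close> with t < s < 1 has its closure inside the domain
    and still contains the points considered, so that rescaling it to the unit disc keeps them
    within a radius \<open>q\<close> < 1.\<close>
  define s where "s = (1 + t) / 2"
  have s: "0 < s" "s < 1" "t < s" using assms by (auto simp: s_def)
  \<comment> \<open>The value 1/2 serves t = 0, where t / s would not be positive.\<close>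
  define q where "q = (if t = 0 then 1/2 else t / s)"
  have q: "0 < q" "q < 1" "t / s \<le> q" using s assms by (auto simp: q_def divide_simps)
  define r' where "r' = (\<bar>r\<bar> + norm a) / norm (b - a)"
  \<comment> \<open>The bound of \<open>Schottky\<close>: it depends on the size at the centre and
    on \<open>q\<close>, not on the function.\<close>
  define C where "C = exp (pi * exp (pi * (2 + 2 * r' + 12 * q / (1 - q))))"
  show ?thesis
  proof
    fix f z
    assume f: "f holomorphic_on ball w R" "\<And>x. x \<in> ball w R \<Longrightarrow> f x \<noteq> a \<and> f x \<noteq> b"
      "norm (f w) \<le> r" "dist w z \<le> t * R"
    define h where "h = (\<lambda>\<zeta>. (f (w + of_real (s * R) * \<zeta>) - a) / (b - a))"
    have sub: "w + of_real (s * R) * \<zeta> \<in> ball w R" if "\<zeta> \<in> cball 0 1" for \<zeta>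
    proof -
      have "norm (of_real (s * R) * \<zeta>) \<le> s * R * 1"
        using that s assms(4) by (simp add: norm_mult mult_left_le)
      also have "\<dots> < R" using s assms(4) by simp
      finally have "norm (of_real (s * R) * \<zeta>) < R" .
      then show ?thesis by (simp add: dist_norm norm_minus_commute)
    qed
    have "(f \<circ> (\<lambda>\<zeta>. w + of_real (s * R) * \<zeta>)) holomorphic_on cball 0 1"
      by (rule holomorphic_on_compose_gen[OF _ f(1)]) (use sub in \<open>auto intro!: holomorphic_intros simp: image_subset_iff\<close>)
    then have hol: "h holomorphic_on cball 0 1"
      unfolding h_def using assms(1) by (auto intro!: holomorphic_intros simp: o_def)
    define \<zeta> where "\<zeta> = (z - w) / of_real (s * R)"
    have "norm (f w - a) \<le> \<bar>r\<bar> + norm a"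
      using f(3) norm_triangle_ineq4[of "f w" a] by linarith
    then have h0: "norm (h 0) \<le> r'"
      unfolding h_def r'_def by (simp add: norm_divide divide_right_mono)
    have n01: "\<not> (h z = 0 \<or> h z = 1)" if "z \<in> cball 0 1" for z
      using f(2)[OF sub[OF that]] assms(1) by (auto simp: h_def)
    have "norm \<zeta> \<le> q"
    proof -
      have "norm \<zeta> = norm (z - w) / (s * R)" using s assms(4) by (simp add: \<zeta>_def norm_divide norm_mult)
      also have "\<dots> \<le> t * R / (s * R)"
        using f(4) s assms(4) by (intro divide_right_mono) (auto simp: dist_norm norm_minus_commute)
      also have "\<dots> = t / s" using assms(4) by simp
      finally show ?thesis using q by simp
    qed
    from Schottky[OF hol h0 n01 q(1,2) this]
    have "norm (h \<zeta>) \<le> C" by (simp add: C_def)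
    moreover have "w + of_real (s * R) * \<zeta> = z" using s assms(4) by (simp add: \<zeta>_def)
    ultimately have "norm (f z - a) / norm (b - a) \<le> C"
      by (simp add: h_def norm_divide)
    then have "norm (f z - a) \<le> C * norm (b - a)" using assms(1) by (simp add: divide_simps split: if_splits)
    then show "norm (f z) \<le> C * norm (b - a) + norm a"
      using norm_triangle_sub[of "f z" a] by linarith
  qed
qed

text \<open>Convergence at the centre bounds the values there, so the two omitted values make the
  family locally bounded. If uniform convergence failed, a subsequence would stay away from
  \<open>A\<close> somewhere on \<open>Q\<close>; by Montel a further subsequence converges, and its
  limit equals \<open>A\<close> by the identity theorem.\<close>

lemma Vitali_omitting_ball:
  fixes f :: "nat \<Rightarrow> complex \<Rightarrow> complex"
  assumes "a \<noteq> b" "0 < e" "ball w e \<subseteq> ball w R"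
    and hol: "\<And>i. f i holomorphic_on ball w R"
    and om: "\<And>i x. x \<in> ball w R \<Longrightarrow> f i x \<noteq> a \<and> f i x \<noteq> b"
    and lim: "\<And>x. x \<in> ball w e \<Longrightarrow> (\<lambda>i. f i x) \<longlonglongrightarrow> A x"
    and A: "A holomorphic_on ball w R"
    and Q: "compact Q" "Q \<subseteq> ball w R"
  shows "uniform_limit Q f A sequentially"
proof (rule ccontr)
  have R: "0 < R" using assms(2,3) by (metis ball_eq_empty centre_in_ball in_mono not_less)
  assume "\<not> uniform_limit Q f A sequentially"
  then obtain \<epsilon> where \<epsilon>: "\<epsilon> > 0" "\<not> (\<forall>\<^sub>F n in sequentially. \<forall>x\<in>Q. dist (f n x) (A x) < \<epsilon>)"
    unfolding uniform_limit_iff by auto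
  then have inf: "\<exists>n\<ge>N. \<not> (\<forall>x\<in>Q. dist (f n x) (A x) < \<epsilon>)" for N
    unfolding eventually_sequentially by auto
  obtain s :: "nat \<Rightarrow> nat" where s: "strict_mono s" "\<And>n. \<not> (\<forall>x\<in>Q. dist (f (s n) x) (A x) < \<epsilon>)"
  proof -
    have "infinite {n. \<not> (\<forall>x\<in>Q. dist (f n x) (A x) < \<epsilon>)}"
      unfolding infinite_nat_iff_unbounded_le using inf by auto
    from infinite_enumerate[OF this] show ?thesis using that by auto
  qed
  have "(\<lambda>i. f i w) \<longlonglongrightarrow> A w" using lim assms(2) by simp
  then obtain r where r: "\<And>i. norm (f i w) \<le> r"
    by (meson Bseq_def convergentI convergent_imp_Bseq)
  have bd: "\<exists>B. \<forall>h \<in> range f. \<forall>z\<in>C. norm (h z) \<le> B" if C: "compact C" "C \<subseteq> ball w R" for C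
  proof -
    have "\<exists>t. 0 \<le> t \<and> t < 1 \<and> C \<subseteq> cball w (t * R)"
    proof (cases "C = {}")
      case False
      obtain c where c: "c \<in> C" "\<And>x. x \<in> C \<Longrightarrow> dist w x \<le> dist w c"
        using continuous_attains_sup[OF C(1) False, of "dist w"] continuous_on_dist[OF continuous_on_const continuous_on_id]
        by blast
      show ?thesis using c C(2) R by (intro exI[of _ "dist w c / R"]) auto
    qed (auto intro: exI[of _ 0])
    then obtain t where t: "0 \<le> t" "t < 1" "C \<subseteq> cball w (t * R)" by blast
    obtain B where B: "\<And>f z. \<lbrakk>f holomorphic_on ball w R; \<And>x. x \<in> ball w R \<Longrightarrow> f x \<noteq> a \<and> f x \<noteq> b;
      norm (f w) \<le> r; dist w z \<le> t * R\<rbrakk> \<Longrightarrow> norm (f z) \<le> B"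
      using omitting_two_values_bounded[OF assms(1) t(1,2) R] by blast
    show ?thesis using B hol om r t(3) by (intro exI[of _ B]) fastforce
  qed
  have rng: "range (f \<circ> s) \<subseteq> range f" by auto
  obtain G r' where G: "G holomorphic_on ball w R" "strict_mono (r' :: nat \<Rightarrow> nat)"
     "\<And>x. x \<in> ball w R \<Longrightarrow> ((\<lambda>n. (f \<circ> s) (r' n) x) \<longlongrightarrow> G x) sequentially"
     "\<And>K. \<lbrakk>compact K; K \<subseteq> ball w R\<rbrakk> \<Longrightarrow> uniform_limit K ((f \<circ> s) \<circ> r') G sequentially"
    by (rule Montel[OF open_ball _ bd rng]) (use hol in auto)
  have "G x = A x" if "x \<in> ball w e" for x
  proof (rule LIMSEQ_unique)
    show "(\<lambda>n. f ((s \<circ> r') n) x) \<longlonglongrightarrow> A x"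
      using LIMSEQ_subseq_LIMSEQ[OF lim[OF that] strict_mono_o[OF s(1) G(2)]] by (simp add: o_def)
    show "(\<lambda>n. f ((s \<circ> r') n) x) \<longlonglongrightarrow> G x" using G(3)[of x] that assms(3) by (auto simp: o_def)
  qed
  then have "G x = A x" if "x \<in> ball w R" for x
    using analytic_continuation_open[OF open_ball open_ball _ _ assms(3) G(1) A _ that] assms(2) by auto
  then have "uniform_limit Q ((f \<circ> s) \<circ> r') A sequentially"
    using G(4)[OF Q] Q(2) by (subst uniform_limit_cong'[where g = "(f \<circ> s) \<circ> r'" and i = G]) auto
  then have "\<forall>\<^sub>F n in sequentially. \<forall>x\<in>Q. dist (f (s (r' n)) x) (A x) < \<epsilon>"
    using \<epsilon>(1) by (auto simp: uniform_limit_iff)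
  then show False using s(2) by (auto simp: eventually_sequentially)
qed

text \<open>A general domain has no single centre from which Schottky's bound reaches everything.
  Convergence is therefore carried from ball to ball, and \<open>Q\<close> is finally covered by
  finitely many balls.\<close>

lemma Vitali_omitting:
  fixes f :: "nat \<Rightarrow> complex \<Rightarrow> complex"
  assumes "a \<noteq> b" "open S" "connected S" "w \<in> S" "0 < e" "ball w e \<subseteq> S"
    and hol: "\<And>i. f i holomorphic_on S"
    and om: "\<And>i x. x \<in> S \<Longrightarrow> f i x \<noteq> a \<and> f i x \<noteq> b"
    and lim: "\<And>x. x \<in> ball w e \<Longrightarrow> (\<lambda>i. f i x) \<longlonglongrightarrow> A x"
    and A: "A holomorphic_on S"
    and Q: "compact Q" "Q \<subseteq> S"
  shows "uniform_limit Q f A sequentially"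
proof -
  have ball: "uniform_limit C f A sequentially"
    if "0 < \<delta>" "ball u \<delta> \<subseteq> ball u r" "ball u r \<subseteq> S" "\<And>x. x \<in> ball u \<delta> \<Longrightarrow> (\<lambda>i. f i x) \<longlonglongrightarrow> A x"
      "compact C" "C \<subseteq> ball u r" for u \<delta> r C
    using that by (intro Vitali_omitting_ball[OF assms(1) that(1,2)])

      (use om in \<open>auto intro: holomorphic_on_subset[OF hol] holomorphic_on_subset[OF A] simp: subset_iff\<close>)
  define V where "V = {u \<in> S. \<exists>\<delta>>0. ball u \<delta> \<subseteq> S \<and> (\<forall>x \<in> ball u \<delta>. (\<lambda>i. f i x) \<longlonglongrightarrow> A x)}"
  \<comment> \<open>The radius \<open>r\<close> is limited by \<open>S\<close> only, not by the
    radius on which convergence is already known; this is what makes \<open>V\<close> relatively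
    closed.\<close>
  have step: "ball u r \<subseteq> V" if uV: "u \<in> V" and uS: "ball u r \<subseteq> S" and r0: "0 < r" for u r
  proof
    fix x assume x: "x \<in> ball u r"
    obtain \<delta> where \<delta>: "\<delta> > 0" "\<forall>x \<in> ball u \<delta>. (\<lambda>i. f i x) \<longlonglongrightarrow> A x"
    proof -
      have "\<exists>\<delta>>0. ball u \<delta> \<subseteq> S \<and> (\<forall>x \<in> ball u \<delta>. (\<lambda>i. f i x) \<longlonglongrightarrow> A x)"
        using uV unfolding V_def mem_Collect_eq by (elim conjE)
      then show ?thesis using that by (elim exE conjE)
    qed
    obtain \<eta> where \<eta>: "\<eta> > 0" "ball x \<eta> \<subseteq> ball u r"
      by (rule openE[OF open_ball x])
    have "(\<lambda>i. f i y) \<longlonglongrightarrow> A y" if "y \<in> ball u r" for y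
    proof -
      have "uniform_limit {y} f A sequentially"
        by (rule ball[of "min \<delta> r" u r]) (use \<delta> that r0 uS in auto)
      then show ?thesis by (rule tendsto_uniform_limitI) simp
    qed
    then have "\<forall>y \<in> ball x \<eta>. (\<lambda>i. f i y) \<longlonglongrightarrow> A y" using \<eta>(2) by (meson subsetD)
    moreover have "x \<in> S" "ball x \<eta> \<subseteq> S" using \<eta>(2) x uS by (meson subsetD order_trans)+
    ultimately show "x \<in> V" unfolding V_def mem_Collect_eq using \<eta>(1) by (intro conjI exI)
  qed
  have "w \<in> V" unfolding V_def using assms(4-6) lim by blast
  moreover have "V = {} \<or> V = S"
  proof (rule connected_clopen[THEN iffD1, rule_format, OF assms(3)])
    show "openin (top_of_set S) V \<and> closedin (top_of_set S) V"
    proof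
      have "open V"
      proof (subst open_contains_ball, intro ballI)
        fix u assume "u \<in> V"
        then obtain r where "r > 0" "ball u r \<subseteq> S" unfolding V_def by auto
        then show "\<exists>e>0. ball u e \<subseteq> V" using step[OF \<open>u \<in> V\<close>] by blast
      qed
      then show "openin (top_of_set S) V" using openin_open_eq[OF assms(2)] by (auto simp: V_def)
      show "closedin (top_of_set S) V"
      proof (subst closedin_limpt, intro conjI allI impI)
        show "V \<subseteq> S" by (auto simp: V_def)
        fix x assume x: "x islimpt V \<and> x \<in> S"
        obtain r where r: "r > 0" "ball x r \<subseteq> S" using x assms(2) by (meson open_contains_ball)
        obtain u where u: "u \<in> V" "dist u x < r/2"
          using x r(1) by (metis half_gt_zero islimpt_approachable)
        have "ball u (r/2) \<subseteq> ball x r"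
        proof
          fix y assume "y \<in> ball u (r/2)"
          then show "y \<in> ball x r" using u(2) dist_triangle[of x y u] by (simp add: dist_commute)
        qed
        then have "x \<in> ball u (r/2)" "ball u (r/2) \<subseteq> S" using u r by auto
        moreover have "0 < r/2" using r(1) by simp
        ultimately show "x \<in> V" using step[OF u(1)] by (meson subsetD)
      qed
    qed
  qed
  ultimately have "V = S" by blast
  then have ptw: "(\<lambda>i. f i y) \<longlonglongrightarrow> A y" if "y \<in> S" for y
    using that unfolding V_def by force
  obtain r where r: "r > 0" "\<And>x. x \<in> Q \<Longrightarrow> cball x r \<subseteq> S"
  proof -
    obtain r where "r > 0" "(\<Union>x\<in>Q. cball x r) \<subseteq> S"
      using compact_subset_open_imp_cball_epsilon_subset[OF Q(1) assms(2) Q(2)] by blast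
    then show ?thesis using that by blast
  qed
  have "\<exists>T \<subseteq> Q. finite T \<and> Q \<subseteq> (\<Union>x\<in>T. ball x (r/2))"
  proof -
    obtain T where "T \<subseteq> Q" "finite T" "Q \<subseteq> (\<Union>x\<in>T. ball x (r/2))"
      using compactE_image[OF Q(1), of Q "\<lambda>x. ball x (r/2)"] r(1) by force
    then show ?thesis by blast
  qed
  then obtain T where T: "T \<subseteq> Q" "finite T" "Q \<subseteq> (\<Union>x\<in>T. ball x (r/2))" by blast
  have "uniform_limit (cball x (r/2)) f A sequentially" if "x \<in> T" for x
  proof (rule ball[of r x r])
    have "cball x r \<subseteq> S" using r(2) T(1) that by blast
    then show xS: "ball x r \<subseteq> S" using ball_subset_cball by blast
    show "(\<lambda>i. f i y) \<longlonglongrightarrow> A y" if "y \<in> ball x r" for y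
      using ptw xS that by blast
    show "cball x (r/2) \<subseteq> ball x r" using r(1) by (auto simp: dist_commute)
  qed (use r(1) in \<open>simp_all\<close>)
  then have "uniform_limit (\<Union>x\<in>T. cball x (r/2)) f A sequentially"
    using T(2) by (intro uniform_limit_on_UNION)
  moreover have "Q \<subseteq> (\<Union>x\<in>T. cball x (r/2))"
    using T(3) UN_mono[OF order_refl ball_subset_cball] by (rule order_trans)
  ultimately show ?thesis
    by (rule uniform_limit_on_subset)
qed

section \<open>Winding numbers and proper coverings\<close>

text \<open>The argument principle for a merely continuous loop. The loop is replaced by a nearby
  polynomial one, homotopic to it off the zeros of f - c, and simple connectivity makes the winding
  numbers about points outside \<open>S\<close> vanish.\<close>

lemma winding_number_holomorphic_compose:
  assumes S: "open S" "simply_connected S" and f: "f holomorphic_on S"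
    and fin: "finite {z\<in>S. f z = c}"
    and \<sigma>: "path \<sigma>" "pathfinish \<sigma> = pathstart \<sigma>" "path_image \<sigma> \<subseteq> S - {z\<in>S. f z = c}"
  shows "winding_number (f \<circ> \<sigma>) c = (\<Sum>z\<in>{z\<in>S. f z = c}. winding_number \<sigma> z * zorder (\<lambda>x. f x - c) z)"
proof -
  define Z where "Z = {z\<in>S. f z = c}"
  have oS: "open (S - Z)" using S(1) fin unfolding Z_def by (simp add: finite_imp_closed open_Diff)
  obtain d where d: "0 < d" "\<And>h. \<lbrakk>path h; pathfinish h = pathstart h; \<forall>t\<in>{0..1}. norm (h t - \<sigma> t) < d\<rbrakk>
      \<Longrightarrow> homotopic_loops (S - Z) \<sigma> h"
    using homotopic_nearby_loops[OF \<sigma>(1) oS] \<sigma>(2,3) unfolding Z_def by metis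
  obtain p where p: "polynomial_function p" "pathstart p = pathstart \<sigma>" "pathfinish p = pathfinish \<sigma>"
     "\<And>t. t \<in> {0..1} \<Longrightarrow> norm (p t - \<sigma> t) < d"
    using path_approx_polynomial_function[OF \<sigma>(1) d(1)] by blast
  have vp: "valid_path p" using p(1) by (rule valid_path_polynomial_function)
  have hom: "homotopic_loops (S - Z) \<sigma> p"
    using d(2)[of p] p \<sigma>(2) vp by (simp add: valid_path_imp_path)
  have pim: "path_image p \<subseteq> S - Z" using homotopic_loops_imp_subset[OF hom] by simp
  have loop: "pathfinish p = pathstart p" using p \<sigma>(2) by simp
  have "homotopic_loops (- {c}) (f \<circ> \<sigma>) (f \<circ> p)"
    by (rule homotopic_loops_continuous_image[OF hom])
       (use f in \<open>auto simp: Z_def intro: holomorphic_on_imp_continuous_on holomorphic_on_subset\<close>)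
  then have "winding_number (f \<circ> \<sigma>) c = winding_number (f \<circ> p) c"
    by (rule winding_number_homotopic_loops)
  also have "\<dots> = 1 / (2 * pi * \<i>) * contour_integral (f \<circ> p) (\<lambda>w. 1 / (w - c))"
  proof (rule winding_number_valid_path)
    show "valid_path (f \<circ> p)"
      using valid_path_compose_holomorphic[OF vp f S(1)] pim by auto
    show "c \<notin> path_image (f \<circ> p)" using pim by (auto simp: path_image_compose Z_def)
  qed
  also have "contour_integral (f \<circ> p) (\<lambda>w. 1 / (w - c)) = contour_integral p (\<lambda>w. deriv f w * (1 / (f w - c)))"
    by (rule contour_integral_comp_analyticW[of f S])
       (use f S pim vp in \<open>auto simp: analytic_on_open\<close>)
  also have "\<dots> = contour_integral p (\<lambda>x. deriv (\<lambda>x. f x - c) x * 1 / (f x - c))"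
  proof (rule contour_integral_cong)
    fix x assume "x \<in> path_image p"
    then have "f field_differentiable at x"
      using pim f S(1) holomorphic_on_imp_differentiable_at by blast
    then show "deriv f x * (1 / (f x - c)) = deriv (\<lambda>x. f x - c) x * 1 / (f x - c)"
      by (subst deriv_diff) auto
  qed simp
  also have "\<dots> = 2 * pi * \<i> * (\<Sum>z\<in>{z\<in>S. f z - c = 0 \<or> z \<in> {}}. winding_number p z * 1 * zorder (\<lambda>x. f x - c) z)"
  proof (rule argument_principle[OF S(1)])
    show "connected S" using S(2) by (rule simply_connected_imp_connected)
    show "(\<lambda>x. f x - c) holomorphic_on S - {}" using f by (auto intro!: holomorphic_intros)
    show "\<forall>z. z \<notin> S \<longrightarrow> winding_number p z = 0"
      using simply_connected_imp_winding_number_zero[OF S(2) valid_path_imp_path[OF vp] _ loop] pim by auto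
    show "path_image p \<subseteq> S - {w \<in> S. f w - c = 0 \<or> w \<in> {}}" using pim by (auto simp: Z_def)
  qed (use loop vp fin in auto)
  also have "1 / (2 * pi * \<i>) * \<dots> = (\<Sum>z\<in>{z\<in>S. f z - c = 0 \<or> z \<in> {}}. winding_number p z * zorder (\<lambda>x. f x - c) z)"
    by simp
  also have "\<dots> = (\<Sum>z\<in>{z\<in>S. f z = c}. winding_number \<sigma> z * zorder (\<lambda>x. f x - c) z)"
  proof (rule sum.cong)
    fix z assume "z \<in> {z\<in>S. f z = c}"
    then have "homotopic_loops (- {z}) \<sigma> p"
      by (intro homotopic_loops_subset[OF hom]) (auto simp: Z_def)
    then show "winding_number p z * zorder (\<lambda>x. f x - c) z = winding_number \<sigma> z * zorder (\<lambda>x. f x - c) z"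
      by (simp add: winding_number_homotopic_loops)
  qed auto
  finally show ?thesis .
qed

lemma proper_map_top_of_setD:
  assumes "proper_map (top_of_set S) (top_of_set T) f"
  shows "f ` S \<subseteq> T" "\<And>C. \<lbrakk>compact C; C \<subseteq> T\<rbrakk> \<Longrightarrow> compact {x\<in>S. f x \<in> C}"
    "\<And>C. closedin (top_of_set S) C \<Longrightarrow> closedin (top_of_set T) (f ` C)"
proof -
  show "f ` S \<subseteq> T" using proper_map_imp_subset_topspace[OF assms] by auto
  show "compact {x\<in>S. f x \<in> C}" if "compact C" "C \<subseteq> T" for C
    using compactin_proper_map_preimage[OF assms, of C] that by (simp add: compactin_subtopology)
  show "closedin (top_of_set T) (f ` C)" if "closedin (top_of_set S) C" for C
    using proper_imp_closed_map[OF assms] that by (simp add: closed_map_def)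
qed

text \<open>An infinite compact fibre would accumulate at one of its own points, near which
  \<open>f\<close> is injective.\<close>

lemma finite_fibre_local_homeomorphism:
  assumes "open S" "f holomorphic_on S" "\<And>x. x \<in> S \<Longrightarrow> deriv f x \<noteq> 0" "compact {x\<in>S. f x = w}"
  shows "finite {x\<in>S. f x = w}"
proof (rule ccontr)
  assume "infinite {x\<in>S. f x = w}"
  then obtain x where x: "x \<in> S" "f x = w" "x islimpt {x\<in>S. f x = w}"
    using assms(4)[unfolded compact_eq_Bolzano_Weierstrass, rule_format, of "{x\<in>S. f x = w}"] by blast
  obtain r where r: "r > 0" "ball x r \<subseteq> S" "inj_on f (ball x r)"
    using has_complex_derivative_locally_injective[OF assms(2) x(1) assms(1) assms(3)[OF x(1)]] by blast
  obtain y where "y \<in> {x\<in>S. f x = w}" "y \<in> ball x r" "y \<noteq> x"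
    by (rule islimptE[OF x(3) _ open_ball[of x r]]) (use r(1) in auto)
  then show False using r x(2) by (auto dest: inj_onD)
qed

text \<open>A proper local homeomorphism is a covering: take disjoint discs of injectivity around
  the finitely many points of a fibre; properness ensures that values close enough have no further
  preimages outside these discs.\<close>

lemma covering_space_proper_holomorphic:
  assumes "open S" "open T" "f holomorphic_on S" "f ` S = T"
    and nz: "\<And>x. x \<in> S \<Longrightarrow> deriv f x \<noteq> 0"
    and proper: "\<And>C. \<lbrakk>compact C; C \<subseteq> T\<rbrakk> \<Longrightarrow> compact {x\<in>S. f x \<in> C}"
  shows "covering_space S f T"
proof
  show cont: "continuous_on S f" using assms(3) by (rule holomorphic_on_imp_continuous_on)
  show "f ` S = T" by fact
  fix w assume w: "w \<in> T"
  define Z where "Z = {x\<in>S. f x = w}"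
  have "finite Z" unfolding Z_def
    using finite_fibre_local_homeomorphism[OF assms(1,3) nz, of w] proper[of "{w}"] w by auto
  have "\<exists>r. r > 0 \<and> ball x r \<subseteq> S \<and> inj_on f (ball x r)" if "x \<in> Z" for x
    using has_complex_derivative_locally_injective[OF assms(3) _ assms(1) nz, of x] that unfolding Z_def by blast
  then obtain r0 where r0: "\<And>x. x \<in> Z \<Longrightarrow> r0 x > 0 \<and> ball x (r0 x) \<subseteq> S \<and> inj_on f (ball x (r0 x))" by metis
  obtain \<delta> where \<delta>: "\<delta> > 0" "\<And>x y. \<lbrakk>x \<in> Z; y \<in> Z; x \<noteq> y\<rbrakk> \<Longrightarrow> \<delta> \<le> dist x y"
  proof -
    have "uniform_discrete Z" using \<open>finite Z\<close> uniform_discrete_finite_iff by blast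
    then obtain e where "e > 0" "\<forall>x\<in>Z. \<forall>y\<in>Z. dist x y < e \<longrightarrow> x = y" unfolding uniform_discrete_def by blast
    then show ?thesis using that[of e] by (meson not_le)
  qed
  define r where "r = (\<lambda>x. min (r0 x) (\<delta>/2))"
  have r: "r x > 0" "ball x (r x) \<subseteq> S" "inj_on f (ball x (r x))" if "x \<in> Z" for x
    using r0[OF that] \<delta>(1) unfolding r_def by (auto intro: inj_on_subset)
  have dis: "ball x (r x) \<inter> ball y (r y) = {}" if "x \<in> Z" "y \<in> Z" "x \<noteq> y" for x y
  proof (rule ccontr)
    assume "\<not> ?thesis"
    then obtain v where "dist x v < r x" "dist y v < r y" by auto
    then have "dist x y < \<delta>" using dist_triangle2[of x y v] unfolding r_def by linarith
    then show False using \<delta>(2)[OF that] by simp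
  qed
  have opn: "open (f ` ball x (r x))" if "x \<in> Z" for x
    using open_mapping_thm3[of f "ball x (r x)"] holomorphic_on_subset[OF assms(3) r(2)[OF that]] r(3)[OF that] by auto
  obtain \<eta>0 where \<eta>0: "\<eta>0 > 0" "cball w \<eta>0 \<subseteq> T" using w assms(2) by (meson open_contains_cball)
  define B where "B = (\<Union>x\<in>Z. ball x (r x))"
  \<comment> \<open>\<open>C\<close> holds the preimages of values near \<open>w\<close> that avoid
    all the discs. It is compact and its image misses \<open>w\<close>, so removing that image
    leaves a neighbourhood of \<open>w\<close> whose preimages all lie in the discs.\<close>
  define C where "C = {x\<in>S. f x \<in> cball w \<eta>0} - B"
  have "compact C" unfolding C_def B_def using proper[of "cball w \<eta>0"] \<eta>0 by (intro compact_diff) auto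
  then have cfC: "compact (f ` C)"
    by (intro compact_continuous_image continuous_on_subset[OF cont]) (auto simp: C_def)
  have "w \<notin> f ` C" using r(1) by (auto simp: C_def B_def Z_def)
  then have "open (- (f ` C))" "w \<in> - (f ` C)" using cfC by (auto simp: compact_imp_closed open_Compl)
  define O' where "O' = ball w \<eta>0 \<inter> - (f ` C) \<inter> (\<Inter>x\<in>Z. f ` ball x (r x))"
  have "open O'" unfolding O'_def using \<open>open (- (f ` C))\<close> opn \<open>finite Z\<close> by (intro open_Int open_INT) auto
  have "w \<in> O'" unfolding O'_def using \<open>w \<in> - (f ` C)\<close> \<eta>0 r(1) by (force simp: Z_def)
  have O'T: "O' \<subseteq> T" using \<eta>0 by (auto simp: O'_def)
  define v where "v = (\<lambda>x. ball x (r x) \<inter> f -` O') ` Z"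
  have Un: "\<Union>v = S \<inter> f -` O'"
  proof
    show "\<Union>v \<subseteq> S \<inter> f -` O'" using r(2) by (auto simp: v_def)
    show "S \<inter> f -` O' \<subseteq> \<Union>v"
    proof
      fix x assume x: "x \<in> S \<inter> f -` O'"
      then have "x \<in> B" unfolding O'_def C_def by auto
      then show "x \<in> \<Union>v" using x by (auto simp: v_def B_def)
    qed
  qed
  have opv: "open (ball x (r x) \<inter> f -` O')" if "x \<in> Z" for x
    using continuous_open_preimage[OF continuous_on_subset[OF cont r(2)[OF that]] _ \<open>open O'\<close>] by auto
  have hom: "\<exists>q. homeomorphism (ball x (r x) \<inter> f -` O') O' f q" if "x \<in> Z" for x
  proof -
    have inj: "inj_on f (ball x (r x))" and sub: "ball x (r x) \<subseteq> S" using r[OF that] by auto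
    obtain q where q: "q holomorphic_on (f ` ball x (r x))"
      "\<And>z. z \<in> ball x (r x) \<Longrightarrow> deriv f z * deriv q (f z) = 1" "\<And>z. z \<in> ball x (r x) \<Longrightarrow> q (f z) = z"
      using holomorphic_has_inverse[OF holomorphic_on_subset[OF assms(3) sub] open_ball inj] by metis
    have subO: "O' \<subseteq> f ` ball x (r x)" using that by (auto simp: O'_def)
    show "\<exists>q. homeomorphism (ball x (r x) \<inter> f -` O') O' f q"
    proof (intro exI homeomorphismI)
      show "continuous_on (ball x (r x) \<inter> f -` O') f"
        using r(2)[OF that] by (intro continuous_on_subset[OF cont]) auto
      show "continuous_on O' q"
        using subO q(1) by (meson continuous_on_subset holomorphic_on_imp_continuous_on)
      show "q ` O' \<subseteq> ball x (r x) \<inter> f -` O'" using subO q(3) by fastforce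
      show "f (q y) = y" if "y \<in> O'" for y using subO q(3) that by fastforce
    qed (use q(3) in auto)
  qed
  show "\<exists>T'. w \<in> T' \<and> openin (top_of_set T) T' \<and>
            (\<exists>v. \<Union> v = S \<inter> f -` T' \<and> (\<forall>u\<in>v. openin (top_of_set S) u) \<and>
                 pairwise disjnt v \<and> (\<forall>u\<in>v. \<exists>q. homeomorphism u T' f q))"
  proof (intro exI[of _ O'] conjI exI[of _ v])
    show "openin (top_of_set T) O'" using \<open>open O'\<close> O'T by (simp add: openin_open_eq assms(2))
    show "\<forall>u\<in>v. openin (top_of_set S) u"
      using opv r(2) by (auto simp: v_def openin_open_eq assms(1))
    show "pairwise disjnt v" using dis unfolding v_def pairwise_def disjnt_def by blast
    show "\<forall>u\<in>v. \<exists>q. homeomorphism u O' f q" using hom by (auto simp: v_def)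
  qed (use \<open>w \<in> O'\<close> Un in auto)
qed

text \<open>A continuous lift is holomorphic because near each point it is a local inverse of
  \<open>f\<close> composed with \<open>E\<close>.\<close>

lemma holomorphic_lift:
  assumes "open S" "f holomorphic_on S" "\<And>x. x \<in> S \<Longrightarrow> deriv f x \<noteq> 0"
    and "open V" "E holomorphic_on V" "continuous_on V \<phi>" "\<phi> ` V \<subseteq> S" "\<And>x. x \<in> V \<Longrightarrow> f (\<phi> x) = E x"
  shows "\<phi> holomorphic_on V"
proof (subst holomorphic_on_open[OF assms(4)], intro ballI)
  fix x assume x: "x \<in> V"
  then have "\<phi> x \<in> S" using assms(7) by auto
  obtain r where r: "r > 0" "ball (\<phi> x) r \<subseteq> S" "inj_on f (ball (\<phi> x) r)"
    using has_complex_derivative_locally_injective[OF assms(2) \<open>\<phi> x \<in> S\<close> assms(1) assms(3)[OF \<open>\<phi> x \<in> S\<close>]] by blast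
  obtain q where q: "q holomorphic_on (f ` ball (\<phi> x) r)" "\<And>z. z \<in> ball (\<phi> x) r \<Longrightarrow> q (f z) = z"
    using holomorphic_has_inverse[OF holomorphic_on_subset[OF assms(2) r(2)] open_ball r(3)] by metis
  define W where "W = V \<inter> \<phi> -` ball (\<phi> x) r"
  have "open W" unfolding W_def using continuous_open_preimage[OF assms(6,4) open_ball] .
  have "x \<in> W" using x r by (simp add: W_def)
  have "(q \<circ> E) holomorphic_on W"
  proof (rule holomorphic_on_compose_gen[OF _ q(1)])
    show "E holomorphic_on W" using assms(5) by (rule holomorphic_on_subset) (auto simp: W_def)
    show "E ` W \<subseteq> f ` ball (\<phi> x) r" using assms(8) by (force simp: W_def)
  qed
  then have "\<phi> holomorphic_on W"
    by (rule holomorphic_transform) (use q(2) assms(8) in \<open>auto simp: W_def simp flip: assms(8)\<close>)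
  then show "\<exists>f'. (\<phi> has_field_derivative f') (at x)"
    using \<open>open W\<close> \<open>x \<in> W\<close> by (auto simp: holomorphic_on_open)
qed

section \<open>The Riemann--Hurwitz formula for simply connected domains\<close>

lemma Riemann_map_at:
  assumes "open S" "simply_connected S" "S \<noteq> UNIV" "x \<in> S"
  obtains \<phi> \<psi> where "\<phi> holomorphic_on S" "\<psi> holomorphic_on ball 0 1"
    "\<And>z. z \<in> S \<Longrightarrow> \<phi> z \<in> ball 0 1 \<and> \<psi> (\<phi> z) = z"
    "\<And>\<zeta>. \<zeta> \<in> ball 0 1 \<Longrightarrow> \<psi> \<zeta> \<in> S \<and> \<phi> (\<psi> \<zeta>) = \<zeta>" "\<phi> x = 0"
proof -
  obtain f g where f: "f holomorphic_on S" "g holomorphic_on ball 0 1"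
    "\<forall>z \<in> S. f z \<in> ball 0 1 \<and> g (f z) = z" "\<forall>z \<in> ball 0 1. g z \<in> S \<and> f (g z) = z"
    using Riemann_mapping_theorem[of S] assms by blast
  have "f x \<in> ball 0 1" using f(3) assms(4) by blast
  then obtain h k where h: "h (f x) = 0" "h holomorphic_on ball 0 1" "h ` ball 0 1 \<subseteq> ball 0 1"
    "k holomorphic_on ball 0 1" "k ` ball 0 1 \<subseteq> ball 0 1"
    "\<And>z. z \<in> ball 0 1 \<Longrightarrow> h (k z) = z" "\<And>z. z \<in> ball 0 1 \<Longrightarrow> k (h z) = z"
    using ball_biholomorphism_exists by blast
  show ?thesis
  proof
    show "(h \<circ> f) holomorphic_on S"
      by (rule holomorphic_on_compose_gen[OF f(1) h(2)]) (use f(3) in blast)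
    show "(g \<circ> k) holomorphic_on ball 0 1"
      by (rule holomorphic_on_compose_gen[OF h(4) f(2) h(5)])
    show "(h \<circ> f) z \<in> ball 0 1 \<and> (g \<circ> k) ((h \<circ> f) z) = z" if "z \<in> S" for z
    proof -
      have "f z \<in> ball 0 1" "g (f z) = z" using f(3) that by auto
      moreover have "h (f z) \<in> ball 0 1" using h(3) \<open>f z \<in> ball 0 1\<close> by blast
      ultimately show ?thesis using h(7) by simp
    qed
    show "(g \<circ> k) \<zeta> \<in> S \<and> (h \<circ> f) ((g \<circ> k) \<zeta>) = \<zeta>" if "\<zeta> \<in> ball 0 1" for \<zeta>
    proof -
      have "k \<zeta> \<in> ball 0 1" using h(5) that by blast
      then show ?thesis using f(4) h(6)[OF that] by simp
    qed
  qed (use h(1) in simp)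
qed

lemma deriv_inverse_nonzero:
  assumes "open S" "\<phi> holomorphic_on S" "\<psi> holomorphic_on T" "open T" "\<phi> ` S \<subseteq> T" "\<And>z. z \<in> S \<Longrightarrow> \<psi> (\<phi> z) = z" "z \<in> S"
  shows "deriv \<phi> z \<noteq> 0"
proof
  assume 0: "deriv \<phi> z = 0"
  have d1: "(\<phi> has_field_derivative 0) (at z)"
    using assms(1,2,7) 0 by (metis holomorphic_derivI)
  have d2: "(\<psi> has_field_derivative deriv \<psi> (\<phi> z)) (at (\<phi> z))"
    by (rule holomorphic_derivI[OF assms(3,4)]) (use assms(5,7) in blast)
  have "((\<psi> \<circ> \<phi>) has_field_derivative 0) (at z)"
    using DERIV_chain[OF d2 d1] by simp
  moreover have "((\<lambda>z. z) has_field_derivative 0) (at z)"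
    by (rule has_field_derivative_transform_within_open[OF calculation assms(1,7)]) (use assms(6) in auto)
  ultimately show False using DERIV_unique[OF _ DERIV_ident] zero_neq_one by blast
qed

lemma zorder_simple_zero:
  assumes "open S" "f holomorphic_on S" "x \<in> S" "deriv f x \<noteq> 0"
  shows "zorder (\<lambda>z. f z - f x) x = 1"
proof (rule zorder_zero_eqI[OF _ assms(1,3)])
  show "(\<lambda>z. f z - f x) holomorphic_on S" using assms(2) by (auto intro!: holomorphic_intros)
  have "deriv (\<lambda>z. f z - f x) x = deriv f x"
    using holomorphic_on_imp_differentiable_at[OF assms(2,1,3)] by (subst deriv_diff) auto
  then show "(deriv ^^ nat 1) (\<lambda>z. f z - f x) x \<noteq> 0" using assms(4) by simp
qed auto

text \<open>Both paths have continuous logarithms because \<open>exp\<close> covers the punctured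
  plane; a winding number is the increment of a logarithm over 2 pi i, and the logarithms of the
  factors of a product add.\<close>

lemma winding_number_mult:
  assumes "path p" "path q" "0 \<notin> path_image p" "0 \<notin> path_image q"
  shows "winding_number (\<lambda>t. p t * q t) 0 = winding_number p 0 + winding_number q 0"
proof -
  have ex: "\<exists>P. path P \<and> (\<forall>t\<in>{0..1}. exp (P t) = p t)" if p: "path p" "0 \<notin> path_image p" for p :: "real \<Rightarrow> complex"
  proof -
    have "path_image p \<subseteq> - {0}" using p(2) by auto
    then obtain h where "path h" "path_image h \<subseteq> UNIV" "\<And>t. t \<in> {0..1} \<Longrightarrow> exp (h t) = p t"
      using covering_space_lift_path[OF covering_space_exp_punctured_plane p(1)] by blast
    then show ?thesis by blast
  qed
  have wn: "winding_number p 0 = (pathfinish P - pathstart P) / (2 * of_real pi * \<i>)"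
    if "path P" "\<forall>t\<in>{0..1}. exp (P t) = p t" for p P
  proof -
    have "winding_number p 0 = winding_number (exp \<circ> P) 0"
      by (rule winding_number_cong) (use that in auto)
    then show ?thesis using winding_number_compose_exp[OF that(1)] by simp
  qed
  obtain P Q where P: "path P" "\<forall>t\<in>{0..1}. exp (P t) = p t" and Q: "path Q" "\<forall>t\<in>{0..1}. exp (Q t) = q t"
    using ex assms by metis
  have "path (\<lambda>t. P t + Q t)" using P(1) Q(1) by (auto simp: path_def intro: continuous_intros)
  moreover have "\<forall>t\<in>{0..1}. exp (P t + Q t) = p t * q t" using P(2) Q(2) by (simp add: exp_add)
  ultimately show ?thesis
    unfolding wn[OF P] wn[OF Q] by (subst wn) (auto simp: pathfinish_def pathstart_def field_simps)
qed

section \<open>Proper self-maps of the disc as finite Blaschke products\<close>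

lemma divide_out_zero:
  assumes b: "b holomorphic_on S" "open S" "connected S" "a \<in> S" "b a = 0" "\<not> b constant_on S"
  obtains n h where "0 < n" "h holomorphic_on S" "\<And>z. z \<in> S \<Longrightarrow> b z = (z - a) ^ n * h z" "h a \<noteq> 0"
proof -
  obtain g r n where g: "0 < n" "0 < r" "ball a r \<subseteq> S" "g holomorphic_on ball a r"
     "\<And>w. w \<in> ball a r \<Longrightarrow> b w = (w - a)^n * g w" "\<And>w. w \<in> ball a r \<Longrightarrow> g w \<noteq> 0"
    by (rule holomorphic_factor_zero_nonconstant[OF b]) blast
  define u where "u = (\<lambda>w. if w = a then g a else b w / (w - a)^n)"
  have ug: "u w = g w" if "w \<in> ball a r" for w
    using g(5)[OF that] by (auto simp: u_def)
  have u1: "u holomorphic_on ball a r" using g(4) by (rule holomorphic_transform) (use ug in auto)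
  have "(\<lambda>w. b w / (w - a)^n) holomorphic_on (S - {a})"
    by (intro holomorphic_intros holomorphic_on_subset[OF b(1)]) auto
  then have u2: "u holomorphic_on (S - {a})"
    by (rule holomorphic_transform) (auto simp: u_def)
  have "S = ball a r \<union> (S - {a})" using g(2,3) by auto
  moreover have "open (ball a r)" "open (S - {a})" using b(2) by auto
  ultimately have u: "u holomorphic_on S"
    using holomorphic_on_Un[OF u1 u2] by metis
  have "u a \<noteq> 0" using g(6)[of a] g(2) by (simp add: u_def)
  moreover have "b w = (w - a)^n * u w" if "w \<in> S" for w
    using b(5) g(1) by (auto simp: u_def)
  ultimately show ?thesis using that g(1) u by blast
qed

text \<open>Zeros are divided out one point at a time; a list instead of a set records their
  multiplicities.\<close>

lemma factor_out_zeros: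
  assumes "open S" "connected S" "b holomorphic_on S" "finite {z\<in>S. b z = 0}" "\<not> b constant_on S"
  shows "\<exists>as u. set as = {z\<in>S. b z = 0} \<and> u holomorphic_on S \<and> (\<forall>z\<in>S. b z = (\<Prod>a\<leftarrow>as. z - a) * u z \<and> u z \<noteq> 0)"
  using assms(3-5)
proof (induction "card {z\<in>S. b z = 0}" arbitrary: b rule: less_induct)
  case less
  show ?case
  proof (cases "{z\<in>S. b z = 0} = {}")
    case True
    then show ?thesis using less.prems by (intro exI[of _ "[]"] exI[of _ b]) auto
  next
    case False
    then obtain a where a: "a \<in> S" "b a = 0" by blast
    obtain n h where n: "0 < n" "h holomorphic_on S" "\<And>z. z \<in> S \<Longrightarrow> b z = (z - a) ^ n * h z" "h a \<noteq> 0"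
      using divide_out_zero[OF less.prems(1) assms(1,2) a less.prems(3)] by blast
    have eq: "{z\<in>S. h z = 0} = {z\<in>S. b z = 0} - {a}" using n(1,3,4) by auto
    have pr: "(\<Prod>a\<leftarrow>replicate n a. z - a) = (z - a) ^ n" for z by (induction n) auto
    show ?thesis
    \<comment> \<open>The induction hypothesis asks for a nonconstant function. A constant
      \<open>h\<close> is nonzero because it is so at \<open>a\<close>, and then no zeros
      remain.\<close>
    proof (cases "h constant_on S")
      case True
      then have "\<forall>z\<in>S. h z \<noteq> 0" using n(4) a(1) unfolding constant_on_def by metis
      then show ?thesis using n a pr eq
        by (intro exI[of _ "replicate n a"] exI[of _ h]) auto
    next
      case False
      have "card {z\<in>S. h z = 0} < card {z\<in>S. b z = 0}"
        unfolding eq by (rule card_Diff1_less) (use less.prems(2) a in auto)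
      moreover have "finite {z\<in>S. h z = 0}" using eq less.prems(2) by simp
      ultimately obtain as u where IH: "set as = {z\<in>S. h z = 0}" "u holomorphic_on S"
        "\<forall>z\<in>S. h z = (\<Prod>a\<leftarrow>as. z - a) * u z \<and> u z \<noteq> 0"
        using less.hyps[of h] n(2) False by blast
      show ?thesis
      proof (intro exI conjI)
        show "set (replicate n a @ as) = {z\<in>S. b z = 0}" using IH(1) eq a n(1) by auto
        show "u holomorphic_on S" by fact
        show "\<forall>z\<in>S. b z = (\<Prod>a\<leftarrow>replicate n a @ as. z - a) * u z \<and> u z \<noteq> 0"
          using IH(3) n(3) pr by auto
      qed
    qed
  qed
qed

text \<open>The maximum principle for \<open>v\<close> and 1/v on circles close to the unit circle
  gives |v| = 1 throughout the disc, and a holomorphic function of constant modulus is constant.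
  Bounds near the circle take the place of boundary values.\<close>

lemma unimodular_boundary_constant:
  fixes v :: "complex \<Rightarrow> complex"
  assumes v: "v holomorphic_on ball 0 1" "\<And>z. z \<in> ball 0 1 \<Longrightarrow> v z \<noteq> 0"
    and bd: "\<And>e. 0 < e \<Longrightarrow> \<exists>t<1. \<forall>z. t < norm z \<and> norm z < 1 \<longrightarrow> norm (v z) \<le> 1 + e \<and> 1 \<le> (1 + e) * norm (v z)"
  shows "\<exists>c. c \<noteq> 0 \<and> (\<forall>z \<in> ball 0 1. v z = c)"
proof -
  have max: "norm (v w) \<le> C" if v: "v holomorphic_on ball 0 1" and w: "w \<in> ball 0 1"
    and C: "\<And>\<zeta>. norm \<zeta> = t \<Longrightarrow> norm (v \<zeta>) \<le> C" and t: "norm w < t" "t < 1" for v w C t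
  proof (rule maximum_modulus_frontier[of v "cball 0 t"])
    show "v holomorphic_on interior (cball 0 t)"
      by (rule holomorphic_on_subset[OF v]) (use t in auto)
    show "continuous_on (closure (cball 0 t)) v"
      using holomorphic_on_imp_continuous_on[OF v] t by (auto intro: continuous_on_subset)
    show "norm (v \<zeta>) \<le> C" if "\<zeta> \<in> frontier (cball 0 t)" for \<zeta>
      using that t norm_ge_zero[of w] by (intro C) (auto simp: frontier_cball)
  qed (use t in auto)
  have bound: "norm (v w) \<le> 1 + e \<and> 1 \<le> (1 + e) * norm (v w)" if w: "w \<in> ball 0 1" and e: "0 < e" for w e
  proof -
    obtain t0 where t0: "t0 < 1" "\<And>z. \<lbrakk>t0 < norm z; norm z < 1\<rbrakk> \<Longrightarrow> norm (v z) \<le> 1 + e \<and> 1 \<le> (1 + e) * norm (v z)"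
      using bd[OF e] by blast
    define t where "t = (max t0 (norm w) + 1) / 2"
    have t: "t0 < t" "norm w < t" "t < 1"
      using t0(1) w unfolding t_def by (auto simp: max_def)
    have "norm (v w) \<le> 1 + e" by (rule max[OF v(1) w _ t(2,3)]) (use t t0 in auto)
    moreover have "norm (1 / v w) \<le> 1 + e"
    proof (rule max[OF _ w _ t(2,3)])
      show "(\<lambda>w. 1 / v w) holomorphic_on ball 0 1" using v by (intro holomorphic_intros) auto
      fix \<zeta> :: complex assume \<zeta>: "norm \<zeta> = t"
      then have "1 \<le> (1 + e) * norm (v \<zeta>)" "v \<zeta> \<noteq> 0" using t0(2)[of \<zeta>] t v(2)[of \<zeta>] by auto
      then show "norm (1 / v \<zeta>) \<le> 1 + e" by (simp add: norm_divide divide_le_eq)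
    qed
    ultimately show ?thesis using v(2)[OF w] by (simp add: norm_divide divide_le_eq)
  qed
  have eq1: "norm (v w) = 1" if w: "w \<in> ball 0 1" for w
  proof (rule antisym)
    show "norm (v w) \<le> 1" by (rule field_le_epsilon) (use bound[OF w] in auto)
    show "1 \<le> norm (v w)"
    proof (rule ccontr)
      assume "\<not> 1 \<le> norm (v w)"
      define e where "e = 1 / norm (v w) - 1"
      have "0 < norm (v w)" using v(2)[OF w] by simp
      then have e: "0 < e" "(1 + e) * norm (v w) = 1" using \<open>\<not> 1 \<le> norm (v w)\<close> by (auto simp: e_def field_simps)
      then have "1 \<le> (1 + e / 2) * norm (v w)" using bound[OF w, of "e / 2"] by simp
      moreover have "0 < e * norm (v w)" using e \<open>0 < norm (v w)\<close> by simp
      ultimately show False using e(2) by (simp add: algebra_simps)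
    qed
  qed
  have "v constant_on ball 0 1"
    by (rule maximum_modulus_principle[OF v(1) open_ball connected_ball open_ball order_refl, of 0])
       (use eq1 in auto)
  then obtain c where "\<forall>w \<in> ball 0 1. v w = c" unfolding constant_on_def by blast
  then show ?thesis using v(2)[of 0] by (intro exI[of _ c]) auto
qed

text \<open>The Moebius map 1 / (1 - q) takes the unit disc onto this half-plane. Two such terms
  outweigh the -1 in the logarithmic derivative of a Blaschke factor.\<close>

lemma Re_inverse_one_minus: "norm q < 1 \<Longrightarrow> 1 / 2 < Re (1 / (1 - q))" for q :: complex
proof -
  assume q: "norm q < 1"
  then have "(norm q)\<^sup>2 < 1" by (simp add: power_less_one_iff)
  then have 1: "(Re q)\<^sup>2 + (Im q)\<^sup>2 < 1" by (simp add: cmod_power2)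
  have "1 - q \<noteq> 0" using q by auto
  then have 2: "0 < (1 - Re q)\<^sup>2 + (Im q)\<^sup>2" by (auto simp: complex_eq_iff sum_power2_gt_zero_iff)
  have "Re (1 / (1 - q)) = (1 - Re q) / ((1 - Re q)\<^sup>2 + (Im q)\<^sup>2)" by (simp add: Re_divide)
  moreover have "(1 - Re q)\<^sup>2 + (Im q)\<^sup>2 < 2 * (1 - Re q)" using 1 by (simp add: power2_eq_square algebra_simps)
  then have "1 / 2 < (1 - Re q) / ((1 - Re q)\<^sup>2 + (Im q)\<^sup>2)" by (simp add: pos_less_divide_eq[OF 2])
  ultimately show ?thesis by simp
qed

text \<open>For one factor, z times the logarithmic derivative equals 1/(1 - a/z) + 1/(1 - cnj a z)
  - 1, and for |a| < |z| < 1 both fractions have real part above 1/2. Logarithmic derivatives of a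
  product add, so positivity passes to the whole list.\<close>

lemma Blaschke_log_derivative:
  assumes z: "norm z < 1" and as: "\<And>a. a \<in> set as \<Longrightarrow> norm a < norm z"
  shows "\<exists>D. ((\<lambda>z. \<Prod>a\<leftarrow>as. (z - a) / (1 - cnj a * z)) has_field_derivative D) (at z) \<and>
     (\<Prod>a\<leftarrow>as. (z - a) / (1 - cnj a * z)) \<noteq> 0 \<and>
     (if as = [] then D = 0 else 0 < Re (z * D / (\<Prod>a\<leftarrow>as. (z - a) / (1 - cnj a * z))))"
  using as
proof (induction as)
  case (Cons a as)
  define M where "M = (\<Prod>a\<leftarrow>as. (z - a) / (1 - cnj a * z))"
  obtain D where D: "((\<lambda>z. \<Prod>a\<leftarrow>as. (z - a) / (1 - cnj a * z)) has_field_derivative D) (at z)"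
     "M \<noteq> 0" "if as = [] then D = 0 else 0 < Re (z * D / M)"
    using Cons.IH Cons.prems unfolding M_def by auto
  have a: "norm a < norm z" using Cons.prems by simp
  then have z0: "z \<noteq> 0" "z - a \<noteq> 0" by auto
  have naz: "norm (cnj a * z) < 1"
  proof -
    have "norm a * norm z \<le> norm a * 1" using z by (intro mult_left_mono) auto
    then show ?thesis using a z by (simp add: norm_mult)
  qed
  then have nz: "1 - cnj a * z \<noteq> 0" by auto
  define m where "m = (z - a) / (1 - cnj a * z)"
  define D1 where "D1 = (1 * (1 - cnj a * z) - (z - a) * (0 - cnj a)) / ((1 - cnj a * z) * (1 - cnj a * z))"
  have d1: "((\<lambda>z. (z - a) / (1 - cnj a * z)) has_field_derivative D1) (at z)"
    unfolding D1_def by (rule derivative_eq_intros refl nz | simp)+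
  have m: "m \<noteq> 0" using z0 nz by (simp add: m_def)
  have "((\<lambda>z. (z - a) / (1 - cnj a * z) * (\<Prod>a\<leftarrow>as. (z - a) / (1 - cnj a * z))) has_field_derivative D1 * M + D * m) (at z)"
    unfolding M_def m_def by (rule DERIV_mult[OF d1 D(1)])
  moreover have "0 < Re (z * (D1 * M + D * m) / (m * M))"
  proof -
    have "z * (D1 * M + D * m) / (m * M) = z * D1 / m + z * D / M"
      using m D(2) by (simp add: field_simps)
    also have "z * D1 / m = 1 / (1 - a / z) + 1 / (1 - cnj a * z) - 1"
    proof -
      have "1 / (1 - a / z) = z / (z - a)" using z0 by (simp add: field_simps)
      moreover have "z * D1 / m = z * ((1 - cnj a * z) + (z - a) * cnj a) / ((1 - cnj a * z) * (z - a))"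
      proof -
        have "z * (N / (w * w)) / (y / w) = z * N / (w * y)" if "w \<noteq> 0" for N w y :: complex
          using that by simp
        from this[OF nz, of "1 * (1 - cnj a * z) - (z - a) * (0 - cnj a)" "z - a"] show ?thesis
          unfolding D1_def m_def by simp
      qed
      moreover have "\<dots> = z / (z - a) + 1 / (1 - cnj a * z) - 1"
      proof -
        have "z / (z - a) + 1 / (1 - cnj a * z) - 1 = (z * (1 - cnj a * z) + (z - a) - (1 - cnj a * z) * (z - a)) / ((1 - cnj a * z) * (z - a))"
        proof -
          have "z / y + 1 / w - 1 = (z * w + y - w * y) / (w * y)" if "w \<noteq> 0" "y \<noteq> 0" for w y :: complex
            using that by (simp add: field_simps)
          from this[OF nz z0(2)] show ?thesis .
        qed
        moreover have "z * (1 - cnj a * z) + (z - a) - (1 - cnj a * z) * (z - a) = z * ((1 - cnj a * z) + (z - a) * cnj a)"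
          by (simp add: algebra_simps)
        ultimately show ?thesis by simp
      qed
      ultimately show ?thesis by simp
    qed
    finally have "Re (z * (D1 * M + D * m) / (m * M)) = Re (1 / (1 - a / z)) + Re (1 / (1 - cnj a * z)) - 1 + Re (z * D / M)"
      by simp
    moreover have "norm (a / z) < 1" using a z0 by (simp add: norm_divide)
    then have "1 / 2 < Re (1 / (1 - a / z))" by (rule Re_inverse_one_minus)
    moreover have "1 / 2 < Re (1 / (1 - cnj a * z))" using naz by (rule Re_inverse_one_minus)
    moreover have "0 \<le> Re (z * D / M)" using D(3) by (auto split: if_splits)
    ultimately show ?thesis by linarith
  qed
  ultimately show ?case using m D(2) by (auto simp: m_def M_def intro!: exI[of _ "D1 * M + D * m"])
qed auto

text \<open>Properness makes |b| tend to 1 at the circle, which identifies \<open>b\<close> as a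
  constant times the Blaschke product of its zeros; the sign of the logarithmic derivative can then
  be read off from the factors.\<close>

lemma proper_disc_log_derivative:
  assumes b: "b holomorphic_on ball 0 1" "b 0 = 0" "finite {z\<in>ball 0 1. b z = 0}"
    and b1: "\<And>\<zeta>. \<zeta> \<in> ball 0 1 \<Longrightarrow> norm (b \<zeta>) < 1"
    and proper: "\<And>e. \<lbrakk>0 < e; e < 1\<rbrakk> \<Longrightarrow> \<exists>t<1. \<forall>\<zeta>\<in>ball 0 1. norm (b \<zeta>) \<le> 1 - e \<longrightarrow> norm \<zeta> \<le> t"
  shows "\<exists>r<1. 0 \<le> r \<and> (\<forall>z. r < norm z \<and> norm z < 1 \<longrightarrow> b z \<noteq> 0 \<and> 0 < Re (z * deriv b z / b z))"
proof -
  have nc: "\<not> b constant_on ball 0 1"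
  proof
    assume "b constant_on ball 0 1"
    then obtain c where "\<And>z. z \<in> ball 0 1 \<Longrightarrow> b z = c" unfolding constant_on_def by blast
    then have "b z = 0" if "z \<in> ball 0 1" for z using that b(2) by (metis centre_in_ball zero_less_one)
    then have "{z\<in>ball 0 1. b z = 0} = ball 0 1" by blast
    then show False using b(3) uncountable_infinite[OF uncountable_ball[of 1 "0::complex"]] by simp
  qed
  obtain as u where as: "set as = {z\<in>ball 0 1. b z = 0}" and u: "u holomorphic_on ball 0 1"
     "\<And>z. z \<in> ball 0 1 \<Longrightarrow> b z = (\<Prod>a\<leftarrow>as. z - a) * u z \<and> u z \<noteq> 0"
    using factor_out_zeros[OF open_ball connected_ball b(1,3) nc] by blast
  have as1: "\<And>a. a \<in> set as \<Longrightarrow> norm a < 1" using as by auto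
  define P where "P = (\<lambda>z. \<Prod>a\<leftarrow>as. z - a)"
  \<comment> \<open>P / Q is the Blaschke product of the zeros. On the unit circle |z - a| = |1 -
    cnj a z|, so |P| = |Q| there; since b = P * u, the product u * Q becomes unimodular at the
    circle.\<close>
  define Q where "Q = (\<lambda>z. \<Prod>a\<leftarrow>as. 1 - cnj a * z)"
  have holQ: "Q holomorphic_on UNIV" and holP: "P holomorphic_on UNIV"
    unfolding P_def Q_def by (induction as) (auto intro!: holomorphic_intros)
  have Qnz: "Q z \<noteq> 0" if "norm z \<le> 1" for z
    using as1 unfolding Q_def
  proof (induction as)
    case (Cons a as)
    have "norm a * norm z < 1" using Cons.prems[of a] that norm_ge_zero[of a]
      by (metis list.set_intros(1) mult_left_le order_le_less_trans)
    then have "norm (cnj a * z) < 1" by (simp add: norm_mult)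
    then have "1 - cnj a * z \<noteq> 0" by auto
    then show ?case using Cons by auto
  qed simp
  define h where "h = (\<lambda>z. norm (P z) / norm (Q z))"
  have h1: "h z = 1" if "norm z = 1" for z
  proof -
    have *: "norm (z - a) = norm (1 - cnj a * z)" for a
    proof -
      have "z * cnj z = 1" using that by (simp add: complex_norm_square[symmetric])
      then have "1 - cnj a * z = z * cnj (z - a)" by (simp add: algebra_simps)
      then show ?thesis using that by (simp add: norm_mult del: complex_cnj_diff)
    qed
    have "norm (P z) = norm (Q z)" unfolding P_def Q_def by (induction as) (auto simp: norm_mult *)
    then show ?thesis using Qnz[of z] that by (simp add: h_def)
  qed
  have "continuous_on (cball 0 1) h" unfolding h_def
    using Qnz holomorphic_on_imp_continuous_on[OF holP] holomorphic_on_imp_continuous_on[OF holQ]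
    by (intro continuous_intros) (auto intro: continuous_on_subset)
  then have huc: "uniformly_continuous_on (cball 0 1) h" by (intro compact_uniformly_continuous) auto
  have hb: "\<exists>t<1. \<forall>z. t < norm z \<and> norm z < 1 \<longrightarrow> \<bar>h z - 1\<bar> < e" if e: "0 < e" for e
  proof -
    obtain \<delta> where \<delta>: "0 < \<delta>" "\<And>x x'. \<lbrakk>x \<in> cball 0 1; x' \<in> cball 0 1; dist x' x < \<delta>\<rbrakk> \<Longrightarrow> dist (h x') (h x) < e"
      using huc e unfolding uniformly_continuous_on_def by metis
    show ?thesis
    proof (intro exI[of _ "max 0 (1 - \<delta>)"] conjI allI impI)
      fix z :: complex assume z: "max 0 (1 - \<delta>) < norm z \<and> norm z < 1"
      define x where "x = z / of_real (norm z)"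
      have x: "norm x = 1" using z by (auto simp: x_def norm_divide)
      have "z = of_real (norm z) * x" using z by (auto simp: x_def)
      then have "z - x = of_real (norm z - 1) * x" by (simp add: algebra_simps)
      then have "norm (z - x) = \<bar>norm z - 1\<bar>" using x by (simp only: norm_mult norm_of_real) simp
      then have "norm (z - x) = 1 - norm z" using z by simp
      then have "dist (h z) (h x) < e" using z x by (intro \<delta>(2)) (auto simp: dist_norm)
      then show "\<bar>h z - 1\<bar> < e" using h1[OF x] by (simp add: dist_real_def)
    qed (use \<delta> in auto)
  qed
  have "\<exists>c. c \<noteq> 0 \<and> (\<forall>z \<in> ball 0 1. u z * Q z = c)"
  proof (rule unimodular_boundary_constant[of "\<lambda>z. u z * Q z"])
    show "(\<lambda>z. u z * Q z) holomorphic_on ball 0 1"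
      using u(1) holQ by (auto intro!: holomorphic_intros intro: holomorphic_on_subset)
    show "u z * Q z \<noteq> 0" if "z \<in> ball 0 1" for z using u(2)[OF that] Qnz[of z] that by auto
    fix e :: real assume e: "0 < e"
    \<comment> \<open>The solution of (1 + e1) / (1 - e1) = 1 + e: near the circle both |b| and |P /
      Q| are within \<open>e1\<close> of 1, and |u * Q| is their quotient.\<close>
    define e1 where "e1 = e / (2 + e)"
    have e1: "0 < e1" "e1 < 1" "e1 * (2 + e) = e" using e by (auto simp: e1_def)
    obtain t1 where t1: "t1 < 1" "\<And>z. \<lbrakk>t1 < norm z; norm z < 1\<rbrakk> \<Longrightarrow> \<bar>h z - 1\<bar> < e1" using hb[OF e1(1)] by blast
    obtain t2 where t2: "t2 < 1" "\<And>z. \<lbrakk>z \<in> ball 0 1; norm (b z) \<le> 1 - e1\<rbrakk> \<Longrightarrow> norm z \<le> t2" using proper[OF e1(1,2)] by blast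
    show "\<exists>t<1. \<forall>z. t < norm z \<and> norm z < 1 \<longrightarrow> norm (u z * Q z) \<le> 1 + e \<and> 1 \<le> (1 + e) * norm (u z * Q z)"
    proof (intro exI[of _ "max t1 t2"] conjI allI impI)
      show "max t1 t2 < 1" using t1(1) t2(1) by simp
      fix z :: complex assume z: "max t1 t2 < norm z \<and> norm z < 1"
      have zb: "z \<in> ball 0 1" using z by simp
      define m where "m = norm (u z * Q z)"
      have mh: "m * h z = norm (b z)"
        using u(2)[OF zb] Qnz[of z] z by (simp add: m_def h_def norm_mult P_def)
      have h: "1 - e1 < h z" "h z < 1 + e1" using t1(2)[of z] z by (auto simp: abs_less_iff)
      have bz: "norm (b z) < 1" "1 - e1 < norm (b z)"
        using b1[OF zb] t2(2)[OF zb] z by (auto simp: not_le[symmetric])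
      have m0: "0 \<le> m" by (simp add: m_def)
      have "m * (1 - e1) \<le> 1" using mult_left_mono[OF less_imp_le[OF h(1)] m0] mh bz by linarith
      moreover have "1 \<le> (1 + e) * (1 - e1)" using e1 e by (simp add: algebra_simps)
      ultimately have "m * (1 - e1) \<le> (1 + e) * (1 - e1)" by linarith
      then have A: "m \<le> 1 + e" using e1 by simp
      have "1 - e1 \<le> m * (1 + e1)" using mult_left_mono[OF less_imp_le[OF h(2)] m0] mh bz by linarith
      then have "(1 + e) * (1 - e1) \<le> (1 + e) * (m * (1 + e1))" using e by (intro mult_left_mono) auto
      moreover have "1 + e1 \<le> (1 + e) * (1 - e1)" using e1 by (simp add: algebra_simps)
      ultimately have "1 * (1 + e1) \<le> ((1 + e) * m) * (1 + e1)" by (simp add: mult_ac)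
      then have "1 \<le> (1 + e) * m" using e1 by (subst (asm) mult_le_cancel_right_pos) auto
      then show "norm (u z * Q z) \<le> 1 + e" "1 \<le> (1 + e) * norm (u z * Q z)" using A by (auto simp: m_def)
    qed
  qed
  then obtain c where c: "c \<noteq> 0" "\<And>z. z \<in> ball 0 1 \<Longrightarrow> u z * Q z = c" by blast
  \<comment> \<open>Beyond this radius every zero satisfies |a| < |z|, as
    \<open>Blaschke_log_derivative\<close> requires. The point 0 is one of the zeros, so the list is
    not empty and the inequality is strict.\<close>
  define r where "r = Max (norm ` set as)"
  have 0: "0 \<in> set as" using as b(2) by auto
  then have r: "\<And>a. a \<in> set as \<Longrightarrow> norm a \<le> r" "r < 1" "0 \<le> r"
  proof -
    have fin: "finite (norm ` set as)" "norm ` set as \<noteq> {}" using 0 by auto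
    show "norm a \<le> r" if "a \<in> set as" for a unfolding r_def using Max_ge[OF fin(1)] that by simp
    then show "0 \<le> r" using 0 by force
    show "r < 1" unfolding r_def using Max_in[OF fin] as1 by auto
  qed
  show ?thesis
  proof (intro exI[of _ r] conjI allI impI)
    fix z :: complex assume z: "r < norm z \<and> norm z < 1"
    define B where "B = (\<lambda>z. \<Prod>a\<leftarrow>as. (z - a) / (1 - cnj a * z))"
    have BPQ: "B z = P z / Q z" for z unfolding B_def P_def Q_def by (induction as) auto
    obtain D where D: "(B has_field_derivative D) (at z)" "B z \<noteq> 0" "0 < Re (z * D / B z)"
    proof -
      have ne: "as \<noteq> []" using 0 by auto
      have lt: "norm a < norm z" if "a \<in> set as" for a using r(1)[OF that] z by linarith
      from Blaschke_log_derivative[OF conjunct2[OF z], of as] lt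
      have "\<exists>D. (B has_field_derivative D) (at z) \<and> B z \<noteq> 0 \<and> 0 < Re (z * D / B z)"
        using ne unfolding B_def by simp
      then show ?thesis using that by blast
    qed
    have bB: "b w = c * B w" if "w \<in> ball 0 1" for w
      using u(2)[OF that] c(2)[OF that] Qnz[of w] that by (auto simp: BPQ P_def field_simps)
    have zb: "z \<in> ball 0 1" using z by simp
    have "((\<lambda>w. c * B w) has_field_derivative c * D) (at z)" by (rule DERIV_cmult[OF D(1)])
    then have "(b has_field_derivative c * D) (at z)"
      by (rule has_field_derivative_transform_within_open[OF _ open_ball zb]) (use bB in auto)
    then have "deriv b z = c * D" by (rule DERIV_imp_deriv)
    then show "b z \<noteq> 0" "0 < Re (z * deriv b z / b z)" using bB[OF zb] c(1) D(2,3) by auto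
  qed (use r in auto)
qed

text \<open>Conjugated to the disc, \<open>f\<close> is a finite Blaschke product \<open>b\<close>. Since \<open>z b' / b\<close> has positive real part near the
  unit circle, \<open>z b'\<close> and \<open>b\<close> have the same winding number, hence the same number of zeros.\<close>

theorem Riemann_Hurwitz_simply_connected:
  assumes S: "open S" "simply_connected S" "S \<noteq> UNIV" "S \<noteq> {}" and T: "open T" "simply_connected T" "T \<noteq> UNIV"
    and f: "f holomorphic_on S" "f ` S \<subseteq> T" and proper: "\<And>C. \<lbrakk>compact C; C \<subseteq> T\<rbrakk> \<Longrightarrow> compact {x\<in>S. f x \<in> C}"
    and deg: "\<And>w. w \<in> T \<Longrightarrow> finite {z \<in> S. f z = w} \<and> (\<Sum>z\<in>{z \<in> S. f z = w}. zorder (\<lambda>x. f x - w) z) = int d"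
  shows "finite {z\<in>S. deriv f z = 0} \<and> (\<Sum>z\<in>{z\<in>S. deriv f z = 0}. zorder (deriv f) z) = int d - 1"
proof -
  obtain x where x: "x \<in> S" using S(4) by blast
  obtain \<phi> \<psi> where \<phi>: "\<phi> holomorphic_on S" "\<psi> holomorphic_on ball 0 1"
    "\<And>z. z \<in> S \<Longrightarrow> \<phi> z \<in> ball 0 1 \<and> \<psi> (\<phi> z) = z"
    "\<And>\<zeta>. \<zeta> \<in> ball 0 1 \<Longrightarrow> \<psi> \<zeta> \<in> S \<and> \<phi> (\<psi> \<zeta>) = \<zeta>" "\<phi> x = 0"
    using Riemann_map_at[OF S(1-3) x] by metis
  define w0 where "w0 = f x"
  have w0: "w0 \<in> T" using f(2) x by (auto simp: w0_def)
  obtain R R' where R: "R holomorphic_on T" "R' holomorphic_on ball 0 1"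
    "\<And>z. z \<in> T \<Longrightarrow> R z \<in> ball 0 1 \<and> R' (R z) = z"
    "\<And>\<zeta>. \<zeta> \<in> ball 0 1 \<Longrightarrow> R' \<zeta> \<in> T \<and> R (R' \<zeta>) = \<zeta>" "R w0 = 0"
    using Riemann_map_at[OF T w0] by metis
  define b where "b = (\<lambda>\<zeta>. R (f (\<psi> \<zeta>)))"
  have fT: "f (\<psi> \<zeta>) \<in> T" if "\<zeta> \<in> ball 0 1" for \<zeta> using \<phi>(4)[OF that] f(2) by blast
  have hf\<psi>: "(f \<circ> \<psi>) holomorphic_on ball 0 1"
    by (rule holomorphic_on_compose_gen[OF \<phi>(2) f(1)]) (use \<phi>(4) in blast)
  then have "(R \<circ> (f \<circ> \<psi>)) holomorphic_on ball 0 1"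
    by (rule holomorphic_on_compose_gen[OF _ R(1)]) (use fT in auto)
  then have hb: "b holomorphic_on ball 0 1" by (simp add: b_def o_def)
  have psi0: "\<psi> 0 = x" using \<phi>(3)[OF x] \<phi>(5) by simp
  have b0: "b 0 = 0" by (simp add: b_def psi0 R(5) flip: w0_def)
  have bz: "b \<zeta> = 0 \<longleftrightarrow> f (\<psi> \<zeta>) = w0" if "\<zeta> \<in> ball 0 1" for \<zeta>
    unfolding b_def using R(3)[OF fT[OF that]] R(3)[OF w0] R(5) by metis
  have finb: "finite {z\<in>ball 0 1. b z = 0}"
  proof (rule finite_subset[OF _ finite_imageI[of _ \<phi>]])
    show "{z\<in>ball 0 1. b z = 0} \<subseteq> \<phi> ` {z\<in>S. f z = w0}"
    proof
      fix \<zeta> assume "\<zeta> \<in> {z\<in>ball 0 1. b z = 0}"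
      then have "\<zeta> \<in> ball 0 1" "f (\<psi> \<zeta>) = w0" using bz by auto
      then show "\<zeta> \<in> \<phi> ` {z\<in>S. f z = w0}" using \<phi>(4)[of \<zeta>] by (intro image_eqI[of _ _ "\<psi> \<zeta>"]) auto
    qed
    show "finite {z\<in>S. f z = w0}" using deg[OF w0] by blast
  qed
  have bproper: "\<exists>t<1. \<forall>\<zeta>\<in>ball 0 1. norm (b \<zeta>) \<le> 1 - e \<longrightarrow> norm \<zeta> \<le> t" if e: "0 < e" "e < 1" for e
  proof -
    have sub: "cball 0 (1 - e) \<subseteq> ball (0::complex) 1" using e by auto
    define Z where "Z = \<phi> ` {x\<in>S. f x \<in> R' ` cball 0 (1 - e)}"
    have "compact (R' ` cball 0 (1 - e))"
      by (intro compact_continuous_image continuous_on_subset[OF holomorphic_on_imp_continuous_on[OF R(2)] sub]) auto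
    moreover have "R' ` cball 0 (1 - e) \<subseteq> T" using R(4) sub by blast
    ultimately have "compact {x\<in>S. f x \<in> R' ` cball 0 (1 - e)}" by (rule proper)
    then have C: "compact Z" unfolding Z_def
      by (intro compact_continuous_image continuous_on_subset[OF holomorphic_on_imp_continuous_on[OF \<phi>(1)]]) auto
    have Z1: "Z \<subseteq> ball 0 1" unfolding Z_def using \<phi>(3) by blast
    have "\<exists>t<1. Z \<subseteq> cball 0 t"
    proof (cases "Z = {}")
      case False
      obtain c where c: "c \<in> Z" "\<forall>y\<in>Z. norm y \<le> norm c"
        using continuous_attains_sup[OF C False, of norm] by (auto intro: continuous_on_norm_id)
      then have "norm c < 1" using Z1 by auto
      then show ?thesis using c(2) by (intro exI[of _ "norm c"]) auto
    qed (auto intro: exI[of _ 0])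
    then obtain t where t: "t < 1" "Z \<subseteq> cball 0 t" by blast
    show ?thesis
    proof (intro exI conjI ballI impI)
      fix \<zeta> :: complex assume \<zeta>: "\<zeta> \<in> ball 0 1" "norm (b \<zeta>) \<le> 1 - e"
      have "f (\<psi> \<zeta>) = R' (b \<zeta>)" using R(3)[OF fT[OF \<zeta>(1)]] by (simp add: b_def)
      then have "\<psi> \<zeta> \<in> {x\<in>S. f x \<in> R' ` cball 0 (1 - e)}" using \<zeta>(2) \<phi>(4)[OF \<zeta>(1)] by auto
      then have "\<phi> (\<psi> \<zeta>) \<in> cball 0 t" using t(2) unfolding Z_def by blast
      then show "norm \<zeta> \<le> t" using \<phi>(4)[OF \<zeta>(1)] by simp
    qed (rule t(1))
  qed
  have b1: "norm (b \<zeta>) < 1" if "\<zeta> \<in> ball 0 1" for \<zeta> using R(3)[OF fT[OF that]] by (simp add: b_def)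
  obtain r0 where r0: "r0 < 1" "0 \<le> r0"
    "\<And>z. \<lbrakk>r0 < norm z; norm z < 1\<rbrakk> \<Longrightarrow> b z \<noteq> 0 \<and> 0 < Re (z * deriv b z / b z)"
    using proper_disc_log_derivative[OF hb b0 finb b1 bproper] by blast
  define r where "r = (r0 + 1) / 2"
  have r: "r0 < r" "r < 1" "0 < r" using r0 by (auto simp: r_def)
  \<comment> \<open>By the chain rule b' is \<open>k\<close> times f' after \<psi>. Since
    \<open>k\<close> has no zeros, b' vanishes exactly over the critical points of
    \<open>f\<close>.\<close>
  define k where "k = (\<lambda>\<zeta>. deriv R (f (\<psi> \<zeta>)) * deriv \<psi> \<zeta>)"
  have dR: "deriv R w \<noteq> 0" if "w \<in> T" for w
    by (rule deriv_inverse_nonzero[OF T(1) R(1,2) open_ball _ _ that]) (use R(3) in blast)+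
  have d\<psi>: "deriv \<psi> \<zeta> \<noteq> 0" if "\<zeta> \<in> ball 0 1" for \<zeta>
    by (rule deriv_inverse_nonzero[OF open_ball \<phi>(2,1) S(1) _ _ that]) (use \<phi>(4) in blast)+
  have knz: "k \<zeta> \<noteq> 0" if "\<zeta> \<in> ball 0 1" for \<zeta> using dR[OF fT[OF that]] d\<psi>[OF that] by (simp add: k_def)
  have "(deriv R \<circ> (f \<circ> \<psi>)) holomorphic_on ball 0 1"
    by (rule holomorphic_on_compose_gen[OF hf\<psi> holomorphic_deriv[OF R(1) T(1)]]) (use fT in auto)
  then have hk: "k holomorphic_on ball 0 1"
    unfolding k_def o_def using holomorphic_deriv[OF \<phi>(2) open_ball] by (intro holomorphic_on_mult) auto
  have db: "deriv b \<zeta> = k \<zeta> * deriv f (\<psi> \<zeta>)" if \<zeta>: "\<zeta> \<in> ball 0 1" for \<zeta>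
  proof -
    have d1: "(\<psi> has_field_derivative deriv \<psi> \<zeta>) (at \<zeta>)"
      by (rule holomorphic_derivI[OF \<phi>(2) open_ball \<zeta>])
    have d2: "(f has_field_derivative deriv f (\<psi> \<zeta>)) (at (\<psi> \<zeta>))"
      using holomorphic_derivI[OF f(1) S(1)] \<phi>(4)[OF \<zeta>] by blast
    have d3: "(R has_field_derivative deriv R (f (\<psi> \<zeta>))) (at (f (\<psi> \<zeta>)))"
      using holomorphic_derivI[OF R(1) T(1) fT[OF \<zeta>]] .
    have "(b has_field_derivative deriv R (f (\<psi> \<zeta>)) * (deriv f (\<psi> \<zeta>) * deriv \<psi> \<zeta>)) (at \<zeta>)"
      unfolding b_def by (rule DERIV_chain2[OF d3 DERIV_chain2[OF d2 d1]])
    then show ?thesis using DERIV_imp_deriv by (fastforce simp: k_def)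
  qed
  have far: "deriv b \<zeta> \<noteq> 0" if "r0 < norm \<zeta>" "norm \<zeta> < 1" for \<zeta> using r0(3)[OF that] by auto
  have crit: "norm (\<phi> y) \<le> r0" if "y \<in> S" "deriv f y = 0" for y
    using far[of "\<phi> y"] db[of "\<phi> y"] \<phi>(3)[OF that(1)] that(2) by force
  have fibre: "norm (\<phi> y) \<le> r0" if "y \<in> S" "f y = w0" for y
    using r0(3)[of "\<phi> y"] bz[of "\<phi> y"] \<phi>(3)[OF that(1)] that(2) by force
  have hdf: "deriv f holomorphic_on S" by (rule holomorphic_deriv[OF f(1) S(1)])
  have fin: "finite {y\<in>S. deriv f y = 0}"
  proof (rule finite_subset)
    define C where "C = \<psi> ` cball 0 r0"
    have C: "compact C" "C \<subseteq> S"
      using \<phi>(4) r0(1) by (auto simp: C_def intro!: compact_continuous_image continuous_on_subset[OF holomorphic_on_imp_continuous_on[OF \<phi>(2)]])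
    have "\<psi> (of_real r) \<in> S" "deriv f (\<psi> (of_real r)) \<noteq> 0"
      using \<phi>(4)[of "of_real r"] far[of "of_real r"] db[of "of_real r"] r by auto
    then have nz: "\<exists>w\<in>S. deriv f w \<noteq> 0" by blast
    show "finite {z\<in>C. deriv f z = 0}"
    proof (cases "deriv f constant_on S")
      case True
      then have "\<forall>z\<in>C. deriv f z \<noteq> 0" using nz C(2) unfolding constant_on_def by (metis subsetD)
      then have "{z\<in>C. deriv f z = 0} = {}" by auto
      then show ?thesis by (simp only: finite.emptyI)
    qed (rule holomorphic_compact_finite_zeros[OF hdf S(1) simply_connected_imp_connected[OF S(2)] C])
    show "{y\<in>S. deriv f y = 0} \<subseteq> {z\<in>C. deriv f z = 0}"
    proof
      fix y assume y: "y \<in> {y\<in>S. deriv f y = 0}"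
      then have "y = \<psi> (\<phi> y)" "\<phi> y \<in> cball 0 r0" using crit[of y] \<phi>(3)[of y] by auto
      then show "y \<in> {z\<in>C. deriv f z = 0}" using y by (auto simp: C_def)
    qed
  qed
  define \<sigma> where "\<sigma> = circlepath 0 r"
  have \<sigma>: "path \<sigma>" "pathfinish \<sigma> = pathstart \<sigma>" "path_image \<sigma> = sphere 0 r" using r by (auto simp: \<sigma>_def)
  have s1: "sphere 0 r \<subseteq> ball (0::complex) 1" using r by auto
  have cont: "path (h \<circ> \<sigma>)" "pathfinish (h \<circ> \<sigma>) = pathstart (h \<circ> \<sigma>)" if "h holomorphic_on ball 0 1" for h
    using \<sigma> continuous_on_subset[OF holomorphic_on_imp_continuous_on[OF that] s1]
    by (auto simp: pathfinish_compose pathstart_compose intro!: path_continuous_image)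
  \<comment> \<open>The image of the circle of radius r > r0 winds once about every critical point
    of \<open>f\<close> and every preimage of \<open>w0\<close>, since \<phi> maps all of these into
    the disc of radius \<open>r0\<close>.\<close>
  have w\<psi>: "winding_number (\<psi> \<circ> \<sigma>) y = 1" if y: "y \<in> S" "norm (\<phi> y) \<le> r0" for y
  proof -
    have eq: "{z\<in>ball 0 1. \<psi> z = y} = {\<phi> y}"
    proof (intro equalityI subsetI)
      fix z assume "z \<in> {z\<in>ball 0 1. \<psi> z = y}"
      then show "z \<in> {\<phi> y}" using \<phi>(4)[of z] by auto
    qed (use \<phi>(3)[OF y(1)] in auto)
    have fin1: "finite {z\<in>ball 0 1. \<psi> z = y}" unfolding eq by simp
    have pim1: "path_image \<sigma> \<subseteq> ball 0 1 - {z\<in>ball 0 1. \<psi> z = y}"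
      unfolding eq \<sigma>(3) using s1 r y(2) by auto
    have "winding_number (\<psi> \<circ> \<sigma>) y = (\<Sum>z\<in>{z\<in>ball 0 1. \<psi> z = y}. winding_number \<sigma> z * zorder (\<lambda>x. \<psi> x - y) z)"
      by (rule winding_number_holomorphic_compose[OF open_ball convex_imp_simply_connected[OF convex_ball] \<phi>(2) fin1 \<sigma>(1,2) pim1])
    also have "\<dots> = 1 * zorder (\<lambda>x. \<psi> x - y) (\<phi> y)"
      unfolding eq using y r by (simp add: \<sigma>_def winding_number_circlepath)
    also have "zorder (\<lambda>x. \<psi> x - y) (\<phi> y) = 1"
      using zorder_simple_zero[OF open_ball \<phi>(2) _ d\<psi>, of "\<phi> y"] \<phi>(3)[OF y(1)] by simp
    finally show ?thesis by (simp add: o_def)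
  qed
  have im: "path_image (\<psi> \<circ> \<sigma>) \<subseteq> S - {z\<in>S. norm (\<phi> z) \<le> r0}"
    using \<phi>(4) s1 \<sigma>(3) r(1) by (force simp: path_image_compose)
  have W1: "winding_number (deriv f \<circ> (\<psi> \<circ> \<sigma>)) 0 = of_int (\<Sum>z\<in>{z\<in>S. deriv f z = 0}. zorder (deriv f) z)"
  proof -
    have "winding_number (deriv f \<circ> (\<psi> \<circ> \<sigma>)) 0 = (\<Sum>z\<in>{z\<in>S. deriv f z = 0}. winding_number (\<psi> \<circ> \<sigma>) z * zorder (\<lambda>x. deriv f x - 0) z)"
      by (rule winding_number_holomorphic_compose[OF S(1,2) hdf fin cont[OF \<phi>(2)]]) (rule order_trans[OF im], use crit in blast)
    also have "\<dots> = (\<Sum>z\<in>{z\<in>S. deriv f z = 0}. of_int (zorder (deriv f) z))"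
      using w\<psi> crit by (intro sum.cong) auto
    finally show ?thesis by (simp add: o_def)
  qed
  have W2: "winding_number (f \<circ> (\<psi> \<circ> \<sigma>)) w0 = of_nat d"
  proof -
    have "winding_number (f \<circ> (\<psi> \<circ> \<sigma>)) w0 = (\<Sum>z\<in>{z\<in>S. f z = w0}. winding_number (\<psi> \<circ> \<sigma>) z * zorder (\<lambda>x. f x - w0) z)"
      by (rule winding_number_holomorphic_compose[OF S(1,2) f(1) conjunct1[OF deg[OF w0]] cont[OF \<phi>(2)]])
         (rule order_trans[OF im], use fibre in blast)
    also have "\<dots> = (\<Sum>z\<in>{z\<in>S. f z = w0}. of_int (zorder (\<lambda>x. f x - w0) z))"
      using w\<psi> fibre by (intro sum.cong) auto
    also have "\<dots> = of_int (\<Sum>z\<in>{z\<in>S. f z = w0}. zorder (\<lambda>x. f x - w0) z)" by simp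
    finally show ?thesis using deg[OF w0] by (simp add: o_def)
  qed
  have W3: "winding_number (b \<circ> \<sigma>) 0 = of_nat d"
  proof -
    have eq: "{z\<in>T. R z = 0} = {w0}"
    proof (intro equalityI subsetI)
      fix z assume z: "z \<in> {z\<in>T. R z = 0}"
      then have "R' (R z) = z" "R' (R w0) = w0" using R(3)[of z] R(3)[OF w0] by blast+
      then show "z \<in> {w0}" using z R(5) by simp
    qed (use R(5) w0 in auto)
    have bs: "b \<circ> \<sigma> = R \<circ> (f \<circ> (\<psi> \<circ> \<sigma>))" by (auto simp: b_def)
    have fs: "f \<circ> (\<psi> \<circ> \<sigma>) = (f \<circ> \<psi>) \<circ> \<sigma>" by (simp add: o_assoc)
    have imT: "path_image (f \<circ> (\<psi> \<circ> \<sigma>)) \<subseteq> T - {w0}"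
    proof
      fix u assume "u \<in> path_image (f \<circ> (\<psi> \<circ> \<sigma>))"
      then obtain y where "u = f y" "y \<in> path_image (\<psi> \<circ> \<sigma>)" by (auto simp: path_image_compose[of f])
      then show "u \<in> T - {w0}" using im fibre[of y] f(2) by blast
    qed
    have "winding_number (b \<circ> \<sigma>) 0 = (\<Sum>z\<in>{z\<in>T. R z = 0}. winding_number (f \<circ> (\<psi> \<circ> \<sigma>)) z * zorder (\<lambda>x. R x - 0) z)"
      unfolding bs
      by (rule winding_number_holomorphic_compose[OF T(1,2) R(1) _ cont[OF hf\<psi>, folded fs]])
         (use imT in \<open>simp_all add: eq\<close>)
    also have "\<dots> = of_nat d * zorder (\<lambda>x. R x - 0) w0" using W2 by (simp add: eq o_def)
    also have "zorder (\<lambda>x. R x - 0) w0 = 1"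
      using zorder_simple_zero[OF T(1) R(1) w0 dR[OF w0]] R(5) by simp
    finally show ?thesis by (simp add: o_def)
  qed
  \<comment> \<open>The quotient z b' / b has positive real part on the circle, so the segment from
    b to z b' misses 0 and the two loops wind equally often.\<close>
  have W4: "winding_number (\<lambda>t. \<sigma> t * (k (\<sigma> t) * deriv f (\<psi> (\<sigma> t)))) 0 = winding_number (b \<circ> \<sigma>) 0"
  proof (rule winding_number_loops_linear_eq)
    have sg: "norm (\<sigma> t) = r" if "t \<in> {0..1}" for t using \<sigma>(3) that by (force simp: path_image_def)
    show "path (\<lambda>t. \<sigma> t * (k (\<sigma> t) * deriv f (\<psi> (\<sigma> t))))"
      "pathfinish (\<lambda>t. \<sigma> t * (k (\<sigma> t) * deriv f (\<psi> (\<sigma> t)))) = pathstart (\<lambda>t. \<sigma> t * (k (\<sigma> t) * deriv f (\<psi> (\<sigma> t))))"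
    proof -
      have "(deriv f \<circ> \<psi>) holomorphic_on ball 0 1"
        by (rule holomorphic_on_compose_gen[OF \<phi>(2) hdf]) (use \<phi>(4) in blast)
      then have "(\<lambda>z. z * (k z * deriv f (\<psi> z))) holomorphic_on ball 0 1"
        using hk by (auto intro!: holomorphic_intros simp: o_def)
      from cont[OF this] show "path (\<lambda>t. \<sigma> t * (k (\<sigma> t) * deriv f (\<psi> (\<sigma> t))))"
      "pathfinish (\<lambda>t. \<sigma> t * (k (\<sigma> t) * deriv f (\<psi> (\<sigma> t)))) = pathstart (\<lambda>t. \<sigma> t * (k (\<sigma> t) * deriv f (\<psi> (\<sigma> t))))"
        by (simp_all add: o_def)
    qed
    fix t :: real assume t: "t \<in> {0..1}"
    define \<zeta> where "\<zeta> = \<sigma> t"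
    have \<zeta>: "norm \<zeta> = r" using sg[OF t] by (simp add: \<zeta>_def)
    have q: "b \<zeta> \<noteq> 0" "0 < Re (\<zeta> * deriv b \<zeta> / b \<zeta>)" using r0(3)[of \<zeta>] \<zeta> r by auto
    show "0 \<notin> closed_segment ((b \<circ> \<sigma>) t) (\<sigma> t * (k (\<sigma> t) * deriv f (\<psi> (\<sigma> t))))"
    proof
      define y :: complex where "y = 0"
      assume "0 \<in> closed_segment ((b \<circ> \<sigma>) t) (\<sigma> t * (k (\<sigma> t) * deriv f (\<psi> (\<sigma> t))))"
      then have "y \<in> closed_segment ((b \<circ> \<sigma>) t) (\<sigma> t * (k (\<sigma> t) * deriv f (\<psi> (\<sigma> t))))" by (simp only: y_def)
      then obtain s where s: "0 \<le> s" "s \<le> 1" "y = (1 - s) *\<^sub>R b \<zeta> + s *\<^sub>R (\<zeta> * deriv b \<zeta>)"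
        using db[of \<zeta>] \<zeta> r unfolding closed_segment_def by (auto simp flip: \<zeta>_def)
      have "y / b \<zeta> = of_real (1 - s) + of_real s * (\<zeta> * deriv b \<zeta> / b \<zeta>)"
        using q(1) unfolding s(3) by (simp add: scaleR_conv_of_real add_divide_distrib)
      moreover have "Re (of_real (1 - s) + of_real s * X) = (1 - s) + s * Re X" for X by simp
      moreover have "(1 - s) + s * Re (\<zeta> * deriv b \<zeta> / b \<zeta>) > 0"
      proof (cases "s = 0")
        case False
        then show ?thesis using s q(2) by (intro add_nonneg_pos mult_pos_pos) auto
      qed simp
      ultimately have "Re (y / b \<zeta>) > 0" by presburger
      then show False by (simp add: y_def)
    qed
  qed (use cont[OF hb] in auto)
  have z0: "0 \<notin> path_image \<sigma>" using \<sigma>(3) r by auto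
  have z1: "0 \<notin> path_image (k \<circ> \<sigma>)" using knz s1 \<sigma>(3) by (force simp: path_image_compose)
  have z2: "0 \<notin> path_image (deriv f \<circ> (\<psi> \<circ> \<sigma>))" using im crit by (force simp: path_image_compose[of "deriv f"])
  have p2: "path (deriv f \<circ> (\<psi> \<circ> \<sigma>))"
    using cont(1)[OF \<phi>(2)] im by (auto intro!: path_continuous_image continuous_on_subset[OF holomorphic_on_imp_continuous_on[OF hdf]])
  \<comment> \<open>The factors of z b' contribute 1 for z, 0 for the zero-free \<open>k\<close>,
    and the number of critical points with multiplicity for f'. Their sum is the winding number d of
    b.\<close>
  have "winding_number (\<lambda>t. \<sigma> t * ((k \<circ> \<sigma>) t * (deriv f \<circ> (\<psi> \<circ> \<sigma>)) t)) 0
      = winding_number \<sigma> 0 + (winding_number (k \<circ> \<sigma>) 0 + winding_number (deriv f \<circ> (\<psi> \<circ> \<sigma>)) 0)"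
  proof (subst winding_number_mult)
    show "path (\<lambda>t. (k \<circ> \<sigma>) t * (deriv f \<circ> (\<psi> \<circ> \<sigma>)) t)"
      using cont(1)[OF hk] p2 by (auto simp: path_def intro!: continuous_intros)
    show "0 \<notin> path_image (\<lambda>t. (k \<circ> \<sigma>) t * (deriv f \<circ> (\<psi> \<circ> \<sigma>)) t)"
      using z1 z2 by (auto simp: path_image_def)
    show "winding_number \<sigma> 0 + winding_number (\<lambda>t. (k \<circ> \<sigma>) t * (deriv f \<circ> (\<psi> \<circ> \<sigma>)) t) 0
      = winding_number \<sigma> 0 + (winding_number (k \<circ> \<sigma>) 0 + winding_number (deriv f \<circ> (\<psi> \<circ> \<sigma>)) 0)"
      using winding_number_mult[OF cont(1)[OF hk] p2 z1 z2] by simp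
  qed (use \<sigma> z0 in auto)
  moreover have "winding_number \<sigma> 0 = 1" using r by (simp add: \<sigma>_def winding_number_circlepath)
  moreover have "winding_number (k \<circ> \<sigma>) 0 = 0"
  proof -
    have eq: "{z\<in>ball 0 1. k z = 0} = {}" using knz by auto
    have fin1: "finite {z\<in>ball 0 1. k z = 0}" and pim1: "path_image \<sigma> \<subseteq> ball 0 1 - {z\<in>ball 0 1. k z = 0}"
      unfolding eq \<sigma>(3) using s1 by auto
    show ?thesis
      unfolding winding_number_holomorphic_compose[OF open_ball convex_imp_simply_connected[OF convex_ball] hk fin1 \<sigma>(1,2) pim1]
      unfolding eq by simp
  qed
  ultimately have "of_nat d = 1 + (of_int (\<Sum>z\<in>{z\<in>S. deriv f z = 0}. zorder (deriv f) z) :: complex)"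
    using W1 W3 W4 by (simp add: o_def)
  then have "of_int (int d) = (of_int (1 + (\<Sum>z\<in>{z\<in>S. deriv f z = 0}. zorder (deriv f) z)) :: complex)" by simp
  then have "int d = 1 + (\<Sum>z\<in>{z\<in>S. deriv f z = 0}. zorder (deriv f) z)" by (simp only: of_int_eq_iff)
  then show ?thesis using fin by simp
qed

section \<open>A capacity estimate\<close>

text \<open>The increment is the integral over [s, t] of the inner product of G with w - x, and the
  integrand is at most R (l |G|^2 + 1/l) because 2 a <= l a^2 + 1/l. The parameter \<open>l\<close>
  stays free to be matched to the scale; \<open>ennreal\<close> truncates a negative increment to
  0.\<close>

lemma segment_increment_bound:
  fixes J :: "complex \<Rightarrow> real" and G :: "complex \<Rightarrow> complex"
  assumes B: "convex B" "x \<in> B" "w \<in> B" "open B"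
    and J: "\<And>\<zeta>. \<zeta> \<in> B \<Longrightarrow> (J has_derivative (\<lambda>h. G \<zeta> \<bullet> h)) (at \<zeta>)" and G: "continuous_on B G"
    and st: "0 \<le> s" "s \<le> t" "t \<le> 1" and l: "0 < l" and R: "dist x w \<le> 2 * R"
  shows "ennreal (J (x + t *\<^sub>R (w - x)) - J (x + s *\<^sub>R (w - x)))
    \<le> ennreal (R * ((t - s) / l)) +
       ennreal (R * l) * (\<integral>\<^sup>+u. indicator {s..t} u * ennreal ((norm (G (x + u *\<^sub>R (w - x))))\<^sup>2) \<partial>lborel)"
proof -
  define \<gamma> where "\<gamma> = (\<lambda>u. x + u *\<^sub>R (w - x))"
  have R0: "0 \<le> R" using R zero_le_dist[of x w] by linarith
  have gB: "\<gamma> u \<in> B" if "u \<in> {s..t}" for u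
  proof -
    have "\<gamma> u = (1 - u) *\<^sub>R x + u *\<^sub>R w" by (simp add: \<gamma>_def algebra_simps)
    then show ?thesis using convexD[OF B(1-3), of "1 - u" u] that st by simp
  qed
  have contG: "continuous_on {s..t} (\<lambda>u. G (\<gamma> u))"
    by (rule continuous_on_compose2[OF G]) (use gB in \<open>auto simp: \<gamma>_def intro!: continuous_intros\<close>)
  have "((\<lambda>u. G (\<gamma> u) \<bullet> (w - x)) has_integral (J (\<gamma> t) - J (\<gamma> s))) {s..t}"
  proof (rule fundamental_theorem_of_calculus[OF st(2)])
    fix u assume u: "u \<in> {s..t}"
    have 1: "(\<gamma> has_derivative (\<lambda>h. h *\<^sub>R (w - x))) (at u within {s..t})"
      unfolding \<gamma>_def by (auto intro!: derivative_eq_intros)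
    have "((\<lambda>u. J (\<gamma> u)) has_derivative (\<lambda>h. G (\<gamma> u) \<bullet> (h *\<^sub>R (w - x)))) (at u within {s..t})"
      by (rule has_derivative_compose[OF 1 J[OF gB[OF u]]])
    then show "((\<lambda>u. J (\<gamma> u)) has_vector_derivative G (\<gamma> u) \<bullet> (w - x)) (at u within {s..t})"
      by (simp add: has_vector_derivative_def)
  qed
  moreover have "(\<lambda>u. (norm (G (\<gamma> u)))\<^sup>2) integrable_on {s..t}"
    by (intro integrable_continuous_real continuous_intros contG)
  then obtain I where I: "((\<lambda>u. (norm (G (\<gamma> u)))\<^sup>2) has_integral I) {s..t}" by blast
  have "((\<lambda>u. R * (l * (norm (G (\<gamma> u)))\<^sup>2 + 1 / l)) has_integral (R * (l * I + (t - s) * (1 / l)))) {s..t}"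
    using has_integral_add[OF has_integral_mult_right[OF I, of l] has_integral_const_real[of "1 / l" s t]] st
    by (intro has_integral_mult_right) simp
  ultimately have "J (\<gamma> t) - J (\<gamma> s) \<le> R * (l * I + (t - s) * (1 / l))"
  proof (rule has_integral_le)
    fix u assume "u \<in> {s..t}"
    define a where "a = norm (G (\<gamma> u))"
    have "G (\<gamma> u) \<bullet> (w - x) \<le> a * norm (w - x)" unfolding a_def by (rule norm_cauchy_schwarz)
    also have "\<dots> \<le> a * (2 * R)"
      using R by (intro mult_left_mono) (auto simp: a_def dist_norm norm_minus_commute)
    also have "\<dots> = R * (2 * a)" by simp
    also have "\<dots> \<le> R * (l * a\<^sup>2 + 1 / l)"
    proof (rule mult_left_mono[OF _ R0])
      have "0 \<le> (l * a - 1)\<^sup>2 / l" using l by simp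
      also have "(l * a - 1)\<^sup>2 / l = l * a\<^sup>2 + 1 / l - 2 * a"
        using l by (simp add: power2_eq_square field_simps)
      finally show "2 * a \<le> l * a\<^sup>2 + 1 / l" by simp
    qed
    finally show "G (\<gamma> u) \<bullet> (w - x) \<le> R * (l * (norm (G (\<gamma> u)))\<^sup>2 + 1 / l)" by (simp add: a_def)
  qed
  then have "ennreal (J (\<gamma> t) - J (\<gamma> s)) \<le> ennreal (R * (l * I + (t - s) * (1 / l)))" by (rule ennreal_leI)
  also have "\<dots> = ennreal (R * ((t - s) / l)) + ennreal (R * l) * ennreal I"
  proof -
    have "R * (l * I + (t - s) * (1 / l)) = R * ((t - s) / l) + R * l * I" by (simp add: algebra_simps)
    moreover have "0 \<le> R * ((t - s) / l)" "0 \<le> R * l" "0 \<le> I" using has_integral_nonneg[OF I] R0 l st by auto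
    ultimately show ?thesis by (simp only: ennreal_mult ennreal_plus mult_nonneg_nonneg)
  qed
  also have "ennreal I = (\<integral>\<^sup>+u. ennreal (indicator {s..t} u * (norm (G (\<gamma> u)))\<^sup>2) \<partial>lborel)"
    by (rule nn_integral_has_integral_lebesgue[symmetric, OF _ I]) auto
  also have "\<dots> = (\<integral>\<^sup>+u. indicator {s..t} u * ennreal ((norm (G (\<gamma> u)))\<^sup>2) \<partial>lborel)"
    by (rule nn_integral_cong) (auto simp: indicator_def)
  finally show ?thesis by (simp add: \<gamma>_def)
qed

lemma nn_integral_homothety:
  fixes v :: "complex \<Rightarrow> ennreal"
  assumes [measurable]: "v \<in> borel_measurable borel" and "0 < t"
  shows "(\<integral>\<^sup>+w. v (x + t *\<^sub>R (w - x)) \<partial>lborel) = ennreal (1 / t\<^sup>2) * (\<integral>\<^sup>+w. v w \<partial>lborel)"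
proof -
  have "(\<integral>\<^sup>+w. v w \<partial>lborel) = (\<integral>\<^sup>+w. v w \<partial>density (distr lborel borel (\<lambda>w. (x - t *\<^sub>R x) + t *\<^sub>R w)) (\<lambda>_. \<bar>t\<bar>^DIM(complex)))"
    using lborel_affine[of t "x - t *\<^sub>R x"] assms(2) by simp
  also have "\<dots> = ennreal (t\<^sup>2) * (\<integral>\<^sup>+w. v (x + t *\<^sub>R (w - x)) \<partial>lborel)"
    using assms(2)
    by (subst nn_integral_density) (auto simp: nn_integral_distr nn_integral_cmult algebra_simps ennreal_power)
  finally show ?thesis
    using assms(2) by (simp add: mult.assoc[symmetric] ennreal_mult[symmetric])
qed

text \<open>A quantitative form of: a set carrying a measure with polynomial decay on balls has positive capacity. The
  average of \<open>J\<close> over \<open>D\<close> is compared with its value at \<open>x\<close> along the homothetic images \<open>x + t (D - x)\<close>,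
  one geometric scale of \<open>t\<close> at a time. Cauchy--Schwarz in the form
  \<open>2 a \<le> l a\<^sup>2 + 1 / l\<close> is balanced on each scale by its own \<open>l\<close>.\<close>

lemma capacity_estimate:
  fixes J :: "complex \<Rightarrow> real" and G :: "complex \<Rightarrow> complex" and q :: "complex \<Rightarrow> real"
  assumes B: "convex B" "open B" "ball a R \<subseteq> B" and R: "0 < R"
    and J: "\<And>\<zeta>. \<zeta> \<in> B \<Longrightarrow> (J has_derivative (\<lambda>h. G \<zeta> \<bullet> h)) (at \<zeta>)" and G: "continuous_on B G"
    and E: "(\<integral>\<^sup>+\<zeta>. indicator B \<zeta> * ennreal ((norm (G \<zeta>))\<^sup>2) \<partial>lborel) \<le> ennreal E" "0 \<le> E"
    and X: "finite X" "X \<subseteq> ball a R" "\<And>x. x \<in> X \<Longrightarrow> 0 \<le> q x" "sum q X \<le> 1" "c \<le> sum q X"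
    and D: "D \<in> sets borel" "D \<subseteq> ball a R" and A: "0 \<le> A" "\<And>w. w \<in> D \<Longrightarrow> 1 + A \<le> J w"
    and L: "1 < L" and \<kappa>: "0 < \<kappa>" "\<kappa> < 1" and C: "0 \<le> C"
    and near: "\<And>x \<zeta>. \<lbrakk>x \<in> X; dist x \<zeta> < 2 * R / L ^ N\<rbrakk> \<Longrightarrow> J \<zeta> = 1"
    and decay: "\<And>k \<zeta>. k < N \<Longrightarrow> (\<Sum>x\<in>{x\<in>X. dist x \<zeta> < 2 * R / L ^ k}. q x) \<le> C * \<kappa> ^ (2 * k)"
  shows "A * c * measure lborel D \<le> R * (measure lborel D + L\<^sup>2 * C * E) / (1 - \<kappa>)"
proof -
  define v where "v = (\<lambda>\<zeta>. indicator B \<zeta> * ennreal ((norm (G \<zeta>))\<^sup>2))"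
  have [measurable]: "B \<in> sets borel" using B(2) by simp
  have [measurable]: "D \<in> sets borel" by (rule D(1))
  have "(\<lambda>z. indicator B z *\<^sub>R G z) \<in> borel_measurable borel"
    using borel_measurable_continuous_on_indicator[OF _ G] by simp
  then have m: "(\<lambda>z. ennreal ((norm (indicator B z *\<^sub>R G z))\<^sup>2)) \<in> borel_measurable borel" by measurable
  have eq: "v = (\<lambda>z. ennreal ((norm (indicator B z *\<^sub>R G z))\<^sup>2))"
    by (auto simp: v_def indicator_def fun_eq_iff)
  have v [measurable]: "v \<in> borel_measurable borel" unfolding eq by (rule m)
  \<comment> \<open>This choice balances scale k: the length term becomes at most R * \<kappa>^k,
    and the energy term, which averaging bounds by a multiple of L^k * \<kappa>^(2k), also becomes a
    multiple of \<kappa>^k. Both series converge.\<close>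
  define l where "l = (\<lambda>k::nat. 1 / (L ^ k * \<kappa> ^ k))"
  have l: "l k > 0" for k using L \<kappa> by (simp add: l_def)
  define I where "I = (\<lambda>k::nat. {1 / L ^ Suc k..1 / L ^ k})"
  define T where "T = (\<lambda>k x w. \<integral>\<^sup>+u. indicator (I k) u * v (x + u *\<^sub>R (w - x)) \<partial>lborel)"
  have inB: "x + u *\<^sub>R (w - x) \<in> ball a R" if "x \<in> ball a R" "w \<in> ball a R" "0 \<le> u" "u \<le> 1" for x w u
  proof -
    have "x + u *\<^sub>R (w - x) = (1 - u) *\<^sub>R x + u *\<^sub>R w" by (simp add: algebra_simps)
    then show ?thesis using convexD[OF convex_ball that(1,2), of "1 - u" u] that(3,4) by simp
  qed
  have Lk: "1 / L ^ Suc k \<le> 1 / L ^ k" "1 / L ^ k \<le> 1" "0 < 1 / L ^ k" for k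
    using L by (auto simp: field_simps)
  have seg: "ennreal A \<le> (\<Sum>k<N. ennreal (R * \<kappa> ^ k) + ennreal (R * l k) * T k x w)" if x: "x \<in> X" and w: "w \<in> D" for x w
  proof -
    have xw: "x \<in> ball a R" "w \<in> ball a R" using that X(2) D(2) by auto
    then have dxw: "dist x w < 2 * R" using dist_triangle2[of x w a] by (simp add: dist_commute)
    \<comment> \<open>The increments telescope from the point \<open>w\<close> at k = 0 down to a
      point so close to \<open>x\<close> that J = 1 there.\<close>
    define P where "P = (\<lambda>k. J (x + (1 / L ^ k) *\<^sub>R (w - x)))"
    have "dist x (x + (1 / L ^ N) *\<^sub>R (w - x)) < 2 * R / L ^ N"
      using dxw L by (simp add: dist_norm norm_minus_commute divide_strict_right_mono)
    then have "P N = 1" unfolding P_def by (rule near[OF x])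
    moreover have "1 + A \<le> P 0" using A(2)[OF w] by (simp add: P_def)
    moreover have "(\<Sum>k<N. P k - P (Suc k)) = P 0 - P N" by (rule sum_lessThan_telescope')
    ultimately have "A \<le> (\<Sum>k<N. P k - P (Suc k))" by simp
    also have "\<dots> \<le> (\<Sum>k<N. max 0 (P k - P (Suc k)))" by (intro sum_mono) auto
    finally have "ennreal A \<le> ennreal (\<Sum>k<N. max 0 (P k - P (Suc k)))" by (rule ennreal_leI)
    also have "\<dots> = (\<Sum>k<N. ennreal (P k - P (Suc k)))"
    proof -
      have "(\<Sum>k<N. ennreal (max 0 (P k - P (Suc k)))) = ennreal (\<Sum>k<N. max 0 (P k - P (Suc k)))"
        by (rule sum_ennreal) simp
      then show ?thesis by (simp add: ennreal_max_0)
    qed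
    also have "\<dots> \<le> (\<Sum>k<N. ennreal (R * \<kappa> ^ k) + ennreal (R * l k) * T k x w)"
    proof (rule sum_mono)
      fix k
      have "ennreal (P k - P (Suc k)) \<le> ennreal (R * ((1 / L ^ k - 1 / L ^ Suc k) / l k)) +
         ennreal (R * l k) * (\<integral>\<^sup>+u. indicator {1 / L ^ Suc k..1 / L ^ k} u * ennreal ((norm (G (x + u *\<^sub>R (w - x))))\<^sup>2) \<partial>lborel)"
        unfolding P_def
        by (rule segment_increment_bound[OF B(1) _ _ B(2) J G _ Lk(1,2) l])
           (use xw B(3) dxw Lk(3)[of "Suc k"] in auto)
      also have "(\<integral>\<^sup>+u. indicator {1 / L ^ Suc k..1 / L ^ k} u * ennreal ((norm (G (x + u *\<^sub>R (w - x))))\<^sup>2) \<partial>lborel) = T k x w"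
        unfolding T_def I_def
      proof (rule nn_integral_cong)
        fix u :: real
        show "indicator {1 / L ^ Suc k..1 / L ^ k} u * ennreal ((norm (G (x + u *\<^sub>R (w - x))))\<^sup>2)
          = indicator {1 / L ^ Suc k..1 / L ^ k} u * v (x + u *\<^sub>R (w - x))"
        proof (cases "u \<in> {1 / L ^ Suc k..1 / L ^ k}")
          case True
          then have "0 \<le> u" "u \<le> 1" using Lk(2)[of k] Lk(3)[of "Suc k"] unfolding atLeastAtMost_iff by linarith+
          then have "x + u *\<^sub>R (w - x) \<in> B" using inB[OF xw] B(3) by blast
          then show ?thesis by (simp add: v_def)
        qed simp
      qed
      also have "ennreal (R * ((1 / L ^ k - 1 / L ^ Suc k) / l k)) \<le> ennreal (R * \<kappa> ^ k)"
      proof (intro ennreal_leI mult_left_mono)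
        have "(1 / L ^ k - 1 / L ^ Suc k) / l k \<le> (1 / L ^ k) / l k"
          using l[of k] Lk(3)[of "Suc k"] by (intro divide_right_mono) auto
        also have "\<dots> = \<kappa> ^ k" using L by (simp add: l_def)
        finally show "(1 / L ^ k - 1 / L ^ Suc k) / l k \<le> \<kappa> ^ k" .
      qed (use R in simp)
      finally show "ennreal (P k - P (Suc k)) \<le> ennreal (R * \<kappa> ^ k) + ennreal (R * l k) * T k x w" by simp
    qed
    finally show ?thesis .
  qed
  have Tm [measurable]: "(\<lambda>w. T k x w) \<in> borel_measurable borel" for k x
    unfolding T_def I_def by measurable
  have bD: "emeasure lborel D < \<infinity>"
    using D(2) by (meson bounded_ball bounded_subset emeasure_bounded_finite)
  define mD where "mD = measure lborel D"
  have eD: "emeasure lborel D = ennreal mD" unfolding mD_def using bD by (simp add: emeasure_eq_ennreal_measure)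
  \<comment> \<open>Fubini and the homothety with parameter u turn the average over \<open>D\<close>
    into an energy integral: the Jacobian costs at most L^(2k+2), the interval \<open>I k\<close> is
    no longer than L^(-k), and all points reached lie in the disc of radius 2 R / L^k about
    \<open>x\<close>. Summed over \<open>x\<close>, the decay hypothesis bounds the mass within this
    distance of any point by C * \<kappa>^(2k).\<close>
  have scale: "(\<Sum>x\<in>X. ennreal (q x) * (\<integral>\<^sup>+w. indicator D w * T k x w \<partial>lborel)) \<le> ennreal (L * L * (L^k * \<kappa>^(2*k)) * (C * E))"
    if k: "k < N" for k
  proof -
    define r where "r = 2 * R / L ^ k"
    have vball [measurable]: "(\<lambda>\<zeta>. indicator (ball x r) \<zeta> * v \<zeta>) \<in> borel_measurable borel" for x
      by (intro borel_measurable_times_ennreal borel_measurable_indicator v) simp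
    have 1: "(\<integral>\<^sup>+w. indicator D w * T k x w \<partial>lborel) \<le> ennreal (L * L * L^k) * (\<integral>\<^sup>+\<zeta>. indicator (ball x r) \<zeta> * v \<zeta> \<partial>lborel)"
      if x: "x \<in> X" for x
    proof -
      have "(\<integral>\<^sup>+w. indicator D w * T k x w \<partial>lborel) =
         (\<integral>\<^sup>+w. \<integral>\<^sup>+u. indicator D w * (indicator (I k) u * v (x + u *\<^sub>R (w - x))) \<partial>lborel \<partial>lborel)"
        unfolding T_def by (intro nn_integral_cong nn_integral_cmult[symmetric]) (simp add: I_def)
      also have "\<dots> = (\<integral>\<^sup>+u. \<integral>\<^sup>+w. indicator D w * (indicator (I k) u * v (x + u *\<^sub>R (w - x))) \<partial>lborel \<partial>lborel)"
        by (rule lborel_pair.Fubini') (simp add: I_def case_prod_unfold)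
      also have "\<dots> \<le> (\<integral>\<^sup>+u. indicator (I k) u * (ennreal ((L ^ Suc k)\<^sup>2) * (\<integral>\<^sup>+\<zeta>. indicator (ball x r) \<zeta> * v \<zeta> \<partial>lborel)) \<partial>lborel)"
      proof (rule nn_integral_mono)
        fix u :: real
        show "(\<integral>\<^sup>+w. indicator D w * (indicator (I k) u * v (x + u *\<^sub>R (w - x))) \<partial>lborel)
            \<le> indicator (I k) u * (ennreal ((L ^ Suc k)\<^sup>2) * (\<integral>\<^sup>+\<zeta>. indicator (ball x r) \<zeta> * v \<zeta> \<partial>lborel))"
        proof (cases "u \<in> I k")
          case True
          then have u: "1 / L ^ Suc k \<le> u" "u \<le> 1 / L ^ k" by (auto simp: I_def)
          then have u0: "0 < u" using Lk(3)[of "Suc k"] by linarith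
          have "(\<integral>\<^sup>+w. indicator D w * (indicator (I k) u * v (x + u *\<^sub>R (w - x))) \<partial>lborel)
             \<le> (\<integral>\<^sup>+w. indicator (ball x r) (x + u *\<^sub>R (w - x)) * v (x + u *\<^sub>R (w - x)) \<partial>lborel)"
          proof (rule nn_integral_mono)
            fix w
            show "indicator D w * (indicator (I k) u * v (x + u *\<^sub>R (w - x)))
               \<le> indicator (ball x r) (x + u *\<^sub>R (w - x)) * v (x + u *\<^sub>R (w - x))"
            proof (cases "w \<in> D")
              case True
              have "x \<in> ball a R" "w \<in> ball a R" using x X(2) D(2) True by auto
              then have "dist x w < 2 * R" using dist_triangle2[of x w a] by (simp add: dist_commute)
              then have "u * dist x w < (1 / L ^ k) * (2 * R)"
                using u(2) u0 R by (intro mult_le_less_imp_less) (auto simp: L)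
              then have "x + u *\<^sub>R (w - x) \<in> ball x r"
                using u0 by (simp add: r_def dist_norm norm_minus_commute)
              then show ?thesis using \<open>u \<in> I k\<close> True by simp
            qed simp
          qed
          also have "\<dots> = ennreal (1 / u\<^sup>2) * (\<integral>\<^sup>+\<zeta>. indicator (ball x r) \<zeta> * v \<zeta> \<partial>lborel)"
            by (rule nn_integral_homothety[OF vball u0])
          also have "\<dots> \<le> ennreal ((L ^ Suc k)\<^sup>2) * (\<integral>\<^sup>+\<zeta>. indicator (ball x r) \<zeta> * v \<zeta> \<partial>lborel)"
          proof (intro mult_right_mono ennreal_leI)
            have "1 / u \<le> L ^ Suc k" using u(1) u0 L by (simp add: field_simps)
            then have "(1 / u)\<^sup>2 \<le> (L ^ Suc k)\<^sup>2" using u0 by (intro power_mono) auto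
            then show "1 / u\<^sup>2 \<le> (L ^ Suc k)\<^sup>2" by (simp add: power_divide)
          qed simp
          finally show ?thesis using True by simp
        qed simp
      qed
      also have "\<dots> = emeasure lborel (I k) * (ennreal ((L ^ Suc k)\<^sup>2) * (\<integral>\<^sup>+\<zeta>. indicator (ball x r) \<zeta> * v \<zeta> \<partial>lborel))"
        by (subst nn_integral_multc) (auto simp: I_def)
      also have "\<dots> \<le> ennreal (1 / L ^ k) * (ennreal ((L ^ Suc k)\<^sup>2) * (\<integral>\<^sup>+\<zeta>. indicator (ball x r) \<zeta> * v \<zeta> \<partial>lborel))"
        using Lk(1)[of k] Lk(3)[of "Suc k"] by (intro mult_right_mono) (auto simp: I_def intro!: ennreal_leI)
      also have "\<dots> = ennreal (L * L * L ^ k) * (\<integral>\<^sup>+\<zeta>. indicator (ball x r) \<zeta> * v \<zeta> \<partial>lborel)"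
        using L by (simp add: mult.assoc[symmetric] ennreal_mult[symmetric] power2_eq_square)
      finally show ?thesis .
    qed
    have "(\<Sum>x\<in>X. ennreal (q x) * (\<integral>\<^sup>+w. indicator D w * T k x w \<partial>lborel))
      \<le> (\<Sum>x\<in>X. ennreal (q x) * (ennreal (L * L * L^k) * (\<integral>\<^sup>+\<zeta>. indicator (ball x r) \<zeta> * v \<zeta> \<partial>lborel)))"
      by (intro sum_mono mult_left_mono 1) auto
    also have "\<dots> = ennreal (L * L * L^k) * (\<Sum>x\<in>X. ennreal (q x) * (\<integral>\<^sup>+\<zeta>. indicator (ball x r) \<zeta> * v \<zeta> \<partial>lborel))"
      by (simp add: sum_distrib_left mult_ac)
    also have "(\<Sum>x\<in>X. ennreal (q x) * (\<integral>\<^sup>+\<zeta>. indicator (ball x r) \<zeta> * v \<zeta> \<partial>lborel))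
       = (\<integral>\<^sup>+\<zeta>. (\<Sum>x\<in>X. ennreal (q x) * (indicator (ball x r) \<zeta> * v \<zeta>)) \<partial>lborel)"
    proof -
      have "(\<integral>\<^sup>+\<zeta>. ennreal (q x) * (indicator (ball x r) \<zeta> * v \<zeta>) \<partial>lborel) = ennreal (q x) * (\<integral>\<^sup>+\<zeta>. indicator (ball x r) \<zeta> * v \<zeta> \<partial>lborel)" for x
        using vball by (intro nn_integral_cmult) simp
      moreover have "(\<integral>\<^sup>+\<zeta>. (\<Sum>x\<in>X. ennreal (q x) * (indicator (ball x r) \<zeta> * v \<zeta>)) \<partial>lborel)
        = (\<Sum>x\<in>X. \<integral>\<^sup>+\<zeta>. ennreal (q x) * (indicator (ball x r) \<zeta> * v \<zeta>) \<partial>lborel)"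
      proof (rule nn_integral_sum)
        fix x
        have "(\<lambda>\<zeta>. ennreal (q x) * (indicator (ball x r) \<zeta> * v \<zeta>)) \<in> borel_measurable borel"
          using borel_measurable_times_ennreal[OF borel_measurable_const vball] .
        then show "(\<lambda>\<zeta>. ennreal (q x) * (indicator (ball x r) \<zeta> * v \<zeta>)) \<in> borel_measurable lborel" by simp
      qed
      ultimately show ?thesis by simp
    qed
    also have "\<dots> \<le> (\<integral>\<^sup>+\<zeta>. ennreal (C * \<kappa>^(2*k)) * v \<zeta> \<partial>lborel)"
    proof (rule nn_integral_mono)
      fix \<zeta>
      have "(\<Sum>x\<in>X. ennreal (q x) * (indicator (ball x r) \<zeta> * v \<zeta>)) = (\<Sum>x\<in>X. ennreal (q x * indicator (ball x r) \<zeta>)) * v \<zeta>"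
        unfolding sum_distrib_right by (intro sum.cong) (auto simp: indicator_def)
      also have "(\<Sum>x\<in>X. ennreal (q x * indicator (ball x r) \<zeta>)) = ennreal (\<Sum>x\<in>X. q x * indicator (ball x r) \<zeta>)"
        using X(3) by (intro sum_ennreal) auto
      also have "(\<Sum>x\<in>X. q x * indicator (ball x r) \<zeta>) = (\<Sum>x\<in>{x\<in>X. dist x \<zeta> < 2 * R / L ^ k}. q x)"
        unfolding sum.inter_filter[OF X(1)] by (intro sum.cong) (auto simp: r_def indicator_def)
      also have "ennreal \<dots> * v \<zeta> \<le> ennreal (C * \<kappa>^(2*k)) * v \<zeta>"
        by (intro mult_right_mono ennreal_leI decay[OF k]) auto
      finally show "(\<Sum>x\<in>X. ennreal (q x) * (indicator (ball x r) \<zeta> * v \<zeta>)) \<le> ennreal (C * \<kappa>^(2*k)) * v \<zeta>" .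
    qed
    also have "\<dots> = ennreal (C * \<kappa>^(2*k)) * (\<integral>\<^sup>+\<zeta>. v \<zeta> \<partial>lborel)" by (rule nn_integral_cmult) measurable
    also have "\<dots> \<le> ennreal (C * \<kappa>^(2*k)) * ennreal E" using E(1) by (intro mult_left_mono) (auto simp: v_def)
    also have "ennreal (L * L * L^k) * (ennreal (C * \<kappa>^(2*k)) * ennreal E) = ennreal (L * L * (L^k * \<kappa>^(2*k)) * (C * E))"
      using L \<kappa> C E(2) by (simp add: ennreal_mult[symmetric] mult_ac)
    finally show ?thesis by (simp add: mult_left_mono)
  qed
  have "ennreal (A * sum q X * mD) = (\<Sum>x\<in>X. ennreal (q x) * (\<integral>\<^sup>+w. indicator D w * ennreal A \<partial>lborel))"
  proof -
    have "(\<integral>\<^sup>+w. indicator D w * ennreal A \<partial>lborel) = ennreal mD * ennreal A"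
      by (simp add: nn_integral_multc eD)
    then have "(\<Sum>x\<in>X. ennreal (q x) * (\<integral>\<^sup>+w. indicator D w * ennreal A \<partial>lborel)) = (\<Sum>x\<in>X. ennreal (q x)) * (ennreal mD * ennreal A)"
      by (simp add: sum_distrib_right)
    also have "(\<Sum>x\<in>X. ennreal (q x)) = ennreal (sum q X)" using X(3) by (rule sum_ennreal)
    finally show ?thesis using A(1) X(3) by (simp add: ennreal_mult[symmetric] mD_def mult_ac sum_nonneg)
  qed
  also have "\<dots> \<le> (\<Sum>x\<in>X. ennreal (q x) * (\<integral>\<^sup>+w. (\<Sum>k<N. indicator D w * ennreal (R * \<kappa> ^ k) + ennreal (R * l k) * (indicator D w * T k x w)) \<partial>lborel))"
  proof (intro sum_mono mult_left_mono nn_integral_mono)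
    fix x w assume "x \<in> X"
    show "indicator D w * ennreal A \<le> (\<Sum>k<N. indicator D w * ennreal (R * \<kappa> ^ k) + ennreal (R * l k) * (indicator D w * T k x w))"
      using seg[OF \<open>x \<in> X\<close>, of w] by (cases "w \<in> D") auto
  qed auto
  also have "\<dots> = (\<Sum>x\<in>X. ennreal (q x) * (\<Sum>k<N. ennreal (mD * (R * \<kappa> ^ k)) + ennreal (R * l k) * (\<integral>\<^sup>+w. indicator D w * T k x w \<partial>lborel)))"
    using R \<kappa> by (simp add: nn_integral_sum nn_integral_add nn_integral_cmult nn_integral_multc eD ennreal_mult[symmetric] mD_def)
  also have "\<dots> = (\<Sum>k<N. (\<Sum>x\<in>X. ennreal (q x)) * ennreal (mD * (R * \<kappa> ^ k)) + ennreal (R * l k) * (\<Sum>x\<in>X. ennreal (q x) * (\<integral>\<^sup>+w. indicator D w * T k x w \<partial>lborel)))"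
    by (simp add: sum_distrib_left sum_distrib_right sum.swap[of _ X] distrib_left sum.distrib mult_ac)
  also have "\<dots> \<le> (\<Sum>k<N. 1 * ennreal (mD * (R * \<kappa> ^ k)) + ennreal (R * l k) * ennreal (L * L * (L^k * \<kappa>^(2*k)) * (C * E)))"
  proof (intro sum_mono add_mono mult_right_mono mult_left_mono scale)
    have "(\<Sum>x\<in>X. ennreal (q x)) = ennreal (sum q X)" using X(3) by (rule sum_ennreal)
    also have "\<dots> \<le> ennreal 1" using X(4) by (rule ennreal_leI)
    finally show "(\<Sum>x\<in>X. ennreal (q x)) \<le> 1" by simp
  qed auto
  also have "\<dots> = (\<Sum>k<N. ennreal (R * (mD + L\<^sup>2 * C * E) * \<kappa> ^ k))"
  proof (intro sum.cong refl)
    fix k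
    have "R * l k * (L * L * (L^k * \<kappa>^(2*k)) * (C * E)) = R * (L\<^sup>2 * C * E) * \<kappa> ^ k"
      using L \<kappa> by (simp add: l_def power2_eq_square mult_2 power_add)
    then have "ennreal (R * l k) * ennreal (L * L * (L^k * \<kappa>^(2*k)) * (C * E)) = ennreal (R * (L\<^sup>2 * C * E) * \<kappa> ^ k)"
      using R l[of k] L \<kappa> C E(2) by (subst ennreal_mult[symmetric]) auto
    then show "1 * ennreal (mD * (R * \<kappa> ^ k)) + ennreal (R * l k) * ennreal (L * L * (L^k * \<kappa>^(2*k)) * (C * E)) = ennreal (R * (mD + L\<^sup>2 * C * E) * \<kappa> ^ k)"
      using R \<kappa> C E(2) by (simp add: ennreal_plus[symmetric] mD_def algebra_simps del: ennreal_plus)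
  qed
  also have "\<dots> = ennreal (\<Sum>k<N. R * (mD + L\<^sup>2 * C * E) * \<kappa> ^ k)"
    using R \<kappa> C E(2) by (intro sum_ennreal) (auto simp: mD_def)
  finally have "A * sum q X * mD \<le> (\<Sum>k<N. R * (mD + L\<^sup>2 * C * E) * \<kappa> ^ k)"
    using R \<kappa> C E(2) by (subst (asm) ennreal_le_iff) (auto simp: mD_def intro!: sum_nonneg)
  also have "\<dots> = R * (mD + L\<^sup>2 * C * E) * (\<Sum>k<N. \<kappa> ^ k)" by (simp add: sum_distrib_left)
  also have "\<dots> \<le> R * (mD + L\<^sup>2 * C * E) * (1 / (1 - \<kappa>))"
  proof (rule mult_left_mono)
    have "(\<Sum>k<N. \<kappa> ^ k) = (1 - \<kappa> ^ N) / (1 - \<kappa>)" using \<kappa> by (simp add: sum_gp_strict)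
    also have "\<dots> \<le> 1 / (1 - \<kappa>)" using \<kappa> by (intro divide_right_mono) auto
    finally show "(\<Sum>k<N. \<kappa> ^ k) \<le> 1 / (1 - \<kappa>)" .
  qed (use R C E(2) in \<open>auto simp: mD_def\<close>)
  finally have "A * sum q X * mD \<le> R * (mD + L\<^sup>2 * C * E) / (1 - \<kappa>)" by simp
  moreover have "A * c * mD \<le> A * sum q X * mD"
    using A(1) X(5) by (intro mult_right_mono mult_left_mono) (auto simp: mD_def)
  ultimately show ?thesis by (simp add: mD_def)
qed

section \<open>Areas of holomorphic images\<close>

text \<open>The change-of-variables theorem is stated on real Cartesian spaces; \<open>cvec\<close>
  and \<open>vecc\<close> carry it over to the complex plane.\<close>

definition cvec :: "real^2 \<Rightarrow> complex" where "cvec v = Complex (v$1) (v$2)"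
definition vecc :: "complex \<Rightarrow> real^2" where "vecc z = vector [Re z, Im z]"

lemma cvec_vecc [simp]: "cvec (vecc z) = z" "vecc (cvec v) = v"
  by (auto simp: cvec_def vecc_def vec_eq_iff forall_2)

lemma bounded_linear_cvec: "bounded_linear cvec"
proof (rule linear_conv_bounded_linear[THEN iffD1], rule linearI)
qed (auto simp: cvec_def complex_eq_iff)

lemma bounded_linear_vecc: "bounded_linear vecc"
proof (rule linear_conv_bounded_linear[THEN iffD1], rule linearI)
qed (auto simp: vecc_def vec_eq_iff forall_2)

lemma measurable_cvec [measurable]: "cvec \<in> borel_measurable borel" "vecc \<in> borel_measurable borel"
  by (auto intro!: borel_measurable_continuous_onI linear_continuous_on bounded_linear_cvec bounded_linear_vecc)

text \<open>Lebesgue measure is determined by its values on boxes, and \<open>cvec\<close> maps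
  boxes to boxes with the same side lengths.\<close>

lemma distr_cvec: "distr lborel borel cvec = lborel"
proof (rule lborel_eqI[symmetric])
  fix l u :: complex assume le: "\<And>b. b \<in> Basis \<Longrightarrow> l \<bullet> b \<le> u \<bullet> b"
  have eq: "cvec -` box l u = box (vecc l) (vecc u)"
    by (auto simp: box_def cvec_def vecc_def Basis_complex_def Basis_vec_def axis_eq_axis inner_axis forall_2 UNIV_2)
  have *: "(Basis :: (real^2) set) = {axis 1 1, axis 2 1}" by (auto simp: Basis_vec_def UNIV_2)
  have "emeasure (distr lborel borel cvec) (box l u) = emeasure lborel (box (vecc l) (vecc u))"
    by (simp add: emeasure_distr eq)
  also have "\<dots> = ennreal (\<Prod>b\<in>Basis. (vecc u - vecc l) \<bullet> b)"
    by (rule emeasure_lborel_box) (use le[of 1] le[of \<i>] in \<open>auto simp: * inner_axis vecc_def Basis_complex_def\<close>)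
  also have "(\<Prod>b\<in>Basis. (vecc u - vecc l) \<bullet> b) = (\<Prod>b\<in>Basis. (u - l) \<bullet> b)"
    by (simp add: * axis_eq_axis inner_axis vecc_def Basis_complex_def complex_eq_iff)
  finally show "emeasure (distr lborel borel cvec) (box l u) = ennreal (\<Prod>b\<in>Basis. (u - l) \<bullet> b)" .
qed simp

text \<open>The real Jacobian determinant of a holomorphic map is |\<phi>'|^2, so this is the area
  formula for an injective map. It lets the energy carried by inverse branches be read as the area
  of their images.\<close>

lemma nn_integral_holomorphic_image:
  assumes B: "open B" and \<phi>: "\<phi> holomorphic_on B" "inj_on \<phi> B"
    and P: "P \<in> sets borel" "P \<subseteq> B" "bounded (\<phi> ` P)"
  shows "\<phi> ` P \<in> sets borel"
    and "(\<integral>\<^sup>+z. indicator P z * ennreal ((norm (deriv \<phi> z))\<^sup>2) \<partial>lborel) = emeasure lborel (\<phi> ` P)"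
proof -
  obtain \<psi> where \<psi>: "\<psi> holomorphic_on (\<phi> ` B)" "\<And>z. z \<in> B \<Longrightarrow> \<psi> (\<phi> z) = z"
    using holomorphic_has_inverse[OF \<phi>(1) B \<phi>(2)] by metis
  have oB: "open (\<phi> ` B)" using open_mapping_thm3[OF \<phi>(1) B \<phi>(2)] .
  have "\<phi> ` P = \<psi> -` P \<inter> \<phi> ` B" using \<psi>(2) P(2) by (force simp: image_iff)
  moreover have "\<psi> -` P \<inter> \<phi> ` B \<in> sets borel"
  proof -
    have "(\<lambda>x. if x \<in> \<phi> ` B then \<psi> x else \<psi> x) \<in> borel_measurable (restrict_space borel (\<phi> ` B))"
      using borel_measurable_continuous_on_restrict[OF holomorphic_on_imp_continuous_on[OF \<psi>(1)]] by simp
    then have "\<psi> -` P \<inter> space (restrict_space borel (\<phi> ` B)) \<in> sets (restrict_space borel (\<phi> ` B))"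
      using P(1) by (auto intro: measurable_sets)
    then show ?thesis using oB by (simp add: sets_restrict_space_iff space_restrict_space)
  qed
  ultimately show m: "\<phi> ` P \<in> sets borel" by simp
  define Q where "Q = cvec -` P"
  define F where "F = (\<lambda>v. vecc (\<phi> (cvec v)))"
  define F' where "F' = (\<lambda>v h. vecc (deriv \<phi> (cvec v) * cvec h))"
  have Q: "Q \<in> sets borel" unfolding Q_def using measurable_sets[OF measurable_cvec(1) P(1)] by simp
  have der: "(F has_derivative F' v) (at v within Q)" if "v \<in> Q" for v
  proof -
    have "cvec v \<in> B" using that P(2) by (auto simp: Q_def)
    then have 1: "(\<phi> has_derivative (\<lambda>h. deriv \<phi> (cvec v) * h)) (at (cvec v))"
      using holomorphic_derivI[OF \<phi>(1) B] by (simp add: has_field_derivative_def)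
    have 2: "(cvec has_derivative cvec) (at v within Q)" "(vecc has_derivative vecc) (at (\<phi> (cvec v)))"
      by (auto intro: bounded_linear_imp_has_derivative bounded_linear_cvec bounded_linear_vecc)
    show ?thesis unfolding F_def F'_def
      using has_derivative_compose[OF has_derivative_compose[OF 2(1) 1] 2(2)] by simp
  qed
  have inj: "inj_on F Q"
  proof (rule inj_onI)
    fix x y assume "x \<in> Q" "y \<in> Q" "F x = F y"
    then have "\<phi> (cvec x) = \<phi> (cvec y)" unfolding F_def by (metis cvec_vecc(1))
    then have "cvec x = cvec y" using \<phi>(2) P(2) \<open>x \<in> Q\<close> \<open>y \<in> Q\<close> by (auto simp: Q_def dest: inj_onD)
    then show "x = y" by (metis cvec_vecc(2))
  qed
  have det: "\<bar>det (matrix (F' v))\<bar> = (norm (deriv \<phi> (cvec v)))\<^sup>2" for v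
    by (simp add: det_2 matrix_def F'_def vecc_def cvec_def axis_def cmod_power2 flip: power2_eq_square)
  have FQ: "F ` Q = cvec -` (\<phi> ` P)"
  proof
    show "F ` Q \<subseteq> cvec -` (\<phi> ` P)" by (auto simp: F_def Q_def)
    show "cvec -` (\<phi> ` P) \<subseteq> F ` Q"
    proof
      fix v assume "v \<in> cvec -` (\<phi> ` P)"
      then obtain z where "z \<in> P" "cvec v = \<phi> z" by auto
      then have "v = F (vecc z)" "vecc z \<in> Q" by (auto simp: F_def Q_def) (metis cvec_vecc(2))
      then show "v \<in> F ` Q" by blast
    qed
  qed
  have em: "emeasure lborel (cvec -` A) = emeasure lborel A" if "A \<in> sets borel" for A
  proof -
    have "emeasure (distr lborel borel cvec) A = emeasure lborel (cvec -` A)"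
      using that by (simp add: emeasure_distr)
    then show ?thesis by (simp add: distr_cvec)
  qed
  have FQb: "F ` Q \<in> sets borel" unfolding FQ using measurable_sets[OF measurable_cvec(1) m] by simp
  have "surj cvec" by (metis cvec_vecc(1) surjI)
  then have "cvec ` Q = P" unfolding Q_def by (rule surj_image_vimage_eq)
  then have "F ` Q = vecc ` (\<phi> ` P)" unfolding F_def by (metis image_image)
  then have bFQ: "bounded (F ` Q)" using bounded_linear_image[OF P(3) bounded_linear_vecc] by simp
  have FQl: "F ` Q \<in> lmeasurable" using bFQ
    by (rule bounded_set_imp_lmeasurable) (metis FQb sets_completionI_sets sets_lborel)
  have "((\<lambda>v. (norm (deriv \<phi> (cvec v)))\<^sup>2) has_integral measure lebesgue (F ` Q)) Q"
    using has_measure_differentiable_image[OF _ der inj, of "measure lebesgue (F ` Q)"] FQl Q det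
    by (simp add: sets_completionI_sets)
  then have "(\<integral>\<^sup>+v. ennreal (indicator Q v * (norm (deriv \<phi> (cvec v)))\<^sup>2) \<partial>lborel) = ennreal (measure lebesgue (F ` Q))"
    by (intro nn_integral_has_integral_lebesgue) auto
  also have "\<dots> = emeasure lborel (F ` Q)"
    using emeasure_bounded_finite[OF bFQ] FQb by (subst emeasure_eq_ennreal_measure) (auto simp: measure_completion)
  also have "\<dots> = emeasure lborel (\<phi> ` P)" unfolding FQ by (rule em[OF m])
  finally have fin: "(\<integral>\<^sup>+v. ennreal (indicator Q v * (norm (deriv \<phi> (cvec v)))\<^sup>2) \<partial>lborel) = emeasure lborel (\<phi> ` P)" .
  have meas: "(\<lambda>z. indicator P z * ennreal ((norm (deriv \<phi> z))\<^sup>2)) \<in> borel_measurable borel"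
  proof -
    have "continuous_on B (deriv \<phi>)"
      using holomorphic_deriv[OF \<phi>(1) B] by (rule holomorphic_on_imp_continuous_on)
    then have "(\<lambda>z. indicator B z *\<^sub>R deriv \<phi> z) \<in> borel_measurable borel"
      using B by (intro borel_measurable_continuous_on_indicator) auto
    then have "(\<lambda>z. indicator P z * ennreal ((norm (indicator B z *\<^sub>R deriv \<phi> z))\<^sup>2)) \<in> borel_measurable borel"
      using P(1) by measurable
    moreover have "indicator P z * ennreal ((norm (indicator B z *\<^sub>R deriv \<phi> z))\<^sup>2) = indicator P z * ennreal ((norm (deriv \<phi> z))\<^sup>2)" for z
      using P(2) by (auto simp: indicator_def)
    ultimately show ?thesis by simp
  qed
  have "(\<integral>\<^sup>+z. indicator P z * ennreal ((norm (deriv \<phi> z))\<^sup>2) \<partial>lborel)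
      = (\<integral>\<^sup>+z. indicator P z * ennreal ((norm (deriv \<phi> z))\<^sup>2) \<partial>(distr lborel borel cvec))"
    by (simp add: distr_cvec)
  also have "\<dots> = (\<integral>\<^sup>+v. indicator P (cvec v) * ennreal ((norm (deriv \<phi> (cvec v)))\<^sup>2) \<partial>lborel)"
    using meas by (subst nn_integral_distr) auto
  also have "\<dots> = (\<integral>\<^sup>+v. ennreal (indicator Q v * (norm (deriv \<phi> (cvec v)))\<^sup>2) \<partial>lborel)"
    by (rule nn_integral_cong) (auto simp: Q_def indicator_def)
  finally show "(\<integral>\<^sup>+z. indicator P z * ennreal ((norm (deriv \<phi> z))\<^sup>2) \<partial>lborel) = emeasure lborel (\<phi> ` P)"
    using fin by simp
qed

section \<open>Backward invariant maps\<close>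

locale BI_system =
  fixes g :: "complex \<Rightarrow> complex" and U :: "nat \<Rightarrow> complex set" and d :: nat and K :: "complex set"
  assumes d2: "d \<ge> 2" and BI: "BI_map d g U" and K_sub: "K \<subseteq> (\<Inter>i. U i)"
    and full: "full_compact K" and preK: "preimage_BI g U K = K" and postK: "postcritical_set g U \<subseteq> K"
begin

lemma U_facts:
  shows U_open: "open (U i)" and U_sc: "simply_connected (U i)" and U_conn: "connected (U i)"
    and U_ne: "U i \<noteq> {}" and U_UNIV: "U i \<noteq> UNIV"
proof -
  obtain \<gamma> where \<gamma>: "simple_path \<gamma>" "pathfinish \<gamma> = pathstart \<gamma>" "U i = inside (path_image \<gamma>)"
    using BI unfolding BI_map_def jordan_domain_def by metis
  have "bounded (U i)" and "open (U i)" "connected (U i)" "U i \<noteq> {}"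
    using Jordan_inside_outside[OF \<gamma>(1,2)] \<gamma>(3) by auto
  then show "open (U i)" "connected (U i)" "U i \<noteq> {}" by blast+
  show "simply_connected (U i)" using simply_connected_inside_simple_path[OF \<gamma>(1)] \<gamma>(3) by simp
  show "U i \<noteq> UNIV" using \<open>bounded (U i)\<close> not_bounded_UNIV by metis
qed

lemma K_U: "K \<subseteq> U i" using K_sub by blast

lemma compact_K: "compact K" and connected_compl_K: "connected (- K)"
  using full unfolding full_compact_def by auto

lemma g_hol: "g holomorphic_on U (Suc i)"
proof -
  have "g holomorphic_on (\<Union>i\<in>{1..}. U i)" using BI by (simp add: BI_map_def)
  then show ?thesis by (rule holomorphic_on_subset) force
qed

lemma g_image: "g ` U (Suc i) = U i" and g_degree: "proper_holomorphic_degree d g (U (Suc i)) (U i)"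
  using BI unfolding BI_map_def by blast+

lemma g_proper: "\<lbrakk>compact C; C \<subseteq> U i\<rbrakk> \<Longrightarrow> compact {x\<in>U (Suc i). g x \<in> C}"
  using proper_map_top_of_setD(2) g_degree unfolding proper_holomorphic_degree_def by blast

lemma g_fibre: "w \<in> U i \<Longrightarrow> finite {z \<in> U (Suc i). g z = w} \<and> (\<Sum>z\<in>{z \<in> U (Suc i). g z = w}. zorder (\<lambda>x. g x - w) z) = int d"
  using g_degree unfolding proper_holomorphic_degree_def by blast

lemma g_K: "z \<in> U (Suc i) \<Longrightarrow> g z \<in> K \<longleftrightarrow> z \<in> K"
proof -
  assume "z \<in> U (Suc i)"
  then have "z \<in> (\<Union>i\<in>{1..}. U i)" by force
  then show ?thesis using preK unfolding preimage_BI_def by blast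
qed

section \<open>Critical points and total ramification\<close>

lemma critical_points: "finite {z\<in>U (Suc i). deriv g z = 0} \<and> (\<Sum>z\<in>{z\<in>U (Suc i). deriv g z = 0}. zorder (deriv g) z) = int d - 1"
  by (rule Riemann_Hurwitz_simply_connected[OF U_open U_sc U_UNIV U_ne U_open U_sc U_UNIV g_hol _ g_proper g_fibre])
     (simp_all add: g_image)

text \<open>If \<open>deriv g\<close> vanished identically, the critical set would be the infinite
  set \<open>U (Suc i)\<close>, contrary to Riemann-Hurwitz; so \<open>zorder\<close> is a genuine
  multiplicity here.\<close>

lemma deriv_g_zorder_pos: "\<lbrakk>z \<in> U (Suc i); deriv g z = 0\<rbrakk> \<Longrightarrow> zorder (deriv g) z > 0"
proof -
  assume z: "z \<in> U (Suc i)" "deriv g z = 0"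
  have "\<exists>w\<in>U (Suc i). deriv g w \<noteq> 0"
  proof (rule ccontr)
    assume "\<not> ?thesis"
    then have "{z\<in>U (Suc i). deriv g z = 0} = U (Suc i)" by blast
    then have "finite (U (Suc i))" using critical_points[of i] by simp
    then show False using U_open U_ne finite_imp_not_open by blast
  qed
  then show ?thesis
    using zorder_exist_zero[OF holomorphic_deriv[OF g_hol U_open] U_open U_conn z(1)] z(2) by simp
qed

text \<open>The critical points of \<open>U 1\<close> lie in every \<open>U (Suc i)\<close> by the
  definition of a BI map, and on each level the multiplicities add up to d - 1. As all
  multiplicities are positive, no level has room for further critical points.\<close>

lemma critical_set_eq: "{z\<in>U (Suc i). deriv g z = 0} = critical_set g (U 1)"
proof -
  define C where "C = critical_set g (U 1)"
  define C' where "C' = {z\<in>U (Suc i). deriv g z = 0}"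
  have C: "C = {z\<in>U (Suc 0). deriv g z = 0}" by (simp add: C_def critical_set_def)
  have "C \<subseteq> U (Suc i)" using BI unfolding BI_map_def C_def by blast
  then have sub: "C \<subseteq> C'" unfolding C C'_def by blast
  have fin: "finite C'" and sum: "(\<Sum>z\<in>C'. zorder (deriv g) z) = (\<Sum>z\<in>C. zorder (deriv g) z)"
    using critical_points[of i] critical_points[of 0] unfolding C C'_def by auto
  have "(\<Sum>z\<in>C' - C. zorder (deriv g) z) = 0"
    using sum_diff[OF fin sub, of "zorder (deriv g)"] sum by simp
  moreover have "0 < (\<Sum>z\<in>C' - C. zorder (deriv g) z)" if "C' - C \<noteq> {}"
    using that fin deriv_g_zorder_pos by (intro sum_pos) (auto simp: C'_def)
  ultimately show ?thesis using sub unfolding C_def C'_def by auto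
qed

text \<open>The critical value belongs to the postcritical set, hence to \<open>K\<close>, and
  complete invariance pulls it back to the critical point.\<close>

lemma critical_in_K: "\<lbrakk>z \<in> U (Suc i); deriv g z = 0\<rbrakk> \<Longrightarrow> z \<in> K"
proof -
  assume z: "z \<in> U (Suc i)" "deriv g z = 0"
  then have c: "z \<in> critical_set g (U 1)" using critical_set_eq by blast
  have "(g ^^ 1) z \<in> (\<Union>n\<in>{0<..}. (g ^^ n) ` critical_set g (U 1))"
    by (rule UN_I[of 1]) (use c in auto)
  then have "g z \<in> postcritical_set g U"
    unfolding postcritical_set_def using closure_subset by fastforce
  then show ?thesis using postK g_K[OF z(1)] by blast
qed

lemma critical_set_nonempty: "critical_set g (U 1) \<noteq> {}"
proof
  assume "critical_set g (U 1) = {}"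
  then have "int d - 1 = 0" using critical_points[of 0] critical_set_eq[of 0] by simp
  then show False using d2 by simp
qed

lemma critical_point_in_K: obtains c where "c \<in> critical_set g (U 1)" "c \<in> K"
proof -
  obtain c where "c \<in> critical_set g (U 1)" using critical_set_nonempty by blast
  then show ?thesis using that critical_in_K[of c 0] by (auto simp: critical_set_def)
qed

lemma K_nonempty: "K \<noteq> {}" using critical_point_in_K by blast

text \<open>If \<open>x\<close> is the only preimage of \<open>g x\<close>, it has multiplicity d
  there, so \<open>x\<close> is a critical point of multiplicity d - 1. This exhausts the
  Riemann-Hurwitz count.\<close>

lemma total_ramification_critical:
  assumes x: "x \<in> U (Suc i)" "{z\<in>U (Suc i). g z = g x} = {x}" and y: "y \<in> critical_set g (U 1)"
  shows "y = x"
proof (rule ccontr)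
  assume ne: "y \<noteq> x"
  have "g x \<in> U i" using x(1) g_image by blast
  then have zx: "zorder (\<lambda>z. g z - g x) x = int d" using g_fibre[of "g x" i] x(2) by simp
  have hol: "(\<lambda>z. g z - g x) holomorphic_on U (Suc i)" using g_hol by (auto intro!: holomorphic_intros)
  define C where "C = {z\<in>U (Suc i). deriv g z = 0}"
  have gd: "deriv (\<lambda>z. g z - g x) z = deriv g z" if "z \<in> U (Suc i)" for z
    using holomorphic_on_imp_differentiable_at[OF g_hol U_open that] by (subst deriv_diff) auto
  have "\<exists>\<^sub>F w in at x. g w - g x \<noteq> 0"
  proof -
    have "\<forall>\<^sub>F w in at x. w \<in> U (Suc i) - {x}" by (rule eventually_at_in_open[OF U_open x(1)])
    then have "\<forall>\<^sub>F w in at x. g w - g x \<noteq> 0"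
      by eventually_elim (use x(2) in auto)
    then show ?thesis by (rule eventually_frequently[rotated]) simp
  qed
  moreover have "isolated_singularity_at (\<lambda>z. g z - g x) x" "not_essential (\<lambda>z. g z - g x) x"
    using hol x(1) U_open by (auto intro: isolated_singularity_at_holomorphic not_essential_holomorphic holomorphic_on_subset)
  ultimately have "zorder (deriv (\<lambda>z. g z - g x)) x = int d - 1"
    using zorder_deriv_minus_1[of "\<lambda>z. g z - g x" x] zx d2 by simp
  moreover have "zorder (deriv (\<lambda>z. g z - g x)) x = zorder (deriv g) x"
  proof (rule zorder_cong)
    have "\<forall>\<^sub>F z in at x. z \<in> U (Suc i)" using U_open x(1) by (intro eventually_at_in_open') auto
    then show "\<forall>\<^sub>F z in at x. deriv (\<lambda>z. g z - g x) z = deriv g z" by eventually_elim (rule gd)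
  qed simp
  ultimately have ord: "zorder (deriv g) x = int d - 1" by simp
  have fin: "finite C" and sum: "(\<Sum>z\<in>C. zorder (deriv g) z) = int d - 1"
    using critical_points[of i] unfolding C_def by auto
  have pos: "z \<in> C \<Longrightarrow> zorder (deriv g) z > 0" for z using deriv_g_zorder_pos by (auto simp: C_def)
  have yC: "y \<in> C" using y critical_set_eq[of i] by (simp add: C_def)
  have xC: "x \<in> C"
  proof (rule ccontr)
    assume "x \<notin> C"
    then have "deriv g x \<noteq> 0" using x(1) by (simp add: C_def)
    then have "zorder (\<lambda>z. g z - g x) x = 1" by (rule zorder_simple_zero[OF U_open g_hol x(1)])
    then show False using zx d2 by simp
  qed
  have "(\<Sum>z\<in>{x,y}. zorder (deriv g) z) \<le> (\<Sum>z\<in>C. zorder (deriv g) z)"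
    by (rule sum_mono2[OF fin]) (use xC yC pos in \<open>auto intro: less_imp_le\<close>)
  then show False using ne sum ord pos[OF yC] by simp
qed

text \<open>Neither \<open>x\<close> nor \<open>g x\<close> can be totally ramified at the same time: there is only one such point, it would be
  a fixed point equal to its own preimage, and this is the excluded case of a singleton postcritical set.\<close>

lemma second_preimage_not_unique:
  assumes x: "x \<in> K"
  shows "\<exists>x'\<in>K. x' \<noteq> x \<and> g (g x') = g (g x)"
proof (rule ccontr)
  assume H: "\<not> ?thesis"
  have xU: "x \<in> U i" for i using x K_U by blast
  have gx: "g x \<in> K" using g_K[OF xU] x by blast
  \<comment> \<open>By \<open>H\<close>, the point \<open>x\<close> is alone in its fibre under g o
    g. This forces \<open>x\<close> to be alone over \<open>g x\<close>, and then \<open>g x\<close>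
    to be alone over \<open>g (g x)\<close>, since every preimage of the latter has a preimage in
    \<open>K\<close>.\<close>
  have 1: "{z\<in>U (Suc 0). g z = g x} = {x}"
  proof (intro equalityI subsetI)
    fix z assume z: "z \<in> {z\<in>U (Suc 0). g z = g x}"
    then have "z \<in> K" using g_K[of z 0] gx by auto
    then show "z \<in> {x}" using H z by auto
  qed (use xU in auto)
  have 2: "{z\<in>U (Suc 0). g z = g (g x)} = {g x}"
  proof (intro equalityI subsetI)
    fix z assume z: "z \<in> {z\<in>U (Suc 0). g z = g (g x)}"
    moreover have "g (g x) \<in> K" using g_K[of "g x" 0] gx K_U[of "Suc 0"] by auto
    ultimately have zK: "z \<in> K" using g_K[of z 0] by auto
    then have "z \<in> g ` U (Suc 0)" using g_image[of 0] K_U[of 0] by auto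
    then obtain y where y: "y \<in> U (Suc 0)" "g y = z" by auto
    then have "y \<in> K" using zK g_K[OF y(1)] by simp
    then have "y = x" using H y z by auto
    then show "z \<in> {g x}" using y by simp
  qed (use gx K_U[of "Suc 0"] in auto)
  have gU: "g x \<in> U (Suc 0)" using gx K_U[of "Suc 0"] by auto
  obtain y where y: "y \<in> critical_set g (U 1)" using critical_set_nonempty by blast
  have ygx: "y = g x" by (rule total_ramification_critical[OF gU 2 y])
  have yx: "y = x" by (rule total_ramification_critical[OF xU 1 y])
  have all: "critical_set g (U 1) = {x}"
    using total_ramification_critical[OF xU 1] y yx by blast
  have fx: "g x = x" using ygx yx by simp
  then have it: "(g ^^ n) x = x" for n by (induction n) auto
  have "postcritical_set g U = {x}"
  proof -
    have "(\<Union>n\<in>{0<..}. (g ^^ n) ` {x}) = {x}" using it by auto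
    then show ?thesis unfolding postcritical_set_def all by simp
  qed
  then have "preimage_BI g U {x} \<noteq> {x}" using BI unfolding BI_map_def by blast
  moreover have "preimage_BI g U {x} = {x}"
  proof (intro equalityI subsetI)
    fix z assume "z \<in> preimage_BI g U {x}"
    then obtain i where i: "z \<in> U i" "1 \<le> i" "g z = x" unfolding preimage_BI_def by auto
    then obtain j where "i = Suc j" by (cases i) auto
    then have "z \<in> K" using i g_K[of z j] x by auto
    then have "z \<in> {z\<in>U (Suc 0). g z = g x}" using K_U[of "Suc 0"] fx i by auto
    then show "z \<in> {x}" using 1 by blast
  next
    fix z assume "z \<in> {x}"
    then show "z \<in> preimage_BI g U {x}" using xU[of 1] fx by (auto simp: preimage_BI_def)
  qed
  ultimately show False by blast
qed

text \<open>These are the two values that Schottky's theorem needs: inverse branches outside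
  \<open>K\<close> omit both.\<close>

lemma K_two_points: obtains a b where "a \<in> K" "b \<in> K" "a \<noteq> b"
  using K_nonempty second_preimage_not_unique by blast

section \<open>Iterates as coverings outside the invariant set\<close>

lemma iterate_in: "z \<in> U (n + k) \<Longrightarrow> (g ^^ n) z \<in> U k"
proof (induction n arbitrary: z)
  case (Suc n)
  then have "g z \<in> U (n + k)" using g_image[of "n + k"] by auto
  then show ?case using Suc.IH by (simp add: funpow_swap1)
qed simp

lemma iterate_K: "z \<in> U (n + k) \<Longrightarrow> (g ^^ n) z \<in> K \<longleftrightarrow> z \<in> K"
proof (induction n arbitrary: z)
  case (Suc n)
  then have "g z \<in> U (n + k)" using g_image[of "n + k"] by auto
  then show ?case using Suc.IH[of "g z"] g_K[of z "n + k"] Suc.prems by (simp add: funpow_swap1)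
qed simp

lemma iterate_hol: "(g ^^ n) holomorphic_on U (n + k)"
proof (induction n)
  case (Suc n)
  have "((g ^^ n) \<circ> g) holomorphic_on U (Suc (n + k))"
    by (rule holomorphic_on_compose_gen[OF g_hol Suc]) (use g_image in blast)
  then show ?case by (simp add: funpow_swap1 o_def)
qed (simp add: id_def holomorphic_on_ident)

lemma iterate_deriv: "z \<in> U (n + k) - K \<Longrightarrow> deriv (g ^^ n) z \<noteq> 0"
proof (induction n arbitrary: z)
  case (Suc n)
  have z: "z \<in> U (Suc (n + k))" "z \<notin> K" using Suc.prems by auto
  then have gz: "g z \<in> U (n + k) - K" using g_image[of "n + k"] g_K by blast
  have "deriv ((g ^^ n) \<circ> g) z = deriv (g ^^ n) (g z) * deriv g z"
    using holomorphic_on_imp_differentiable_at[OF g_hol U_open z(1)]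
      holomorphic_on_imp_differentiable_at[OF iterate_hol U_open, of "g z" n k] gz by (intro deriv_chain) auto
  moreover have "(g ^^ n) \<circ> g = g ^^ Suc n" by (simp add: fun_eq_iff funpow_swap1)
  ultimately have "deriv (g ^^ Suc n) z = deriv (g ^^ n) (g z) * deriv g z" by metis
  then show ?case using Suc.IH[OF gz] critical_in_K[OF z(1)] z(2) by (metis no_zero_divisors)
qed (simp add: id_def)

lemma iterate_image: "(g ^^ n) ` U (n + k) = U k"
proof (induction n)
  case (Suc n)
  have "(g ^^ Suc n) ` U (Suc n + k) = (g ^^ n) ` (g ` U (Suc (n + k)))"
    by (simp add: image_image funpow_swap1)
  then show ?case using Suc g_image by simp
qed simp

lemma iterate_proper: "\<lbrakk>compact C; C \<subseteq> U k\<rbrakk> \<Longrightarrow> compact {x\<in>U (n + k). (g ^^ n) x \<in> C}"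
proof (induction n)
  case 0
  then have "{x \<in> U k. x \<in> C} = C" by blast
  then show ?case using 0 by simp
next
  case (Suc n)
  then have "compact {x\<in>U (Suc (n + k)). g x \<in> {x\<in>U (n + k). (g ^^ n) x \<in> C}}" by (intro g_proper) auto
  also have "{x\<in>U (Suc (n + k)). g x \<in> {x\<in>U (n + k). (g ^^ n) x \<in> C}} = {x\<in>U (Suc n + k). (g ^^ Suc n) x \<in> C}"
    using g_image[of "n + k"] by (auto simp: funpow_swap1)
  finally show ?case .
qed

definition "Om n = U n - K"

lemma Om_open: "open (Om n)" unfolding Om_def using U_open compact_K by (simp add: open_Diff compact_imp_closed)

lemma iterate_covering: "covering_space (Om n) (g ^^ n) (Om 0)"
proof (rule covering_space_proper_holomorphic[OF Om_open Om_open])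
  show "(g ^^ n) holomorphic_on Om n"
    using iterate_hol[of n 0] by (auto simp: Om_def intro: holomorphic_on_subset)
  show "(g ^^ n) ` Om n = Om 0"
  proof (intro equalityI subsetI)
    fix w assume "w \<in> (g ^^ n) ` Om n"
    then show "w \<in> Om 0" using iterate_in[of _ n 0] iterate_K[of _ n 0] by (auto simp: Om_def)
  next
    fix w assume w: "w \<in> Om 0"
    then have "w \<in> (g ^^ n) ` U (n + 0)" using iterate_image[of n 0] by (simp add: Om_def)
    then obtain z where "z \<in> U n" "w = (g ^^ n) z" by auto
    then show "w \<in> (g ^^ n) ` Om n" using w iterate_K[of z n 0] by (auto simp: Om_def)
  qed
  show "deriv (g ^^ n) x \<noteq> 0" if "x \<in> Om n" for x using iterate_deriv[of x n 0] that by (simp add: Om_def)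
  show "compact {x \<in> Om n. (g ^^ n) x \<in> C}" if "compact C" "C \<subseteq> Om 0" for C
  proof -
    have "compact {x\<in>U (n + 0). (g ^^ n) x \<in> C}" by (rule iterate_proper) (use that in \<open>auto simp: Om_def\<close>)
    moreover have "{x\<in>U (n + 0). (g ^^ n) x \<in> C} = {x \<in> Om n. (g ^^ n) x \<in> C}"
      using that(2) iterate_K[of _ n 0] by (auto simp: Om_def)
    ultimately show ?thesis by simp
  qed
qed

text \<open>Janiszewski's theorem: neither the full compact set \<open>K\<close> nor the complement
  of \<open>U 0\<close> separates the plane, and the two sets are disjoint.\<close>

lemma Om_connected: "connected (Om 0)"
proof -
  have "connected (- (K \<union> - U 0))"
  proof (rule Janiszewski_connected[OF compact_K _ _ connected_compl_K])
    have "K \<inter> - U 0 = {}" using K_U[of 0] by auto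
    then show "connected (K \<inter> - U 0)" by (simp only: connected_empty)
  qed (use U_open U_conn in auto)
  moreover have "- (K \<union> - U 0) = Om 0" by (auto simp: Om_def)
  ultimately show ?thesis by simp
qed

text \<open>All preimages of \<open>c\<close> lie in \<open>K\<close>, where the winding number has
  the common value \<open>a\<close>, and their multiplicities add up to d.\<close>

lemma winding_number_g:
  assumes \<sigma>: "path \<sigma>" "pathfinish \<sigma> = pathstart \<sigma>" "path_image \<sigma> \<subseteq> Om (Suc i)"
    and a: "\<And>y. y \<in> K \<Longrightarrow> winding_number \<sigma> y = a" and c: "c \<in> K"
  shows "winding_number (g \<circ> \<sigma>) c = of_nat d * a"
proof -
  have cU: "c \<in> U i" using c K_U by blast
  have fib: "z \<in> K" if "z \<in> {z\<in>U (Suc i). g z = c}" for z using that g_K c by blast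
  have "winding_number (g \<circ> \<sigma>) c = (\<Sum>z\<in>{z\<in>U (Suc i). g z = c}. winding_number \<sigma> z * zorder (\<lambda>x. g x - c) z)"
    by (rule winding_number_holomorphic_compose[OF U_open U_sc g_hol conjunct1[OF g_fibre[OF cU]] \<sigma>(1,2)])
       (rule order_trans[OF \<sigma>(3)], use fib in \<open>auto simp: Om_def\<close>)
  also have "\<dots> = (\<Sum>z\<in>{z\<in>U (Suc i). g z = c}. a * of_int (zorder (\<lambda>x. g x - c) z))"
    using a fib by (intro sum.cong) auto
  also have "\<dots> = a * of_int (\<Sum>z\<in>{z\<in>U (Suc i). g z = c}. zorder (\<lambda>x. g x - c) z)"
    by (simp add: sum_distrib_left)
  also have "\<dots> = of_nat d * a" using g_fibre[OF cU] by simp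
  finally show ?thesis .
qed

text \<open>The winding number of the image loop is again the same about all points of
  \<open>K\<close>, so the factor d is gained once per step. Lifted loops that close up are tested
  against this formula.\<close>

lemma winding_number_iterate:
  assumes "path \<sigma>" "pathfinish \<sigma> = pathstart \<sigma>" "path_image \<sigma> \<subseteq> Om n"
    and "\<And>y. y \<in> K \<Longrightarrow> winding_number \<sigma> y = a" and "c \<in> K"
  shows "winding_number ((g ^^ n) \<circ> \<sigma>) c = of_nat (d ^ n) * a"
  using assms
proof (induction n arbitrary: \<sigma> a)
  case (Suc n)
  have cont: "continuous_on (path_image \<sigma>) g"
    using Suc.prems(3) holomorphic_on_imp_continuous_on[OF g_hol[of n]] by (auto simp: Om_def intro: continuous_on_subset)
  have sub: "path_image (g \<circ> \<sigma>) \<subseteq> Om n"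
    unfolding path_image_compose using Suc.prems(3) g_image[of n] g_K[of _ n] by (fastforce simp: Om_def)
  have "winding_number ((g ^^ n) \<circ> (g \<circ> \<sigma>)) c = of_nat (d ^ n) * (of_nat d * a)"
  proof (rule Suc.IH)
    show "path (g \<circ> \<sigma>)" using Suc.prems(1) cont by (rule path_continuous_image)
    show "pathfinish (g \<circ> \<sigma>) = pathstart (g \<circ> \<sigma>)" using Suc.prems(2) by (simp only: pathfinish_compose pathstart_compose)
  qed (use Suc.prems sub winding_number_g[OF Suc.prems(1-4)] in \<open>simp_all only:\<close>)
  moreover have eq: "(g ^^ Suc n) \<circ> \<sigma> = (g ^^ n) \<circ> (g \<circ> \<sigma>)" by (simp add: fun_eq_iff funpow_swap1)
  ultimately show ?case unfolding eq by (simp only: power_Suc of_nat_mult mult_ac)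
qed (simp add: o_def)

section \<open>Limits of inverse branches\<close>

text \<open>Requiring values in \<open>Om n\<close> makes this a lift through the covering
  \<open>g ^^ n\<close> and builds in the omission of \<open>K\<close>.\<close>

definition lift :: "nat \<Rightarrow> complex set \<Rightarrow> (complex \<Rightarrow> complex) \<Rightarrow> (complex \<Rightarrow> complex) \<Rightarrow> bool" where
  "lift n S E \<Phi> \<longleftrightarrow> \<Phi> holomorphic_on S \<and> \<Phi> ` S \<subseteq> Om n \<and> (\<forall>x\<in>S. (g ^^ n) (\<Phi> x) = E x)"

lemma liftD:
  assumes "lift n S E \<Phi>"
  shows "\<Phi> holomorphic_on S" "continuous_on S \<Phi>" "x \<in> S \<Longrightarrow> \<Phi> x \<in> Om n" "x \<in> S \<Longrightarrow> (g ^^ n) (\<Phi> x) = E x"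
  using assms unfolding lift_def by (auto intro: holomorphic_on_imp_continuous_on)

lemma lift_exists:
  assumes "open S" "simply_connected S" "E holomorphic_on S" "E ` S \<subseteq> Om 0" "s \<in> S" "y \<in> Om n" "(g ^^ n) y = E s"
  obtains \<Phi> where "lift n S E \<Phi>" "\<Phi> s = y"
proof -
  obtain \<Phi> where \<Phi>: "continuous_on S \<Phi>" "\<Phi> \<in> S \<rightarrow> Om n" "\<Phi> s = y" "\<And>x. x \<in> S \<Longrightarrow> (g ^^ n) (\<Phi> x) = E x"
  proof (rule covering_space_lift_strong[OF iterate_covering assms(6,5,2)])
    show "locally path_connected S" by (rule open_imp_locally_path_connected[OF assms(1)])
    show "continuous_on S E" using assms(3) by (rule holomorphic_on_imp_continuous_on)
    show "E \<in> S \<rightarrow> Om 0" using assms(4) by blast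
    show "E s = (g ^^ n) y" using assms(7) by simp
  qed blast
  have "\<Phi> holomorphic_on S"
  proof (rule holomorphic_lift[OF Om_open _ _ assms(1,3) \<Phi>(1)])
    show "(g ^^ n) holomorphic_on Om n"
      using iterate_hol[of n 0] by (auto simp: Om_def intro: holomorphic_on_subset)
    show "deriv (g ^^ n) x \<noteq> 0" if "x \<in> Om n" for x using iterate_deriv[of x n 0] that by (simp add: Om_def)
  qed (use \<Phi> in auto)
  then have "lift n S E \<Phi>" unfolding lift_def using \<Phi>(2,4) by auto
  then show ?thesis using that \<Phi>(3) by blast
qed

lemma lift_unique:
  assumes "lift n S E \<Phi>" "lift n S E \<Psi>" "connected S" "s \<in> S" "\<Phi> s = \<Psi> s" "x \<in> S" "E ` S \<subseteq> Om 0" "continuous_on S E"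
  shows "\<Phi> x = \<Psi> x"
  by (rule covering_space_lift_unique[OF iterate_covering assms(5) assms(8) _ liftD(2)[OF assms(1)] _ _ liftD(2)[OF assms(2)] _ _ assms(3,4,6)])
     (use assms(7) liftD(3,4)[OF assms(1)] liftD(3,4)[OF assms(2)] in auto)

lemma lift_subset: "lift n S E \<Phi> \<Longrightarrow> S' \<subseteq> S \<Longrightarrow> lift n S' E \<Phi>"
  unfolding lift_def by (auto intro: holomorphic_on_subset)

lemma lift_compose:
  assumes "lift n S (\<lambda>x. x) \<phi>" "E holomorphic_on T" "E ` T \<subseteq> S"
  shows "lift n T E (\<lambda>x. \<phi> (E x))"
proof -
  have "(\<phi> \<circ> E) holomorphic_on T"
    by (rule holomorphic_on_compose_gen[OF assms(2) liftD(1)[OF assms(1)] assms(3)])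
  then show ?thesis using assms(1,3) unfolding lift_def o_def by blast
qed

text \<open>Lifts of the identity under \<open>g ^^ n\<close> are inverse branches. A convergent sequence of branches near \<open>w\<close>
  is recorded by their values \<open>y i\<close> at \<open>w\<close>, which determine them.\<close>

definition germ :: "(complex \<Rightarrow> complex) \<Rightarrow> (nat \<Rightarrow> nat) \<Rightarrow> complex \<Rightarrow> (nat \<Rightarrow> complex) \<Rightarrow> bool" where
  "germ A n w y \<longleftrightarrow> (\<exists>r>0. ball w r \<subseteq> Om 0 \<and>
     (\<exists>\<phi>. (\<forall>i. lift (n i) (ball w r) (\<lambda>x. x) (\<phi> i) \<and> \<phi> i w = y i) \<and> (\<forall>v\<in>ball w r. (\<lambda>i. \<phi> i v) \<longlonglongrightarrow> A v)))"

lemma germE: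
  assumes "germ A n w y"
  obtains r \<phi> where "0 < r" "ball w r \<subseteq> Om 0" "\<And>i. lift (n i) (ball w r) (\<lambda>x. x) (\<phi> i)" "\<And>i. \<phi> i w = y i"
     "\<And>v. v \<in> ball w r \<Longrightarrow> (\<lambda>i. \<phi> i v) \<longlonglongrightarrow> A v"
  using assms unfolding germ_def by blast

lemma germ_value:
  assumes "germ A n w y"
  shows "y i \<in> Om (n i)" "(g ^^ n i) (y i) = w" "w \<in> Om 0"
proof -
  obtain r \<phi> where *: "0 < r" "ball w r \<subseteq> Om 0" "\<And>i. lift (n i) (ball w r) (\<lambda>x. x) (\<phi> i)" "\<And>i. \<phi> i w = y i"
    using germE[OF assms] by metis
  show "y i \<in> Om (n i)" "(g ^^ n i) (y i) = w" "w \<in> Om 0"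
    using liftD(3,4)[OF *(3)[of i], of w] *(1,2) *(4)[of i] by auto
qed

text \<open>Near \<open>s\<close> the lift is the branch of the germ composed with \<open>E\<close>,
  by uniqueness of lifts, so it converges to A o E there. As lifts omit two points of
  \<open>K\<close>, Vitali's theorem carries this to all of \<open>S\<close>. \<open>A\<close> is
  entire so that A o E makes sense everywhere; it is the identity or a constant in the
  applications.\<close>

lemma germ_lift:
  assumes S: "open S" "connected S" "E holomorphic_on S" "E ` S \<subseteq> Om 0" "s \<in> S"
    and A: "A holomorphic_on UNIV" and germ: "germ A n (E s) y"
    and \<Phi>: "\<And>i. lift (n i) S E (\<Phi> i)" "\<And>i. \<Phi> i s = y i" and Q: "compact Q" "Q \<subseteq> S"
  shows "uniform_limit Q \<Phi> (\<lambda>x. A (E x)) sequentially"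
proof -
  obtain a b where ab: "a \<in> K" "b \<in> K" "a \<noteq> b" by (rule K_two_points)
  obtain r \<phi> where \<phi>: "0 < r" "ball (E s) r \<subseteq> Om 0" "\<And>i. lift (n i) (ball (E s) r) (\<lambda>x. x) (\<phi> i)" "\<And>i. \<phi> i (E s) = y i"
     "\<And>v. v \<in> ball (E s) r \<Longrightarrow> (\<lambda>i. \<phi> i v) \<longlonglongrightarrow> A v"
    by (rule germE[OF germ]) blast
  have contE: "continuous_on S E" using S(3) by (rule holomorphic_on_imp_continuous_on)
  have "open (S \<inter> E -` ball (E s) r)" using continuous_open_preimage[OF contE S(1)] by simp
  moreover have "s \<in> S \<inter> E -` ball (E s) r" using S(5) \<phi>(1) by simp
  ultimately obtain e where e: "0 < e" "ball s e \<subseteq> S \<inter> E -` ball (E s) r" by (rule openE)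
  have eS: "ball s e \<subseteq> S" and eE: "E ` ball s e \<subseteq> ball (E s) r" using e(2) by auto
  have eq: "\<Phi> i x = \<phi> i (E x)" if "x \<in> ball s e" for i x
  proof (rule lift_unique[OF lift_subset[OF \<Phi>(1) eS] lift_compose[OF \<phi>(3) holomorphic_on_subset[OF S(3) eS] eE] connected_ball _ _ that])
    show "s \<in> ball s e" using e(1) by simp
    show "\<Phi> i s = \<phi> i (E s)" using \<Phi>(2) \<phi>(4) by simp
    show "E ` ball s e \<subseteq> Om 0" using eE \<phi>(2) by blast
    show "continuous_on (ball s e) E" using contE eS by (rule continuous_on_subset)
  qed
  show ?thesis
  proof (rule Vitali_omitting[OF ab(3) S(1,2,5) e(1) eS liftD(1)[OF \<Phi>(1)] _ _ _ Q])
    show "\<Phi> i x \<noteq> a \<and> \<Phi> i x \<noteq> b" if "x \<in> S" for i x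
      using liftD(3)[OF \<Phi>(1)[of i] that] ab(1,2) by (auto simp: Om_def)
    show "(\<lambda>i. \<Phi> i x) \<longlonglongrightarrow> A (E x)" if "x \<in> ball s e" for x
    proof -
      have "E x \<in> ball (E s) r" using eE that by blast
      then show ?thesis using \<phi>(5) eq[OF that] by simp
    qed
    have "(A \<circ> E) holomorphic_on S" by (rule holomorphic_on_compose_gen[OF S(3) A]) simp
    then show "(\<lambda>x. A (E x)) holomorphic_on S" by (simp add: o_def)
  qed
qed

text \<open>The way back: a local inverse of \<open>E\<close> at \<open>s\<close> turns the lifts
  into inverse branches near \<open>E s\<close>.\<close>

lemma germ_of_lift:
  assumes S: "open S" "E holomorphic_on S" "E ` S \<subseteq> Om 0" "s \<in> S" "deriv E s \<noteq> 0"
    and \<Phi>: "\<And>i. lift (n i) S E (\<Phi> i)" and lim: "\<And>x. x \<in> S \<Longrightarrow> (\<lambda>i. \<Phi> i x) \<longlonglongrightarrow> A (E x)"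
  shows "germ A n (E s) (\<lambda>i. \<Phi> i s)"
proof -
  obtain e where e: "0 < e" "ball s e \<subseteq> S" "inj_on E (ball s e)"
    using has_complex_derivative_locally_injective[OF S(2,4,1,5)] by blast
  have holE: "E holomorphic_on ball s e" using S(2) e(2) by (rule holomorphic_on_subset)
  obtain q where q: "q holomorphic_on (E ` ball s e)" "\<And>z. z \<in> ball s e \<Longrightarrow> q (E z) = z"
    using holomorphic_has_inverse[OF holE open_ball e(3)] by metis
  have "open (E ` ball s e)" by (rule open_mapping_thm3[OF holE open_ball e(3)])
  moreover have "E s \<in> E ` ball s e" using e(1) by simp
  ultimately obtain r where r: "0 < r" "ball (E s) r \<subseteq> E ` ball s e" by (rule openE)
  have qs: "q v \<in> ball s e" "E (q v) = v" if "v \<in> ball (E s) r" for v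
    using r(2) that q(2) by auto
  show ?thesis unfolding germ_def
  proof (intro exI[of _ r] conjI exI[of _ "\<lambda>i v. \<Phi> i (q v)"] allI ballI)
    show "ball (E s) r \<subseteq> Om 0" using r(2) e(2) S(3) by blast
    show "lift (n i) (ball (E s) r) (\<lambda>x. x) (\<lambda>v. \<Phi> i (q v))" for i
    proof -
      have "(\<Phi> i \<circ> q) holomorphic_on ball (E s) r"
        by (rule holomorphic_on_compose_gen[OF holomorphic_on_subset[OF q(1) r(2)] liftD(1)[OF \<Phi>(1)]])
           (use qs(1) e(2) in blast)
      then show ?thesis unfolding lift_def o_def
        using liftD(3,4)[OF \<Phi>(1)[of i]] qs e(2) by (auto simp: subset_iff)
    qed
    show "\<Phi> i (q (E s)) = \<Phi> i s" for i using q(2)[of s] e(1) by simp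
    show "(\<lambda>i. \<Phi> i (q v)) \<longlonglongrightarrow> A v" if "v \<in> ball (E s) r" for v
      using lim[of "q v"] qs[OF that] e(2) by auto
  qed (rule r(1))
qed

text \<open>Distinctness is demanded for late indices only, because it is going to follow from the
  convergence of lifts. Branches are determined by their values at \<open>w\<close>, so distinct
  values mean distinct branches.\<close>

definition many_germs :: "(complex \<Rightarrow> complex) \<Rightarrow> (nat \<Rightarrow> nat) \<Rightarrow> nat \<Rightarrow> complex \<Rightarrow> bool" where
  "many_germs A n m w \<longleftrightarrow> (\<exists>y. (\<forall>j<m. germ A n w (y j)) \<and> (\<forall>\<^sub>F i in sequentially. inj_on (\<lambda>j. y j i) {..<m}))"

text \<open>All branches extend over a ball inside \<open>Om 0\<close>, and two of them that agreed
  at w' would agree at \<open>w\<close> by uniqueness of lifts.\<close>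

lemma many_germs_move:
  assumes A: "A holomorphic_on UNIV" and w: "many_germs A n m w" "ball w R \<subseteq> Om 0" "w' \<in> ball w R"
  shows "many_germs A n m w'"
proof -
  have "0 < R" using w(3) by (metis ball_empty empty_iff not_less)
  then have wb: "w \<in> ball w R" by simp
  obtain y where y: "\<And>j. j < m \<Longrightarrow> germ A n w (y j)" "\<forall>\<^sub>F i in sequentially. inj_on (\<lambda>j. y j i) {..<m}"
    using w(1) unfolding many_germs_def by blast
  have "\<exists>\<Phi>. j < m \<longrightarrow> lift (n i) (ball w R) (\<lambda>x. x) \<Phi> \<and> \<Phi> w = y j i" for i j
  proof (cases "j < m")
    case True
    obtain \<Phi> where "lift (n i) (ball w R) (\<lambda>x. x) \<Phi>" "\<Phi> w = y j i"
      by (rule lift_exists[OF open_ball convex_imp_simply_connected[OF convex_ball] holomorphic_on_ident _ wb germ_value(1,2)[OF y(1)[OF True]]])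
         (use w(2) in simp)
    then show ?thesis by blast
  qed simp
  then obtain \<Phi> where \<Phi>: "\<And>i j. j < m \<Longrightarrow> lift (n i) (ball w R) (\<lambda>x. x) (\<Phi> j i) \<and> \<Phi> j i w = y j i" by metis
  have idim: "(\<lambda>x. x) ` ball w R \<subseteq> Om 0" using w(2) by simp
  have "germ A n w' (\<lambda>i. \<Phi> j i w')" if j: "j < m" for j
  proof (rule germ_of_lift[OF open_ball holomorphic_on_ident idim w(3)])
    show "lift (n i) (ball w R) (\<lambda>x. x) (\<Phi> j i)" for i using \<Phi> j by blast
    show "(\<lambda>i. \<Phi> j i x) \<longlonglongrightarrow> A x" if "x \<in> ball w R" for x
    proof -
      have "uniform_limit {x} (\<Phi> j) (\<lambda>x. A x) sequentially"
        by (rule germ_lift[OF open_ball connected_ball holomorphic_on_ident idim wb A y(1)[OF j]])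
           (use \<Phi> j that in auto)
      then show ?thesis by (rule tendsto_uniform_limitI) simp
    qed
  qed simp
  moreover have "\<forall>\<^sub>F i in sequentially. inj_on (\<lambda>j. \<Phi> j i w') {..<m}"
    using y(2)
  proof eventually_elim
    case (elim i)
    show ?case
    proof (rule inj_onI)
      fix j j' assume j: "j \<in> {..<m}" "j' \<in> {..<m}" "\<Phi> j i w' = \<Phi> j' i w'"
      have "\<Phi> j i w = \<Phi> j' i w"
        by (rule lift_unique[of "n i" "ball w R" "\<lambda>x. x" _ _ w'])
           (use j \<Phi> w(3) wb idim in \<open>auto intro: continuous_on_id\<close>)
      then show "j = j'" using elim \<Phi> j by (auto dest: inj_onD)
    qed
  qed
  ultimately show ?thesis unfolding many_germs_def by (intro exI[of _ "\<lambda>j i. \<Phi> j i w'"] conjI allI impI)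
qed

text \<open>The balls over which branches move are limited by \<open>Om 0\<close> alone, so the good
  points form an open and relatively closed subset of the connected set \<open>Om 0\<close>.\<close>

lemma many_germs_spread:
  assumes A: "A holomorphic_on UNIV" and w: "many_germs A n m w" "w \<in> Om 0" and v: "v \<in> Om 0"
  shows "many_germs A n m v"
proof -
  define V where "V = {u \<in> Om 0. many_germs A n m u}"
  have Vsub: "V \<subseteq> Om 0" and VD: "\<And>u. u \<in> V \<Longrightarrow> many_germs A n m u" unfolding V_def by simp_all
  have VI: "ball u R \<subseteq> V" if "u \<in> V" "ball u R \<subseteq> Om 0" for u R
    unfolding V_def using many_germs_move[OF A VD[OF that(1)] that(2)] that(2) by blast
  have opV: "openin (top_of_set (Om 0)) V"
  proof -
    have "open V"
    proof (subst open_contains_ball, intro ballI)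
      fix u assume u: "u \<in> V"
      obtain R where R: "R > 0" "ball u R \<subseteq> Om 0" by (rule openE[OF Om_open subsetD[OF Vsub u]])
      then show "\<exists>e>0. ball u e \<subseteq> V" using VI[OF u R(2)] by blast
    qed
    then show ?thesis using Vsub openin_open_eq[OF Om_open] by simp
  qed
  have clV: "closedin (top_of_set (Om 0)) V"
  proof (subst closedin_limpt, intro conjI allI impI)
    show "V \<subseteq> Om 0" by (rule Vsub)
    fix x assume x: "x islimpt V \<and> x \<in> Om 0"
    obtain R where R: "R > 0" "ball x R \<subseteq> Om 0" by (rule openE[OF Om_open conjunct2[OF x]])
    obtain u where u: "u \<in> V" "u \<in> ball x (R/2)"
      by (rule islimptE[OF conjunct1[OF x], of "ball x (R/2)"]) (use R(1) in auto)
    have "ball u (R/2) \<subseteq> ball x R"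
    proof
      fix y assume "y \<in> ball u (R/2)"
      then show "y \<in> ball x R" using u(2) dist_triangle[of x y u] by simp
    qed
    then have "ball u (R/2) \<subseteq> V" using VI[OF u(1)] R(2) by (meson order_trans)
    moreover have "x \<in> ball u (R/2)" using u(2) by (simp add: dist_commute)
    ultimately show "x \<in> V" by (rule subsetD)
  qed
  have "V = {} \<or> V = Om 0"
    using Om_connected opV clV unfolding connected_clopen by blast
  moreover have "w \<in> V" using w by (simp add: V_def)
  ultimately have "v \<in> V" using v by blast
  then show ?thesis by (rule VD)
qed

text \<open>The strip is the universal covering of an annulus around \<open>K\<close> in \<open>U 0\<close>.\<close>

lemma annulus_covering:
  obtains E :: "complex \<Rightarrow> complex" and S \<zeta>0 c0
  where "open S" "convex S" "E holomorphic_on S" "E ` S \<subseteq> Om 0" "\<And>s. s \<in> S \<Longrightarrow> deriv E s \<noteq> 0"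
    "\<And>s (t::real). s \<in> S \<Longrightarrow> s + of_real t * \<i> \<in> S" "\<zeta>0 \<in> S" "\<And>s (k::int). s \<in> S \<Longrightarrow> E (s + of_int k * (2 * of_real pi * \<i>)) = E s" "c0 \<in> K"
    "\<And>c. c \<in> K \<Longrightarrow> winding_number (\<lambda>t. E (\<zeta>0 + of_real t * (2 * of_real pi * \<i>))) c = 1"
    "\<And>j k. winding_number (\<lambda>t. E (\<zeta>0 + of_real (real j + t * real k) * (2 * of_real pi * \<i>))) c0 = of_nat k"
proof -
  obtain c0 where c0: "c0 \<in> K" using K_nonempty by blast
  have c0U: "c0 \<in> U 0" using c0 K_U by blast
  obtain \<phi> \<psi> where \<phi>: "\<phi> holomorphic_on U 0" "\<psi> holomorphic_on ball 0 1"
    "\<And>z. z \<in> U 0 \<Longrightarrow> \<phi> z \<in> ball 0 1 \<and> \<psi> (\<phi> z) = z"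
    "\<And>\<zeta>. \<zeta> \<in> ball 0 1 \<Longrightarrow> \<psi> \<zeta> \<in> U 0 \<and> \<phi> (\<psi> \<zeta>) = \<zeta>" "\<phi> c0 = 0"
    using Riemann_map_at[OF U_open U_sc U_UNIV c0U] by metis
  have d\<psi>: "deriv \<psi> \<zeta> \<noteq> 0" if "\<zeta> \<in> ball 0 1" for \<zeta>
    by (rule deriv_inverse_nonzero[OF open_ball \<phi>(2,1) U_open _ _ that]) (use \<phi>(4) in blast)+
  \<comment> \<open>The annulus s < |\<phi>| < 1 misses \<open>K\<close>. The maximum with 1/2 keeps
    \<open>s\<close> positive, so that the strip can start at ln s.\<close>
  obtain s where s: "0 < s" "s < 1" "\<And>c. c \<in> K \<Longrightarrow> norm (\<phi> c) \<le> s"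
  proof -
    have "compact (\<phi> ` K)"
      by (intro compact_continuous_image continuous_on_subset[OF holomorphic_on_imp_continuous_on[OF \<phi>(1)] K_U] compact_K)
    moreover have "\<phi> ` K \<noteq> {}" using c0 by blast
    ultimately obtain x where x: "x \<in> \<phi> ` K" "\<forall>y\<in>\<phi> ` K. norm y \<le> norm x"
      using continuous_attains_sup[of "\<phi> ` K" norm] continuous_on_norm_id by blast
    have "norm x < 1" using x(1) \<phi>(3) K_U[of 0] by (auto simp: subset_iff)
    show ?thesis
      by (rule that[of "max (norm x) (1/2)"]) (use x \<open>norm x < 1\<close> in \<open>auto simp: max.coboundedI1\<close>)
  qed
  define S where "S = {\<zeta>. ln s < Re \<zeta> \<and> Re \<zeta> < 0}"
  define E where "E = (\<lambda>\<zeta>. \<psi> (exp \<zeta>))"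
  \<comment> \<open>A radius strictly between s and 1; its circle is the loop around
    \<open>K\<close>, and \<open>\<zeta>0\<close> is a logarithm of its point on the positive real
    axis.\<close>
  define \<rho> where "\<rho> = sqrt s"
  define \<zeta>0 where "\<zeta>0 = complex_of_real (ln \<rho>)"
  have \<rho>: "s < \<rho>" "\<rho> < 1" "0 < \<rho>"
  proof -
    show "0 < \<rho>" "\<rho> < 1" using s by (auto simp: \<rho>_def)
    have "s = \<rho> * \<rho>" using s by (simp add: \<rho>_def)
    then show "s < \<rho>" using mult_strict_left_mono[of \<rho> 1 \<rho>] \<open>0 < \<rho>\<close> \<open>\<rho> < 1\<close> by simp
  qed
  have \<zeta>0: "\<zeta>0 \<in> S" using \<rho> s by (auto simp: S_def \<zeta>0_def)
  have e\<zeta>0: "exp \<zeta>0 = of_real \<rho>" using \<rho> by (simp add: \<zeta>0_def exp_of_real)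
  have Sexp: "s < norm (exp \<zeta>)" "norm (exp \<zeta>) < 1" if "\<zeta> \<in> S" for \<zeta>
  proof -
    have "exp (ln s) < exp (Re \<zeta>)" "exp (Re \<zeta>) < exp 0"
      using that by (simp_all only: S_def mem_Collect_eq exp_less_cancel_iff)
    then show "s < norm (exp \<zeta>)" "norm (exp \<zeta>) < 1" using s by (simp_all add: norm_exp_eq_Re)
  qed
  have S: "open S" "convex S"
  proof -
    have "S = {\<zeta>. ln s < Re \<zeta>} \<inter> {\<zeta>. Re \<zeta> < 0}" by (auto simp: S_def)
    then show "open S" "convex S"
      by (simp_all add: open_Int open_halfspace_Re_gt open_halfspace_Re_lt convex_Int convex_halfspace_Re_gt convex_halfspace_Re_lt)
  qed
  have "(\<psi> \<circ> exp) holomorphic_on S"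
    by (rule holomorphic_on_compose_gen[OF holomorphic_on_exp \<phi>(2)]) (use Sexp in auto)
  then have E: "E holomorphic_on S" by (simp add: E_def o_def)
  have EOm: "E ` S \<subseteq> Om 0"
  proof
    fix w assume "w \<in> E ` S"
    then obtain \<zeta> where \<zeta>: "\<zeta> \<in> S" "w = \<psi> (exp \<zeta>)" by (auto simp: E_def)
    then have "w \<in> U 0" "\<phi> w = exp \<zeta>" using \<phi>(4)[of "exp \<zeta>"] Sexp[OF \<zeta>(1)] by auto
    moreover from this have "w \<notin> K" using s(3)[of w] Sexp[OF \<zeta>(1)] by auto
    ultimately show "w \<in> Om 0" by (simp add: Om_def)
  qed
  have dE: "deriv E \<zeta> \<noteq> 0" if "\<zeta> \<in> S" for \<zeta>
  proof -
    have eb: "exp \<zeta> \<in> ball 0 1" using Sexp[OF that] by simp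
    have "(E has_field_derivative deriv \<psi> (exp \<zeta>) * exp \<zeta>) (at \<zeta>)"
      unfolding E_def by (rule DERIV_chain2[OF holomorphic_derivI[OF \<phi>(2) open_ball eb] DERIV_exp])
    then have "deriv E \<zeta> = deriv \<psi> (exp \<zeta>) * exp \<zeta>" by (rule DERIV_imp_deriv)
    then show ?thesis using d\<psi>[OF eb] by simp
  qed
  have per: "exp (\<zeta> + of_int k * (2 * of_real pi * \<i>)) = exp \<zeta>" for \<zeta> and k :: int
    by (simp add: exp_add exp_eq_1)
  have wcomp: "winding_number (\<psi> \<circ> \<sigma>) c = winding_number \<sigma> (\<phi> c)"
    if c: "c \<in> K" and \<sigma>: "path \<sigma>" "pathfinish \<sigma> = pathstart \<sigma>" "path_image \<sigma> \<subseteq> sphere 0 \<rho>" for \<sigma> c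
  proof -
    have cU: "c \<in> U 0" using c K_U by blast
    have eq: "{z\<in>ball 0 1. \<psi> z = c} = {\<phi> c}"
    proof (intro equalityI subsetI)
      fix z assume "z \<in> {z\<in>ball 0 1. \<psi> z = c}"
      then show "z \<in> {\<phi> c}" using \<phi>(4)[of z] by auto
    qed (use \<phi>(3)[OF cU] in auto)
    have fin1: "finite {z\<in>ball 0 1. \<psi> z = c}" unfolding eq by simp
    have pim1: "path_image \<sigma> \<subseteq> ball 0 1 - {z\<in>ball 0 1. \<psi> z = c}"
      unfolding eq using \<sigma>(3) s(3)[OF c] \<rho> by (force simp: subset_iff)
    have "winding_number (\<psi> \<circ> \<sigma>) c = (\<Sum>z\<in>{z\<in>ball 0 1. \<psi> z = c}. winding_number \<sigma> z * zorder (\<lambda>x. \<psi> x - c) z)"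
      by (rule winding_number_holomorphic_compose[OF open_ball convex_imp_simply_connected[OF convex_ball] \<phi>(2) fin1 \<sigma>(1,2) pim1])
    also have "\<dots> = winding_number \<sigma> (\<phi> c) * zorder (\<lambda>x. \<psi> x - c) (\<phi> c)" unfolding eq by simp
    also have "zorder (\<lambda>x. \<psi> x - c) (\<phi> c) = 1"
      using zorder_simple_zero[OF open_ball \<phi>(2) _ d\<psi>, of "\<phi> c"] \<phi>(3)[OF cU] by simp
    finally show ?thesis by (simp add: o_def)
  qed
  show ?thesis
  proof (rule that[OF S E EOm dE _ \<zeta>0 _ c0])
    show "s' + of_real t * \<i> \<in> S" if "s' \<in> S" for s' and t :: real using that by (simp add: S_def)
    show "E (s' + of_int k * (2 * of_real pi * \<i>)) = E s'" if "s' \<in> S" for s' and k :: int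
      by (simp add: E_def per)
    fix c assume c: "c \<in> K"
    have eq: "(\<lambda>t. E (\<zeta>0 + of_real t * (2 * of_real pi * \<i>))) = \<psi> \<circ> circlepath 0 \<rho>"
      by (simp add: fun_eq_iff E_def exp_add e\<zeta>0 circlepath mult_ac)
    show "winding_number (\<lambda>t. E (\<zeta>0 + of_real t * (2 * of_real pi * \<i>))) c = 1"
    proof -
      have "winding_number (\<psi> \<circ> circlepath 0 \<rho>) c = winding_number (circlepath 0 \<rho>) (\<phi> c)"
        by (rule wcomp[OF c]) (use \<rho> in simp_all)
      also have "\<dots> = 1" by (rule winding_number_circlepath) (use s(3)[OF c] \<rho> in simp)
      finally show ?thesis unfolding eq .
    qed
  next
    fix j k :: nat
    \<comment> \<open>A vertical segment of length 2 pi k starting j turns above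
      \<open>\<zeta>0\<close>; \<open>exp\<close> wraps it k times around the circle.\<close>
    define p where "p = linepath (\<zeta>0 + of_nat j * (2 * of_real pi * \<i>)) (\<zeta>0 + of_nat (j + k) * (2 * of_real pi * \<i>))"
    have pt: "p t = \<zeta>0 + of_real (real j + t * real k) * (2 * of_real pi * \<i>)" for t
      by (simp add: p_def linepath_def scaleR_conv_of_real algebra_simps)
    have eq: "(\<lambda>t. E (\<zeta>0 + of_real (real j + t * real k) * (2 * of_real pi * \<i>))) = \<psi> \<circ> (exp \<circ> p)"
      by (simp add: fun_eq_iff E_def pt)
    have pp: "path (exp \<circ> p)" unfolding p_def by (intro path_continuous_image) (auto intro: continuous_intros)
    have loop: "pathfinish (exp \<circ> p) = pathstart (exp \<circ> p)"
      using per[of \<zeta>0 "int (j + k)"] per[of \<zeta>0 "int j"] by (simp add: pathfinish_compose pathstart_compose p_def)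
    have im: "path_image (exp \<circ> p) \<subseteq> sphere 0 \<rho>"
      using \<rho> by (auto simp: path_image_def pt exp_add e\<zeta>0 norm_mult norm_exp_eq_Re)
    have "winding_number (\<psi> \<circ> (exp \<circ> p)) c0 = winding_number (exp \<circ> p) 0"
      using wcomp[OF c0 pp loop im] \<phi>(5) by simp
    also have "\<dots> = (pathfinish p - pathstart p) / (2 * of_real pi * \<i>)"
      by (rule winding_number_compose_exp) (simp add: p_def)
    also have "\<dots> = of_nat k" by (simp add: p_def field_simps)
    finally show "winding_number (\<lambda>t. E (\<zeta>0 + of_real (real j + t * real k) * (2 * of_real pi * \<i>))) c0 = of_nat k"
      unfolding eq .
  qed
qed

lemma uniform_limit_near:
  assumes "uniform_limit Q \<Phi> F sequentially" "0 < e"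
  shows "\<forall>\<^sub>F i in sequentially. \<forall>x\<in>Q. dist (\<Phi> i x) (F x) < e"
  using assms by (auto simp: uniform_limit_iff)

text \<open>The lifts of a loop around \<open>K\<close> converge to the loop itself. The point to
  prove is that a late lift closes up exactly and not only approximately; it then has winding number
  1, as does its image under \<open>g ^^ n i\<close>, and \<open>winding_number_iterate\<close>
  gives 1 = d ^ n i.\<close>

lemma no_identity_germ:
  assumes germ: "germ (\<lambda>z. z) n w y" and n: "\<And>i. 1 \<le> n i"
  shows False
proof -
  have A: "(\<lambda>z::complex. z) holomorphic_on UNIV" by (rule holomorphic_on_ident)
  obtain E S \<zeta>0 c0 where S: "open S" "convex S" "E holomorphic_on S" "E ` S \<subseteq> Om 0" "\<And>s. s \<in> S \<Longrightarrow> deriv E s \<noteq> 0"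
    and trans: "\<And>s (t::real). s \<in> S \<Longrightarrow> s + of_real t * \<i> \<in> S" and \<zeta>0: "\<zeta>0 \<in> S"
    and per: "\<And>s (k::int). s \<in> S \<Longrightarrow> E (s + of_int k * (2 * of_real pi * \<i>)) = E s" and c0: "c0 \<in> K"
    and wind: "\<And>c. c \<in> K \<Longrightarrow> winding_number (\<lambda>t. E (\<zeta>0 + of_real t * (2 * of_real pi * \<i>))) c = 1"
    and "\<And>j k. winding_number (\<lambda>t. E (\<zeta>0 + of_real (real j + t * real k) * (2 * of_real pi * \<i>))) c0 = of_nat k"
    by (rule annulus_covering) (rule that; assumption)
  have E0: "E \<zeta>0 \<in> Om 0" using S(4) \<zeta>0 by blast
  have "many_germs (\<lambda>z. z) n 1 w" unfolding many_germs_def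
    by (intro exI[of _ "\<lambda>j. y"]) (use germ in \<open>auto simp: inj_on_def\<close>)
  then have "many_germs (\<lambda>z. z) n 1 (E \<zeta>0)" by (rule many_germs_spread[OF A _ germ_value(3)[OF germ] E0])
  then obtain y0 where y0: "germ (\<lambda>z. z) n (E \<zeta>0) y0" unfolding many_germs_def by auto
  have sc: "simply_connected S" "connected S" using S(2) by (auto intro: convex_imp_simply_connected convex_connected)
  have "\<exists>\<Phi>. lift (n i) S E \<Phi> \<and> \<Phi> \<zeta>0 = y0 i" for i
    using lift_exists[OF S(1) sc(1) S(3,4) \<zeta>0 germ_value(1)[OF y0] germ_value(2)[OF y0]] by metis
  then obtain \<Phi> where \<Phi>: "\<And>i. lift (n i) S E (\<Phi> i)" "\<And>i. \<Phi> i \<zeta>0 = y0 i" by metis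
  have lim: "uniform_limit Q \<Phi> E sequentially" if "compact Q" "Q \<subseteq> S" for Q
    using germ_lift[OF S(1) sc(2) S(3,4) \<zeta>0 A y0 \<Phi> that] by simp
  define \<zeta> where "\<zeta> = (\<lambda>t::real. \<zeta>0 + of_real t * (2 * of_real pi * \<i>))"
  have \<zeta>S: "\<zeta> t \<in> S" for t using trans[OF \<zeta>0, of "t * (2 * pi)"] by (simp add: \<zeta>_def mult_ac)
  have \<zeta>c: "continuous_on {0..1} \<zeta>" unfolding \<zeta>_def by (intro continuous_intros)
  have E1: "E (\<zeta> 1) = E \<zeta>0" using per[OF \<zeta>0, of 1] by (simp add: \<zeta>_def)
  obtain e where e: "0 < e" "ball \<zeta>0 e \<subseteq> S" "inj_on E (ball \<zeta>0 e)"
    using has_complex_derivative_locally_injective[OF S(3) \<zeta>0 S(1) S(5)[OF \<zeta>0]] by blast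
  define \<epsilon> where "\<epsilon> = e / 2"
  have \<epsilon>: "0 < \<epsilon>" "cball \<zeta>0 \<epsilon> \<subseteq> ball \<zeta>0 e" using e(1) by (auto simp: \<epsilon>_def)
  have "cball \<zeta>0 \<epsilon> \<subseteq> S" using \<epsilon>(2) e(2) by (rule order_trans)
  then have bS: "cball \<zeta>0 \<epsilon> \<subseteq> S" "ball \<zeta>0 \<epsilon> \<subseteq> S" using order_trans[OF ball_subset_cball] by blast+
  have contE: "continuous_on S E" using S(3) by (rule holomorphic_on_imp_continuous_on)
  have sphS: "sphere \<zeta>0 \<epsilon> \<subseteq> S" using \<epsilon>(2) e(2) by auto
  have "\<exists>x\<in>sphere \<zeta>0 \<epsilon>. \<forall>y\<in>sphere \<zeta>0 \<epsilon>. dist (E x) (E \<zeta>0) \<le> dist (E y) (E \<zeta>0)"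
    by (rule continuous_attains_inf) (use \<epsilon>(1) in \<open>auto intro!: continuous_intros continuous_on_subset[OF contE sphS]\<close>)
  then obtain x0 where x0: "x0 \<in> sphere \<zeta>0 \<epsilon>" "\<And>y. y \<in> sphere \<zeta>0 \<epsilon> \<Longrightarrow> dist (E x0) (E \<zeta>0) \<le> dist (E y) (E \<zeta>0)" by blast
  \<comment> \<open>A quarter of the least distance from E \<zeta>0 to the image of the small
    circle: with all errors below \<open>\<mu>\<close>, the lift is at distance more than 2 \<mu>
    from its end value \<open>q\<close> on the circle, and less than that at the centre.\<close>
  define \<mu> where "\<mu> = dist (E x0) (E \<zeta>0) / 4"
  have "E x0 \<noteq> E \<zeta>0"
  proof
    assume eq: "E x0 = E \<zeta>0"
    have "x0 \<in> ball \<zeta>0 e" using x0(1) \<epsilon>(2) by auto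
    then have "x0 = \<zeta>0" using inj_onD[OF e(3) eq] e(1) by simp
    then show False using x0(1) \<epsilon>(1) by simp
  qed
  then have \<mu>: "0 < \<mu>" by (simp add: \<mu>_def)
  define Q where "Q = cball \<zeta>0 \<epsilon> \<union> \<zeta> ` {0..1}"
  have Q: "compact Q" "Q \<subseteq> S"
    using \<zeta>c \<zeta>S \<epsilon>(2) e(2) by (auto simp: Q_def intro!: compact_Un compact_continuous_image)
  have ev1: "\<forall>\<^sub>F i in sequentially. \<forall>x\<in>Q. dist (\<Phi> i x) (E x) < \<mu>" by (rule uniform_limit_near[OF lim[OF Q] \<mu>])
  define \<gamma> where "\<gamma> = (\<lambda>t. E (\<zeta> t))"
  have pg: "path \<gamma>" unfolding path_def \<gamma>_def
    by (rule continuous_on_compose2[OF contE \<zeta>c]) (use \<zeta>S in auto)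
  have gOm: "\<gamma> t \<in> Om 0" for t using S(4) \<zeta>S by (auto simp: \<gamma>_def)
  \<comment> \<open>A closed lift within \<open>\<delta>\<close> of the loop has the same winding
    numbers about \<open>K\<close>.\<close>
  obtain \<delta> where \<delta>: "0 < \<delta>" "\<And>t c. \<lbrakk>t \<in> {0..1}; c \<in> K\<rbrakk> \<Longrightarrow> \<delta> \<le> dist (\<gamma> t) c"
  proof -
    have "compact (\<gamma> ` {0..1})" using pg by (auto simp: path_def intro: compact_continuous_image)
    moreover have "\<gamma> ` {0..1} \<inter> K = {}" using gOm by (auto simp: Om_def)
    ultimately obtain \<delta> where "0 < \<delta>" "\<forall>x\<in>\<gamma> ` {0..1}. \<forall>y\<in>K. \<delta> \<le> dist x y"
      using separate_compact_closed[of "\<gamma> ` {0..1}" K] compact_imp_closed[OF compact_K] by auto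
    then show ?thesis using that by blast
  qed
  have ev2: "\<forall>\<^sub>F i in sequentially. \<forall>x\<in>Q. dist (\<Phi> i x) (E x) < \<delta>" by (rule uniform_limit_near[OF lim[OF Q] \<delta>(1)])
  obtain i where i1: "\<And>x. x \<in> Q \<Longrightarrow> dist (\<Phi> i x) (E x) < \<mu>" and i2: "\<And>x. x \<in> Q \<Longrightarrow> dist (\<Phi> i x) (E x) < \<delta>"
    using eventually_happens[OF eventually_conj[OF ev1 ev2]] by auto
  define q where "q = \<Phi> i (\<zeta> 1)"
  have \<zeta>Q: "\<zeta>0 \<in> Q" "\<zeta> t \<in> Q" if "t \<in> {0..1}" for t using that \<epsilon>(1) by (auto simp: Q_def)
  have "dist q (E \<zeta>0) < \<mu>" using i1[OF \<zeta>Q(2)[of 1]] E1 by (simp add: q_def)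
  \<comment> \<open>By the minimum principle the lift takes its end value \<open>q\<close> at some
    \<open>x\<close> near \<open>\<zeta>0\<close>. Applying \<open>g ^^ n i\<close> gives E x = E
    \<zeta>0, and injectivity of \<open>E\<close> near \<open>\<zeta>0\<close> forces x =
    \<zeta>0.\<close>
  have "\<Phi> i \<zeta>0 = q"
  proof -
    have holi: "\<Phi> i holomorphic_on S" by (rule liftD(1)[OF \<Phi>(1)])
    obtain x where x: "x \<in> ball \<zeta>0 \<epsilon>" "\<Phi> i x - q = 0"
    proof (rule holomorphic_contract_to_zero[of \<zeta>0 \<epsilon> "\<lambda>x. \<Phi> i x - q"])
      show "continuous_on (cball \<zeta>0 \<epsilon>) (\<lambda>x. \<Phi> i x - q)"
        by (intro continuous_intros continuous_on_subset[OF holomorphic_on_imp_continuous_on[OF holi] bS(1)])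
      show "(\<lambda>x. \<Phi> i x - q) holomorphic_on ball \<zeta>0 \<epsilon>"
        by (intro holomorphic_intros holomorphic_on_subset[OF holi bS(2)])
      fix x assume "norm (\<zeta>0 - x) = \<epsilon>"
      then have x: "x \<in> sphere \<zeta>0 \<epsilon>" "x \<in> Q" by (auto simp: dist_norm Q_def)
      have "4 * \<mu> \<le> dist (E x) (E \<zeta>0)" using x0(2)[OF x(1)] by (simp add: \<mu>_def)
      moreover have "dist (\<Phi> i x) (E x) < \<mu>" "dist (\<Phi> i \<zeta>0) (E \<zeta>0) < \<mu>" using i1 x(2) \<zeta>Q(1)[of 0] by auto
      moreover have "dist (E x) (E \<zeta>0) \<le> dist (\<Phi> i x) (E x) + dist (\<Phi> i x) q + dist q (E \<zeta>0)"
        by metric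
      moreover have "dist (\<Phi> i \<zeta>0) q \<le> dist (\<Phi> i \<zeta>0) (E \<zeta>0) + dist q (E \<zeta>0)" by metric
      ultimately have "dist (\<Phi> i \<zeta>0) q < dist (\<Phi> i x) q" using \<open>dist q (E \<zeta>0) < \<mu>\<close> by linarith
      then show "norm (\<Phi> i \<zeta>0 - q) < norm (\<Phi> i x - q)" by (simp add: dist_norm)
    qed (rule \<epsilon>(1))
    have xS: "x \<in> S" using x(1) bS(2) by blast
    have "E x = (g ^^ n i) (\<Phi> i x)" using liftD(4)[OF \<Phi>(1) xS] by simp
    also have "\<dots> = E (\<zeta> 1)" using x(2) liftD(4)[OF \<Phi>(1) \<zeta>S] by (simp add: q_def)
    finally have eq: "E x = E \<zeta>0" using E1 by simp
    have "x \<in> ball \<zeta>0 e" using subsetD[OF \<epsilon>(2)] x(1) by simp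
    then have "x = \<zeta>0" using inj_onD[OF e(3) eq] e(1) by simp
    then show ?thesis using x(2) by simp
  qed
  define \<sigma> where "\<sigma> = (\<lambda>t. \<Phi> i (\<zeta> t))"
  have ps: "path \<sigma>" unfolding path_def \<sigma>_def
    by (rule continuous_on_compose2[OF liftD(2)[OF \<Phi>(1)] \<zeta>c]) (use \<zeta>S in auto)
  have \<zeta>00: "\<zeta> 0 = \<zeta>0" by (simp add: \<zeta>_def)
  have loops: "pathfinish \<sigma> = pathstart \<sigma>" "pathfinish \<gamma> = pathstart \<gamma>"
    using \<open>\<Phi> i \<zeta>0 = q\<close> E1 by (auto simp: pathfinish_def pathstart_def \<sigma>_def \<gamma>_def \<zeta>00 q_def)
  have w1: "winding_number \<sigma> c = 1" if c: "c \<in> K" for c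
  proof -
    have "winding_number \<sigma> c = winding_number \<gamma> c"
    proof (rule winding_number_nearby_loops_eq[OF pg ps loops(2,1)])
      fix t :: real assume t: "t \<in> {0..1}"
      have "dist (\<sigma> t) (\<gamma> t) < \<delta>" using i2[OF \<zeta>Q(2)[OF t]] by (simp add: \<sigma>_def \<gamma>_def)
      then show "norm (\<sigma> t - \<gamma> t) < norm (\<gamma> t - c)" using \<delta>(2)[OF t c] by (simp add: dist_norm)
    qed
    then show ?thesis using wind[OF c] by (simp add: \<gamma>_def \<zeta>_def)
  qed
  have "winding_number ((g ^^ n i) \<circ> \<sigma>) c0 = of_nat (d ^ n i) * 1"
    by (rule winding_number_iterate[OF ps loops(1) _ w1 c0])
       (use liftD(3)[OF \<Phi>(1) \<zeta>S] in \<open>auto simp: path_image_def \<sigma>_def\<close>)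
  moreover have "(g ^^ n i) \<circ> \<sigma> = \<gamma>" using liftD(4)[OF \<Phi>(1) \<zeta>S] by (auto simp: \<sigma>_def \<gamma>_def fun_eq_iff)
  moreover have "winding_number \<gamma> c0 = 1" using wind[OF c0] by (simp add: \<gamma>_def \<zeta>_def)
  ultimately have "(1::complex) = of_nat (d ^ n i)" by simp
  then have "d ^ n i = 1" by (metis of_nat_1_eq_iff)
  then show False using n[of i] d2 by auto
qed

text \<open>The lift over the strip visits the fibre of E \<zeta>0 once per turn. If two visits
  coincided, the part between them would be a loop in a disc around \<open>z\<close> that misses
  \<open>K\<close>, hence of winding number 0 about \<open>K\<close>, while its image winds a
  positive number of times.\<close>

lemma constant_germ_many:
  assumes germ: "germ (\<lambda>_. z) n w y" and z: "z \<notin> K" and p: "p \<in> Om 0"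
  shows "many_germs (\<lambda>_. z) n m p"
proof -
  have A: "(\<lambda>_. z) holomorphic_on UNIV" by (rule holomorphic_on_const)
  obtain E S \<zeta>0 c0 where S: "open S" "convex S" "E holomorphic_on S" "E ` S \<subseteq> Om 0" "\<And>s. s \<in> S \<Longrightarrow> deriv E s \<noteq> 0"
    and trans: "\<And>s (t::real). s \<in> S \<Longrightarrow> s + of_real t * \<i> \<in> S" and \<zeta>0: "\<zeta>0 \<in> S"
    and per: "\<And>s (k::int). s \<in> S \<Longrightarrow> E (s + of_int k * (2 * of_real pi * \<i>)) = E s" and c0: "c0 \<in> K"
    and "\<And>c. c \<in> K \<Longrightarrow> winding_number (\<lambda>t. E (\<zeta>0 + of_real t * (2 * of_real pi * \<i>))) c = 1"
    and wind: "\<And>j k. winding_number (\<lambda>t. E (\<zeta>0 + of_real (real j + t * real k) * (2 * of_real pi * \<i>))) c0 = of_nat k"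
    by (rule annulus_covering) (rule that; assumption)
  have E0: "E \<zeta>0 \<in> Om 0" using S(4) \<zeta>0 by blast
  have "many_germs (\<lambda>_. z) n 1 w" unfolding many_germs_def
    by (intro exI[of _ "\<lambda>j. y"]) (use germ in \<open>auto simp: inj_on_def\<close>)
  then have "many_germs (\<lambda>_. z) n 1 (E \<zeta>0)" by (rule many_germs_spread[OF A _ germ_value(3)[OF germ] E0])
  then obtain y0 where y0: "germ (\<lambda>_. z) n (E \<zeta>0) y0" unfolding many_germs_def by auto
  have sc: "simply_connected S" "connected S" using S(2) by (auto intro: convex_imp_simply_connected convex_connected)
  have "\<exists>\<Phi>. lift (n i) S E \<Phi> \<and> \<Phi> \<zeta>0 = y0 i" for i
    using lift_exists[OF S(1) sc(1) S(3,4) \<zeta>0 germ_value(1)[OF y0] germ_value(2)[OF y0]] by metis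
  then obtain \<Phi> where \<Phi>: "\<And>i. lift (n i) S E (\<Phi> i)" "\<And>i. \<Phi> i \<zeta>0 = y0 i" by metis
  have lim: "uniform_limit Q \<Phi> (\<lambda>_. z) sequentially" if "compact Q" "Q \<subseteq> S" for Q
    using germ_lift[OF S(1) sc(2) S(3,4) \<zeta>0 A y0 \<Phi> that] by simp
  define \<zeta> where "\<zeta> = (\<lambda>t::real. \<zeta>0 + of_real t * (2 * of_real pi * \<i>))"
  have \<zeta>S: "\<zeta> t \<in> S" for t using trans[OF \<zeta>0, of "t * (2 * pi)"] by (simp add: \<zeta>_def mult_ac)
  have \<zeta>c: "continuous_on T \<zeta>" for T unfolding \<zeta>_def by (intro continuous_intros)
  have Ej: "E (\<zeta> (real j)) = E \<zeta>0" for j using per[OF \<zeta>0, of "int j"] by (simp add: \<zeta>_def)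
  have "germ (\<lambda>_. z) n (E (\<zeta> (real j))) (\<lambda>i. \<Phi> i (\<zeta> (real j)))" for j
  proof (rule germ_of_lift[OF S(1,3,4) \<zeta>S S(5)[OF \<zeta>S] \<Phi>(1)])
    fix x assume "x \<in> S"
    then have "uniform_limit {x} \<Phi> (\<lambda>_. z) sequentially" by (intro lim) auto
    then show "(\<lambda>i. \<Phi> i x) \<longlonglongrightarrow> z" by (rule tendsto_uniform_limitI) simp
  qed
  then have g1: "germ (\<lambda>_. z) n (E \<zeta>0) (\<lambda>i. \<Phi> i (\<zeta> (real j)))" for j by (simp add: Ej)
  obtain \<delta> where \<delta>: "0 < \<delta>" "ball z \<delta> \<inter> K = {}"
  proof -
    have "open (- K)" "z \<in> - K" using compact_K z by (auto simp: compact_imp_closed open_Compl)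
    then obtain \<delta> where "0 < \<delta>" "ball z \<delta> \<subseteq> - K" by (rule openE)
    then show ?thesis using that by blast
  qed
  \<comment> \<open>One compact set covers \<open>m\<close> turns, so that a single bound on the
    index serves all pairs of visits.\<close>
  define Q where "Q = \<zeta> ` {0..real m}"
  have Q: "compact Q" "Q \<subseteq> S" using \<zeta>c \<zeta>S by (auto simp: Q_def intro!: compact_continuous_image)
  have "\<forall>\<^sub>F i in sequentially. \<forall>x\<in>Q. dist (\<Phi> i x) z < \<delta>" by (rule uniform_limit_near[OF lim[OF Q] \<delta>(1)])
  then have "\<forall>\<^sub>F i in sequentially. inj_on (\<lambda>j. \<Phi> i (\<zeta> (real j))) {..<m}"
  proof eventually_elim
    case (elim i)
    have no: "False" if j: "j < j'" "j' < m" "\<Phi> i (\<zeta> (real j)) = \<Phi> i (\<zeta> (real j'))" for j j'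
    proof -
      define k where "k = j' - j"
      have k: "0 < k" "real j + real k = real j'" using j by (auto simp: k_def)
      define \<sigma> where "\<sigma> = (\<lambda>t. \<Phi> i (\<zeta> (real j + t * real k)))"
      have ps: "path \<sigma>" unfolding path_def \<sigma>_def
      proof (rule continuous_on_compose2[OF liftD(2)[OF \<Phi>(1)], where f = "\<lambda>t. \<zeta> (real j + t * real k)"])
        show "continuous_on {0..1} (\<lambda>t. \<zeta> (real j + t * real k))" unfolding \<zeta>_def by (intro continuous_intros)
      qed (use \<zeta>S in auto)
      have loop: "pathfinish \<sigma> = pathstart \<sigma>"
        using j(3) k(2) by (simp add: pathfinish_def pathstart_def \<sigma>_def)
      have im: "path_image \<sigma> \<subseteq> ball z \<delta>"
      proof
        fix u assume "u \<in> path_image \<sigma>"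
        then obtain t where t: "t \<in> {0..1}" "u = \<Phi> i (\<zeta> (real j + t * real k))" by (auto simp: path_image_def \<sigma>_def)
        have "t * real k \<le> 1 * real k" using t(1) by (intro mult_right_mono) auto
        then have "real j + t * real k \<in> {0..real m}" using t(1) k(2) j(2) by auto
        then show "u \<in> ball z \<delta>" using elim t(2) by (auto simp: Q_def dist_commute)
      qed
      have w0: "winding_number \<sigma> c = 0" if "c \<in> K" for c
        by (rule winding_number_zero_outside[OF ps convex_ball loop _ im]) (use \<delta>(2) that in blast)
      have "winding_number ((g ^^ n i) \<circ> \<sigma>) c0 = of_nat (d ^ n i) * 0"
        by (rule winding_number_iterate[OF ps loop _ w0 c0])
           (use liftD(3)[OF \<Phi>(1) \<zeta>S] in \<open>auto simp: path_image_def \<sigma>_def\<close>)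
      moreover have "(g ^^ n i) \<circ> \<sigma> = (\<lambda>t. E (\<zeta> (real j + t * real k)))"
        using liftD(4)[OF \<Phi>(1) \<zeta>S] by (auto simp: \<sigma>_def fun_eq_iff)
      ultimately show False using wind[of j k] k(1) by (simp add: \<zeta>_def)
    qed
    show ?case
    proof (rule inj_onI)
      fix j j' assume "j \<in> {..<m}" "j' \<in> {..<m}" "\<Phi> i (\<zeta> (real j)) = \<Phi> i (\<zeta> (real j'))"
      then show "j = j'" using no[of j j'] no[of j' j] by (cases j j' rule: linorder_cases) auto
    qed
  qed
  then have "many_germs (\<lambda>_. z) n m (E \<zeta>0)"
    unfolding many_germs_def using g1 by (intro exI[of _ "\<lambda>j i. \<Phi> i (\<zeta> (real j))"]) auto
  then show ?thesis by (rule many_germs_spread[OF A _ E0 p])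
qed

section \<open>The backward random walk on the invariant set\<close>

text \<open>Two steps of \<open>g\<close> are taken together because a fibre of \<open>g\<close>
  alone may consist of a single point.\<close>

definition fib :: "complex \<Rightarrow> complex set" where "fib w = {y\<in>K. g (g y) = w}"

lemma g_in_K: "y \<in> K \<Longrightarrow> g y \<in> K"
  using g_K[of y 0] K_U[of "Suc 0"] by blast

lemma zorder_fibre_pos: "\<lbrakk>z \<in> U (Suc i); g z = w\<rbrakk> \<Longrightarrow> 0 < zorder (\<lambda>x. g x - w) z"
proof -
  assume z: "z \<in> U (Suc i)" "g z = w"
  have "\<exists>v\<in>U (Suc i). g v - w \<noteq> 0"
  proof (rule ccontr)
    assume "\<not> ?thesis"
    then have "\<forall>v\<in>U (Suc i). g v = w" by simp
    then have "g ` U (Suc i) \<subseteq> {w}" by blast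
    then have "U i \<subseteq> {w}" using g_image[of i] by simp
    then have "finite (U i)" by (rule finite_subset) simp
    then show False using finite_imp_not_open[OF _ U_open] U_ne by blast
  qed
  moreover have "(\<lambda>x. g x - w) holomorphic_on U (Suc i)" using g_hol by (auto intro!: holomorphic_intros)
  ultimately show ?thesis
    using zorder_exist_zero[of "\<lambda>x. g x - w" "U (Suc i)" z] U_open U_conn z by simp
qed

lemma card_g_fibre: "w \<in> U i \<Longrightarrow> card {z\<in>U (Suc i). g z = w} \<le> d"
proof -
  assume w: "w \<in> U i"
  have "int (card {z\<in>U (Suc i). g z = w}) = (\<Sum>z\<in>{z \<in> U (Suc i). g z = w}. 1)" by simp
  also have "\<dots> \<le> (\<Sum>z\<in>{z \<in> U (Suc i). g z = w}. zorder (\<lambda>x. g x - w) z)"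
  proof (rule sum_mono)
    fix z assume "z \<in> {z \<in> U (Suc i). g z = w}"
    then show "1 \<le> zorder (\<lambda>x. g x - w) z" using zorder_fibre_pos[of z i w] by simp
  qed
  also have "\<dots> = int d" using g_fibre[OF w] by blast
  finally show ?thesis by simp
qed

lemma fib_facts:
  assumes w: "w \<in> K"
  shows finite_fib: "finite (fib w)" and card_fib: "card (fib w) \<le> d * d" and fib_nonempty: "fib w \<noteq> {}"
proof -
  define F where "F = (\<lambda>v. {z\<in>U (Suc 0). g z = v})"
  have F: "finite (F v)" "card (F v) \<le> d" if "v \<in> K" for v
  proof -
    have "v \<in> U 0" using that K_U by blast
    then show "finite (F v)" "card (F v) \<le> d" using g_fibre[of v 0] card_g_fibre[of v 0] by (auto simp: F_def)
  qed
  have FK: "F v \<subseteq> K" if "v \<in> K" for v using that g_K[of _ 0] by (auto simp: F_def)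
  have sub: "fib w \<subseteq> (\<Union>v\<in>F w. F v)"
  proof
    fix y assume "y \<in> fib w"
    then have y: "y \<in> K" "g (g y) = w" by (auto simp: fib_def)
    then have "g y \<in> F w" "y \<in> F (g y)" using g_in_K K_U[of "Suc 0"] by (auto simp: F_def)
    then show "y \<in> (\<Union>v\<in>F w. F v)" by blast
  qed
  have fin: "finite (\<Union>v\<in>F w. F v)" using F(1) FK w by blast
  show "finite (fib w)" using finite_subset[OF sub fin] .
  have "card (fib w) \<le> card (\<Union>v\<in>F w. F v)" using card_mono[OF fin sub] .
  also have "\<dots> \<le> (\<Sum>v\<in>F w. card (F v))" by (rule card_UN_le[OF F(1)[OF w]])
  also have "\<dots> \<le> (\<Sum>v\<in>F w. d)"
  proof (rule sum_mono)
    fix v assume "v \<in> F w"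
    then show "card (F v) \<le> d" using F(2) FK[OF w] by blast
  qed
  also have "\<dots> \<le> d * d" using F(2)[OF w] by simp
  finally show "card (fib w) \<le> d * d" .
  have "w \<in> U 0" using w K_U by blast
  then obtain v where v: "v \<in> U (Suc 0)" "g v = w" using g_image[of 0] by (metis imageE)
  then have vK: "v \<in> K" using g_K w by blast
  then have "v \<in> U 0" using K_U by blast
  then obtain y where y: "y \<in> U (Suc 0)" "g y = v" using g_image[of 0] by (metis imageE)
  then have "y \<in> K" using g_K[OF y(1)] vK by simp
  then show "fib w \<noteq> {}" using y v by (auto simp: fib_def)
qed

lemma gg_hol: "(\<lambda>x. g (g x)) holomorphic_on U 2"
  using iterate_hol[of 2 0] by (simp add: numeral_2_eq_2 o_def)

lemma gg_cont: "continuous_on (U 2) (\<lambda>x. g (g x))"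
  using gg_hol by (rule holomorphic_on_imp_continuous_on)

lemma gg_K: "y \<in> U 2 \<Longrightarrow> g (g y) \<in> K \<Longrightarrow> y \<in> K"
  using iterate_K[of y 2 0] by (simp add: numeral_2_eq_2)

lemma gg_open: "open V \<Longrightarrow> V \<subseteq> U 2 \<Longrightarrow> open ((\<lambda>x. g (g x)) ` V)"
proof (rule open_mapping_thm[OF gg_hol U_open U_conn])
  show "\<not> (\<lambda>x. g (g x)) constant_on U 2"
  proof
    assume "(\<lambda>x. g (g x)) constant_on U 2"
    then obtain c where "\<forall>x\<in>U 2. g (g x) = c" unfolding constant_on_def by blast
    then have "(g ^^ 2) ` U (2 + 0) \<subseteq> {c}" by (auto simp: numeral_2_eq_2)
    then have "U 0 \<subseteq> {c}" using iterate_image[of 2 0] by simp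
    then have "finite (U 0)" by (rule finite_subset) simp
    then show False using finite_imp_not_open[OF _ U_open] U_ne by blast
  qed
qed

text \<open>If whole fibres lay in shrinking discs, then along a subsequence they would shrink to
  some \<open>x0\<close> in \<open>K\<close>. Another point \<open>x1\<close> has the same image
  under g o g, and as this map is open the fibres also have points near \<open>x1\<close>, a
  contradiction.\<close>

lemma fibres_spread: "\<exists>r>0. \<forall>x\<in>K. \<forall>w\<in>K. \<exists>y\<in>fib w. r \<le> dist x y"
proof (rule ccontr)
  assume H: "\<not> ?thesis"
  have "\<exists>x w. x \<in> K \<and> w \<in> K \<and> (\<forall>y\<in>fib w. dist x y < inverse (real (Suc k)))" for k
  proof -
    have "\<not> (\<forall>x\<in>K. \<forall>w\<in>K. \<exists>y\<in>fib w. inverse (real (Suc k)) \<le> dist x y)"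
      using H by (metis inverse_positive_iff_positive of_nat_0_less_iff zero_less_Suc)
    then show ?thesis by (metis linorder_not_le)
  qed
  then obtain x w where xw: "\<And>k. x k \<in> K" "\<And>k. w k \<in> K" "\<And>k y. y \<in> fib (w k) \<Longrightarrow> dist (x k) y < inverse (real (Suc k))"
    by metis
  obtain x0 and s :: "nat \<Rightarrow> nat" where s: "x0 \<in> K" "strict_mono s" "(x \<circ> s) \<longlonglongrightarrow> x0"
    using compact_K xw(1) unfolding compact_def by metis
  have "\<exists>y. y \<in> fib (w k)" for k using fib_nonempty[OF xw(2)[of k]] by blast
  then obtain y where y: "\<And>k. y k \<in> fib (w k)" by metis
  have inv0: "(\<lambda>k. inverse (real (Suc (s k)))) \<longlonglongrightarrow> 0"
    using LIMSEQ_subseq_LIMSEQ[OF LIMSEQ_inverse_real_of_nat s(2)] by (simp add: o_def)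
  have dxy: "(\<lambda>k. dist (x (s k)) (y (s k))) \<longlonglongrightarrow> 0"
    by (rule tendsto_sandwich[OF _ _ tendsto_const inv0]) (use xw(3)[OF y] in \<open>auto intro: less_imp_le always_eventually\<close>)
  have ylim: "(\<lambda>k. y (s k)) \<longlonglongrightarrow> x0"
  proof (rule Lim_transform[OF s(3)[unfolded o_def]])
    show "(\<lambda>k. y (s k) - x (s k)) \<longlonglongrightarrow> 0"
      by (rule tendsto_norm_zero_cancel) (use dxy in \<open>simp add: dist_norm norm_minus_commute\<close>)
  qed
  obtain x1 where x1: "x1 \<in> K" "x1 \<noteq> x0" "g (g x1) = g (g x0)" using second_preimage_not_unique[OF s(1)] by blast
  define \<delta> where "\<delta> = dist x0 x1 / 2"
  have \<delta>: "0 < \<delta>" using x1(2) by (simp add: \<delta>_def)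
  have x0U: "x0 \<in> U 2" "x1 \<in> U 2" using s(1) x1(1) K_U by auto
  define W where "W = (\<lambda>x. g (g x)) ` (ball x1 \<delta> \<inter> U 2)"
  have "open W" unfolding W_def by (rule gg_open) (auto intro: U_open)
  moreover have "g (g x0) \<in> W" unfolding W_def using x1(3) x0U(2) \<delta> by (intro image_eqI[of _ _ x1]) auto
  moreover have "(\<lambda>k. g (g (y (s k)))) \<longlonglongrightarrow> g (g x0)"
  proof (rule continuous_on_tendsto_compose[OF gg_cont ylim x0U(1)])
    show "\<forall>\<^sub>F k in sequentially. y (s k) \<in> U 2"
      using y K_U[of 2] by (intro always_eventually allI) (auto simp: fib_def)
  qed
  ultimately have ev: "\<forall>\<^sub>F k in sequentially. g (g (y (s k))) \<in> W" by (metis topological_tendstoD)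
  have ev2: "\<forall>\<^sub>F k in sequentially. dist (x (s k)) x0 < \<delta> / 2"
    using tendstoD[OF s(3), of "\<delta>/2"] \<delta> by (simp only: o_def half_gt_zero)
  have ev3: "\<forall>\<^sub>F k in sequentially. inverse (real (Suc (s k))) < \<delta> / 2" using order_tendstoD(2)[OF inv0, of "\<delta>/2"] \<delta> by simp
  obtain k where k: "g (g (y (s k))) \<in> W" "dist (x (s k)) x0 < \<delta> / 2" "inverse (real (Suc (s k))) < \<delta> / 2"
    using eventually_happens[OF eventually_conj[OF ev eventually_conj[OF ev2 ev3]]] by auto
  then obtain v where v: "v \<in> ball x1 \<delta>" "v \<in> U 2" "g (g v) = w (s k)"
    using y[of "s k"] unfolding W_def fib_def by auto
  then have "v \<in> fib (w (s k))" using gg_K[OF v(2)] xw(2) by (auto simp: fib_def)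
  then have "dist (x (s k)) v < \<delta> / 2" using xw(3)[of v "s k"] k(3) by simp
  moreover have "2 * \<delta> = dist x0 x1" by (simp add: \<delta>_def)
  moreover have "dist x0 x1 \<le> dist (x (s k)) x0 + dist (x (s k)) v + dist x1 v" by metric
  ultimately show False using k(2) v(1) by simp
qed

text \<open>\<open>K\<close> need not be convex, so the mean value inequality is used only for pairs
  at distance at most \<open>s\<close>, on a disc inside \<open>U 2\<close>; for the others the
  diameter of \<open>K\<close> over \<open>s\<close> is a sufficient constant.\<close>

lemma gg_Lipschitz: "\<exists>L>1. \<forall>x\<in>K. \<forall>y\<in>K. dist (g (g x)) (g (g y)) \<le> L * dist x y"
proof -
  obtain s where s: "0 < s" "(\<Union>x\<in>K. cball x s) \<subseteq> U 2"
    using compact_subset_open_imp_cball_epsilon_subset[OF compact_K U_open K_U] by blast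
  define C where "C = (\<Union>x\<in>K. cball x s)"
  have C: "compact C" unfolding C_def by (rule compact_minkowski_sum_cball[OF compact_K])
  have CU: "C \<subseteq> U 2" using s(2) by (simp only: C_def)
  have "continuous_on C (deriv (\<lambda>x. g (g x)))"
    using holomorphic_on_imp_continuous_on[OF holomorphic_deriv[OF gg_hol U_open]] CU by (rule continuous_on_subset)
  then have "compact (deriv (\<lambda>x. g (g x)) ` C)" using C by (rule compact_continuous_image)
  then have "bounded (deriv (\<lambda>x. g (g x)) ` C)" by (rule compact_imp_bounded)
  then obtain B where "\<forall>v\<in>deriv (\<lambda>x. g (g x)) ` C. norm v \<le> B" unfolding bounded_iff by (rule exE)
  then have B: "norm (deriv (\<lambda>x. g (g x)) c) \<le> B" if "c \<in> C" for c using that by simp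
  define D where "D = diameter K"
  define L where "L = max 2 (max B (D / s))"
  have "dist (g (g x)) (g (g y)) \<le> L * dist x y" if xy: "x \<in> K" "y \<in> K" for x y
  proof (cases "dist x y \<le> s")
    case True
    have cb: "cball x s \<subseteq> C" unfolding C_def using xy(1) by (rule UN_upper)
    have "norm (g (g x) - g (g y)) \<le> B * norm (x - y)"
    proof (rule field_differentiable_bound[of "cball x s" "\<lambda>x. g (g x)" "deriv (\<lambda>x. g (g x))"])
      show "((\<lambda>x. g (g x)) has_field_derivative deriv (\<lambda>x. g (g x)) c) (at c within cball x s)" if "c \<in> cball x s" for c
      proof -
        have "c \<in> U 2" using that cb CU by blast
        then show ?thesis using holomorphic_derivI[OF gg_hol U_open] by (blast intro: has_field_derivative_at_within)
      qed
      show "norm (deriv (\<lambda>x. g (g x)) c) \<le> B" if "c \<in> cball x s" for c using B that cb by blast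
    qed (use True s(1) in auto)
    also have "\<dots> \<le> L * norm (x - y)" by (intro mult_right_mono) (auto simp: L_def)
    finally show ?thesis by (simp add: dist_norm)
  next
    case False
    have "dist (g (g x)) (g (g y)) \<le> D"
      unfolding D_def using g_in_K xy by (intro diameter_bounded_bound compact_imp_bounded[OF compact_K]) auto
    also have "D = (D / s) * s" using s(1) by simp
    also have "\<dots> \<le> L * dist x y"
      using False s(1) by (intro mult_mono) (auto simp: L_def)
    finally show ?thesis .
  qed
  moreover have "1 < L" by (simp add: L_def)
  ultimately show ?thesis by blast
qed

text \<open>\<open>wt N\<close> is the distribution on \<open>backward w N\<close> of the random walk that starts at \<open>w\<close> and picks each preimage under
  \<open>g \<circ> g\<close> with the same probability; multiplicities are ignored.\<close>

fun wt :: "nat \<Rightarrow> complex \<Rightarrow> real" where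
  "wt 0 y = 1"
| "wt (Suc N) y = wt N (g (g y)) / real (card (fib (g (g y))))"

fun backward :: "complex \<Rightarrow> nat \<Rightarrow> complex set" where
  "backward w 0 = {w}"
| "backward w (Suc N) = {y\<in>K. g (g y) \<in> backward w N}"

lemma wt_nonneg: "0 \<le> wt N y"
  by (induction N arbitrary: y) auto

lemma backward_sub: "w \<in> K \<Longrightarrow> backward w N \<subseteq> K"
  by (cases N) auto

lemma backward_Suc: "backward w (Suc N) = (\<Union>v\<in>backward w N. fib v)"
  by (auto simp: fib_def)

lemma finite_backward: "w \<in> K \<Longrightarrow> finite (backward w N)"
proof (induction N)
  case (Suc N)
  then show ?case unfolding backward_Suc using finite_fib backward_sub[OF Suc.prems] by blast
qed simp

text \<open>Each point of generation N + 1 lies over exactly one point of generation N. The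
  predicate \<open>P\<close> will be membership in a disc.\<close>

lemma sum_backward:
  assumes w: "w \<in> K"
  shows "(\<Sum>y\<in>{y\<in>backward w (Suc N). P y}. wt (Suc N) y)
       = (\<Sum>v\<in>backward w N. wt N v * (real (card {y\<in>fib v. P y}) / real (card (fib v))))"
proof -
  have vK: "v \<in> K" if "v \<in> backward w N" for v using backward_sub[OF w] that by blast
  have "{y\<in>backward w (Suc N). P y} = (\<Union>v\<in>backward w N. {y\<in>fib v. P y})" unfolding backward_Suc by blast
  then have "(\<Sum>y\<in>{y\<in>backward w (Suc N). P y}. wt (Suc N) y) = (\<Sum>v\<in>backward w N. \<Sum>y\<in>{y\<in>fib v. P y}. wt (Suc N) y)"
  proof (simp only:, intro sum.UNION_disjoint ballI impI)
    show "finite (backward w N)" by (rule finite_backward[OF w])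
    show "finite {y\<in>fib v. P y}" if "v \<in> backward w N" for v using finite_fib[OF vK[OF that]] by simp
    show "{y\<in>fib v. P y} \<inter> {y\<in>fib v'. P y} = {}" if "v \<noteq> v'" for v v' using that by (auto simp: fib_def)
  qed
  also have "\<dots> = (\<Sum>v\<in>backward w N. \<Sum>y\<in>{y\<in>fib v. P y}. wt N v / real (card (fib v)))"
    by (intro sum.cong refl) (auto simp: fib_def)
  also have "\<dots> = (\<Sum>v\<in>backward w N. wt N v * (real (card {y\<in>fib v. P y}) / real (card (fib v))))"
    by (intro sum.cong refl) (simp add: mult_ac)
  finally show ?thesis .
qed

lemma sum_wt: "w \<in> K \<Longrightarrow> (\<Sum>y\<in>backward w N. wt N y) = 1"
proof (induction N)
  case (Suc N)
  have "real (card (fib v)) / real (card (fib v)) = 1" if "v \<in> backward w N" for v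
    using backward_sub[OF Suc.prems] that finite_fib fib_nonempty by (auto simp: card_eq_0_iff)
  then have "(\<Sum>v\<in>backward w N. wt N v * (real (card (fib v)) / real (card (fib v)))) = (\<Sum>v\<in>backward w N. wt N v)"
    by (intro sum.cong) auto
  then show ?case using sum_backward[OF Suc.prems, of N "\<lambda>_. True"] Suc by (simp del: wt.simps backward.simps)
qed simp

text \<open>A fibre that meets the disc of radius r <= r0 has a point at distance at least r0, so at
  most the fraction 1 - 1/d^2 of its at most d^2 points lies in the disc. Its base point lies in the
  disc of radius L r about \<open>g (g x)\<close>, where the induction hypothesis applies.\<close>

lemma wt_decay_centre:
  assumes w: "w \<in> K" and r0: "\<And>x w. \<lbrakk>x \<in> K; w \<in> K\<rbrakk> \<Longrightarrow> \<exists>y\<in>fib w. r0 \<le> dist x y"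
    and L: "1 < L" "\<And>x y. \<lbrakk>x \<in> K; y \<in> K\<rbrakk> \<Longrightarrow> dist (g (g x)) (g (g y)) \<le> L * dist x y"
  shows "\<lbrakk>k \<le> N; x \<in> K; 0 \<le> r; L ^ k * r \<le> r0\<rbrakk> \<Longrightarrow> (\<Sum>y\<in>{y\<in>backward w N. dist x y < r}. wt N y) \<le> (1 - 1 / (real d * real d)) ^ k"
proof (induction k arbitrary: N x r)
  case 0
  have "(\<Sum>y\<in>{y\<in>backward w N. dist x y < r}. wt N y) \<le> (\<Sum>y\<in>backward w N. wt N y)"
    by (rule sum_mono2) (auto simp: finite_backward[OF w] wt_nonneg)
  then show ?case using sum_wt[OF w] by simp
next
  case (Suc k)
  define \<theta> where "\<theta> = 1 - 1 / (real d * real d)"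
  have \<theta>0: "0 \<le> \<theta>"
  proof -
    have "1 \<le> real d * real d" using d2 mult_mono[of 1 "real d" 1 "real d"] by simp
    then show ?thesis by (simp add: \<theta>_def)
  qed
  obtain M where M: "N = Suc M" using Suc.prems(1) by (cases N) auto
  have "r \<le> L ^ Suc k * r" using mult_right_mono[OF one_le_power[OF less_imp_le[OF L(1)], of "Suc k"] Suc.prems(3)] by simp
  then have rr0: "r \<le> r0" using Suc.prems(4) by linarith
  have gx: "g (g x) \<in> K" using Suc.prems(2) g_in_K by blast
  have "(\<Sum>y\<in>{y\<in>backward w N. dist x y < r}. wt N y)
     = (\<Sum>v\<in>backward w M. wt M v * (real (card {y\<in>fib v. dist x y < r}) / real (card (fib v))))"
    unfolding M by (rule sum_backward[OF w])
  also have "\<dots> \<le> (\<Sum>v\<in>backward w M. if dist (g (g x)) v < L * r then wt M v * \<theta> else 0)"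
  proof (rule sum_mono)
    fix v assume v: "v \<in> backward w M"
    then have vK: "v \<in> K" using backward_sub[OF w] by blast
    show "wt M v * (real (card {y\<in>fib v. dist x y < r}) / real (card (fib v))) \<le> (if dist (g (g x)) v < L * r then wt M v * \<theta> else 0)"
    proof (cases "{y\<in>fib v. dist x y < r} = {}")
      case True
      then show ?thesis using wt_nonneg[of M v] \<theta>0 by (simp only: card.empty) simp
    next
      case False
      then obtain y where y: "y \<in> K" "g (g y) = v" "dist x y < r" by (auto simp: fib_def)
      have "dist (g (g x)) v \<le> L * dist x y" using L(2)[OF Suc.prems(2) y(1)] y(2) by simp
      also have "\<dots> < L * r" using y(3) L(1) by simp
      finally have near: "dist (g (g x)) v < L * r" .
      obtain y' where y': "y' \<in> fib v" "r0 \<le> dist x y'" using r0[OF Suc.prems(2) vK] by blast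
      have "card {y\<in>fib v. dist x y < r} \<le> card (fib v - {y'})"
        by (rule card_mono) (use finite_fib[OF vK] y' rr0 in auto)
      also have "\<dots> = card (fib v) - 1" using y'(1) finite_fib[OF vK] by simp
      finally have c1: "card {y\<in>fib v. dist x y < r} \<le> card (fib v) - 1" .
      have c0: "0 < card (fib v)" using finite_fib[OF vK] y'(1) by (auto simp: card_gt_0_iff)
      have "real (card {y\<in>fib v. dist x y < r}) \<le> real (card (fib v)) - 1" using c1 c0 by linarith
      then have "real (card {y\<in>fib v. dist x y < r}) / real (card (fib v)) \<le> (real (card (fib v)) - 1) / real (card (fib v))"
        by (rule divide_right_mono) simp
      also have "\<dots> = 1 - 1 / real (card (fib v))" using c0 by (simp add: diff_divide_distrib)
      also have "\<dots> \<le> \<theta>"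
      proof -
        have "real (card (fib v)) \<le> real (d * d)" using card_fib[OF vK] by (simp only: of_nat_le_iff)
        then have "1 / (real d * real d) \<le> 1 / real (card (fib v))" using c0 by (intro divide_left_mono) auto
        then show ?thesis by (simp add: \<theta>_def)
      qed
      finally have "wt M v * (real (card {y\<in>fib v. dist x y < r}) / real (card (fib v))) \<le> wt M v * \<theta>"
        using wt_nonneg[of M v] by (rule mult_left_mono)
      then show ?thesis using near by simp
    qed
  qed
  also have "\<dots> = (\<Sum>v\<in>{v\<in>backward w M. dist (g (g x)) v < L * r}. wt M v * \<theta>)"
    unfolding sum.inter_filter[OF finite_backward[OF w]] ..
  also have "\<dots> = (\<Sum>v\<in>{v\<in>backward w M. dist (g (g x)) v < L * r}. wt M v) * \<theta>" by (simp add: sum_distrib_right)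
  also have "\<dots> \<le> \<theta> ^ k * \<theta>"
  proof (rule mult_right_mono[OF _ \<theta>0])
    show "(\<Sum>v\<in>{v\<in>backward w M. dist (g (g x)) v < L * r}. wt M v) \<le> \<theta> ^ k"
      unfolding \<theta>_def by (rule Suc.IH) (use Suc.prems M gx L(1) in \<open>auto simp: mult_ac\<close>)
  qed
  finally show ?case by (simp add: \<theta>_def mult_ac)
qed

text \<open>The centre need not lie in \<open>K\<close>: a disc that meets the walk is contained in
  the disc of twice the radius about one of the points of the walk.\<close>

lemma wt_decay:
  assumes w: "w \<in> K" and r0: "\<And>x w. \<lbrakk>x \<in> K; w \<in> K\<rbrakk> \<Longrightarrow> \<exists>y\<in>fib w. r0 \<le> dist x y"
    and L: "1 < L" "\<And>x y. \<lbrakk>x \<in> K; y \<in> K\<rbrakk> \<Longrightarrow> dist (g (g x)) (g (g y)) \<le> L * dist x y"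
    and k: "k \<le> N" "0 \<le> r" "L ^ k * (2 * r) \<le> r0"
  shows "(\<Sum>y\<in>{y\<in>backward w N. dist y \<zeta> < r}. wt N y) \<le> (1 - 1 / (real d * real d)) ^ k"
proof (cases "{y\<in>backward w N. dist y \<zeta> < r} = {}")
  case True
  have "1 \<le> real d * real d" using d2 mult_mono[of 1 "real d" 1 "real d"] by simp
  then have "0 \<le> 1 - 1 / (real d * real d)" by simp
  then show ?thesis unfolding True by simp
next
  case False
  then obtain x where x: "x \<in> backward w N" "dist x \<zeta> < r" by blast
  have "(\<Sum>y\<in>{y\<in>backward w N. dist y \<zeta> < r}. wt N y) \<le> (\<Sum>y\<in>{y\<in>backward w N. dist x y < 2 * r}. wt N y)"
  proof (rule sum_mono2)
    show "{y\<in>backward w N. dist y \<zeta> < r} \<subseteq> {y\<in>backward w N. dist x y < 2 * r}"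
    proof
      fix y assume "y \<in> {y\<in>backward w N. dist y \<zeta> < r}"
      then show "y \<in> {y\<in>backward w N. dist x y < 2 * r}" using x(2) dist_triangle2[of x y \<zeta>] by simp
    qed
  qed (auto simp: finite_backward[OF w] wt_nonneg)
  also have "\<dots> \<le> (1 - 1 / (real d * real d)) ^ k"
    by (rule wt_decay_centre[OF w r0 L k(1)]) (use k x(1) backward_sub[OF w] in auto)
  finally show ?thesis .
qed

text \<open>An interior point of \<open>K\<close> has an interior image, since g o g is open and
  preserves \<open>K\<close>. Staying on the frontier guarantees that points outside
  \<open>K\<close> are found close to the mass of the walk.\<close>

lemma backward_frontier:
  assumes w: "w \<in> frontier K"
  shows "backward w N \<subseteq> frontier K"
proof (induction N)
  case (Suc N)
  have fK: "frontier K = K - interior K" using compact_K by (simp add: frontier_def compact_imp_closed)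
  show ?case
  proof
    fix y assume y: "y \<in> backward w (Suc N)"
    then have yK: "y \<in> K" "g (g y) \<in> frontier K" using Suc by auto
    have "y \<notin> interior K"
    proof
      assume "y \<in> interior K"
      have iK: "interior K \<subseteq> U 2" using interior_subset K_U by blast
      have "open ((\<lambda>x. g (g x)) ` interior K)" by (rule gg_open[OF open_interior iK])
      moreover have "(\<lambda>x. g (g x)) ` interior K \<subseteq> K" using g_in_K interior_subset by blast
      ultimately have "(\<lambda>x. g (g x)) ` interior K \<subseteq> interior K" by (rule interior_maximal[rotated])
      then have "g (g y) \<in> interior K" using \<open>y \<in> interior K\<close> by blast
      then show False using yK(2) fK by blast
    qed
    then show "y \<in> frontier K" using yK(1) fK by blast
  qed
qed (use w in simp)

lemma frontier_K: "frontier K \<noteq> {}" "frontier K \<subseteq> K"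
proof -
  have "K \<noteq> UNIV" using compact_K compact_imp_bounded not_bounded_UNIV by blast
  then show "frontier K \<noteq> {}" using frontier_not_empty[OF K_nonempty] by blast
  show "frontier K \<subseteq> K" using compact_K by (simp add: frontier_def compact_imp_closed)
qed

lemma sum_UN_le:
  fixes T :: "complex set"
  assumes "finite T" "finite A"
  shows "(\<Sum>y\<in>(\<Union>a\<in>T. A \<inter> B a). wt N y) \<le> (\<Sum>a\<in>T. \<Sum>y\<in>A \<inter> B a. wt N y)"
  using assms(1)
proof (induction T)
  case (insert t T)
  have fin: "finite (A \<inter> B t)" "finite (\<Union>a\<in>T. A \<inter> B a)" using assms(2) insert.hyps(1) by auto
  have "(\<Sum>y\<in>(\<Union>a\<in>insert t T. A \<inter> B a). wt N y) = (\<Sum>y\<in>(A \<inter> B t) \<union> (\<Union>a\<in>T. A \<inter> B a). wt N y)" by simp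
  also have "\<dots> \<le> (\<Sum>y\<in>A \<inter> B t. wt N y) + (\<Sum>y\<in>(\<Union>a\<in>T. A \<inter> B a). wt N y)"
    using sum_Un[OF fin, of "wt N"] sum_nonneg[of "(A \<inter> B t) \<inter> (\<Union>a\<in>T. A \<inter> B a)" "wt N"] wt_nonneg by simp
  finally show ?case using insert by simp
qed simp

text \<open>Pigeonhole twice: finitely many discs cover the frontier, so at each time one of them
  has mass at least 1 / card T, and some disc does so infinitely often. The disc is thereby fixed
  before the time, which has to be late depending on the counting function.\<close>

lemma massive_ball:
  assumes w: "w \<in> frontier K" and R: "0 < R"
  obtains a c where "a \<in> frontier K" "0 < c" "\<exists>\<^sub>\<infinity>N. c \<le> (\<Sum>y\<in>backward w N \<inter> ball a R. wt N y)"
proof -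
  have wK: "w \<in> K" using w frontier_K(2) by blast
  have "compact (frontier K)" using compact_K by (rule compact_frontier)
  moreover have "frontier K \<subseteq> (\<Union>a\<in>frontier K. ball a R)" using R by auto
  ultimately obtain T where T: "T \<subseteq> frontier K" "finite T" "frontier K \<subseteq> (\<Union>a\<in>T. ball a R)"
    by (rule compactE_image[of "frontier K" "frontier K" "\<lambda>a. ball a R", OF _ open_ball])
  define c where "c = 1 / real (card T)"
  have "T \<noteq> {}" using T(3) w by blast
  then have card0: "0 < card T" using T(2) by (simp add: card_gt_0_iff)
  then have c: "0 < c" by (simp add: c_def)
  have ex: "\<exists>a\<in>T. c \<le> (\<Sum>y\<in>backward w N \<inter> ball a R. wt N y)" for N
  proof (rule ccontr)
    assume H: "\<not> ?thesis"
    have lt: "(\<Sum>y\<in>backward w N \<inter> ball a R. wt N y) < c" if "a \<in> T" for a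
    proof (rule ccontr)
      assume "\<not> ?thesis"
      then show False using H that by (simp only: not_less) blast
    qed
    have fin: "finite (backward w N)" by (rule finite_backward[OF wK])
    have cov: "backward w N = (\<Union>a\<in>T. backward w N \<inter> ball a R)"
    proof (intro equalityI subsetI)
      fix y assume y: "y \<in> backward w N"
      then have "y \<in> (\<Union>a\<in>T. ball a R)" using T(3) backward_frontier[OF w, of N] by (meson subsetD)
      then show "y \<in> (\<Union>a\<in>T. backward w N \<inter> ball a R)" using y by simp
    qed simp
    have "1 = (\<Sum>y\<in>backward w N. wt N y)" using sum_wt[OF wK] by simp
    also have "\<dots> = (\<Sum>y\<in>(\<Union>a\<in>T. backward w N \<inter> ball a R). wt N y)" using cov by simp
    also have "\<dots> \<le> (\<Sum>a\<in>T. \<Sum>y\<in>backward w N \<inter> ball a R. wt N y)"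
      using sum_UN_le[OF T(2) fin] by simp
    also have "\<dots> < (\<Sum>a\<in>T. c)" by (rule sum_strict_mono[OF T(2) \<open>T \<noteq> {}\<close> lt])
    also have "\<dots> = 1" using card0 by (simp add: c_def)
    finally show False by simp
  qed
  have "\<exists>\<^sub>\<infinity>N. \<exists>a\<in>T. c \<le> (\<Sum>y\<in>backward w N \<inter> ball a R. wt N y)"
  proof (unfold INFM_nat, intro allI)
    fix m :: nat
    show "\<exists>n>m. \<exists>a\<in>T. c \<le> (\<Sum>y\<in>backward w n \<inter> ball a R. wt n y)"
      using ex[of "Suc m"] by (intro exI[of _ "Suc m"]) simp
  qed
  then have "\<exists>a\<in>T. \<exists>\<^sub>\<infinity>N. c \<le> (\<Sum>y\<in>backward w N \<inter> ball a R. wt N y)"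
    by (rule frequently_bex_finite[OF T(2)])
  then obtain a where a: "a \<in> T" "\<exists>\<^sub>\<infinity>N. c \<le> (\<Sum>y\<in>backward w N \<inter> ball a R. wt N y)" ..
  show ?thesis by (rule that[OF subsetD[OF T(1) a(1)] c a(2)])
qed

section \<open>Counting preimages\<close>

definition fibre :: "nat \<Rightarrow> complex \<Rightarrow> complex set" where
  "fibre n w = {y\<in>U n. (g ^^ n) y = w}"

lemma fibre_Om: "w \<in> Om 0 \<Longrightarrow> fibre n w \<subseteq> Om n"
  using iterate_K[of _ n 0] by (auto simp: fibre_def Om_def)

lemma finite_fibre: "w \<in> Om 0 \<Longrightarrow> finite (fibre n w)"
proof -
  assume w: "w \<in> Om 0"
  have eq: "{x\<in>Om n. (g ^^ n) x = w} = fibre n w" using fibre_Om[OF w, of n] by (auto simp: fibre_def Om_def)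
  have "compact (fibre n w)" using iterate_proper[of "{w}" 0 n] w by (simp add: fibre_def Om_def)
  moreover have "(g ^^ n) holomorphic_on Om n"
    using iterate_hol[of n 0] by (auto simp: Om_def intro: holomorphic_on_subset)
  moreover have "deriv (g ^^ n) x \<noteq> 0" if "x \<in> Om n" for x using iterate_deriv[of x n 0] that by (simp add: Om_def)
  ultimately have "finite {x\<in>Om n. (g ^^ n) x = w}"
    by (intro finite_fibre_local_homeomorphism[OF Om_open[of n]]) (assumption | simp only: eq)+
  then show ?thesis by (simp only: eq)
qed

lemma deriv_lift:
  assumes "lift n S (\<lambda>x. x) \<phi>" "open S" "v \<in> S"
  shows "(\<phi> has_field_derivative inverse (deriv (g ^^ n) (\<phi> v))) (at v)"
proof -
  have y: "\<phi> v \<in> U n" using liftD(3)[OF assms(1,3)] by (simp add: Om_def)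
  have 1: "(\<phi> has_field_derivative deriv \<phi> v) (at v)"
    by (rule holomorphic_derivI[OF liftD(1)[OF assms(1)] assms(2,3)])
  have 2: "((g ^^ n) has_field_derivative deriv (g ^^ n) (\<phi> v)) (at (\<phi> v))"
    using holomorphic_derivI[OF iterate_hol[of n 0] U_open] y by simp
  have "((\<lambda>x. (g ^^ n) (\<phi> x)) has_field_derivative deriv (g ^^ n) (\<phi> v) * deriv \<phi> v) (at v)"
    by (rule DERIV_chain2[OF 2 1])
  moreover have "((\<lambda>x. (g ^^ n) (\<phi> x)) has_field_derivative 1) (at v)"
    by (rule has_field_derivative_transform_within_open[OF DERIV_ident assms(2,3)]) (simp add: liftD(4)[OF assms(1)])
  ultimately have "deriv (g ^^ n) (\<phi> v) * deriv \<phi> v = 1" by (rule DERIV_unique)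
  then have "deriv \<phi> v = inverse (deriv (g ^^ n) (\<phi> v))" by (metis inverse_unique)
  then show ?thesis using 1 by simp
qed

text \<open>Over a disc in \<open>Om 0\<close> the fibre moves along inverse branches without
  collisions, which turns sums over fibres into finite sums of holomorphically moving terms.\<close>

lemma fibre_lifts:
  assumes r: "0 < r" "ball w r \<subseteq> Om 0"
  obtains \<phi> where "\<And>y. y \<in> fibre n w \<Longrightarrow> lift n (ball w r) (\<lambda>x. x) (\<phi> y)" "\<And>y. y \<in> fibre n w \<Longrightarrow> \<phi> y w = y"
    "\<And>v. v \<in> ball w r \<Longrightarrow> bij_betw (\<lambda>y. \<phi> y v) (fibre n w) (fibre n v)"
proof -
  have wb: "w \<in> ball w r" using r by simp
  have ex: "\<exists>\<Phi>. lift n (ball w r) (\<lambda>x. x) \<Phi> \<and> \<Phi> v = y" if v: "v \<in> ball w r" and y: "y \<in> fibre n v" for v y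
  proof -
    have "v \<in> Om 0" using v r(2) by blast
    then have yO: "y \<in> Om n" "(g ^^ n) y = v" using y fibre_Om[of v n] by (auto simp: fibre_def)
    obtain \<Phi> where "lift n (ball w r) (\<lambda>x. x) \<Phi>" "\<Phi> v = y"
      by (rule lift_exists[OF open_ball convex_imp_simply_connected[OF convex_ball] holomorphic_on_ident _ v yO])
         (use r(2) in auto)
    then show ?thesis by blast
  qed
  have uniq: "\<Phi> x = \<Psi> x" if "lift n (ball w r) (\<lambda>x. x) \<Phi>" "lift n (ball w r) (\<lambda>x. x) \<Psi>" "v \<in> ball w r" "\<Phi> v = \<Psi> v" "x \<in> ball w r" for \<Phi> \<Psi> v x
    by (rule lift_unique[OF that(1,2) connected_ball that(3-5)]) (use r(2) in \<open>auto intro: continuous_intros\<close>)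
  have "\<forall>y\<in>fibre n w. \<exists>\<Phi>. lift n (ball w r) (\<lambda>x. x) \<Phi> \<and> \<Phi> w = y" using ex[OF wb] by simp
  then obtain \<phi> where \<phi>: "\<forall>y\<in>fibre n w. lift n (ball w r) (\<lambda>x. x) (\<phi> y) \<and> \<phi> y w = y" by (rule bchoice[THEN exE])
  have "bij_betw (\<lambda>y. \<phi> y v) (fibre n w) (fibre n v)" if v: "v \<in> ball w r" for v
  proof (rule bij_betw_imageI)
    show "inj_on (\<lambda>y. \<phi> y v) (fibre n w)"
    proof (rule inj_onI)
      fix x y assume xy: "x \<in> fibre n w" "y \<in> fibre n w" "\<phi> x v = \<phi> y v"
      have "lift n (ball w r) (\<lambda>x. x) (\<phi> x)" "lift n (ball w r) (\<lambda>x. x) (\<phi> y)" using \<phi> xy by auto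
      then have "\<phi> x w = \<phi> y w" using v xy(3) wb by (rule uniq)
      then show "x = y" using \<phi> xy by simp
    qed
    show "(\<lambda>y. \<phi> y v) ` fibre n w = fibre n v"
    proof (intro equalityI subsetI)
      fix y assume "y \<in> (\<lambda>y. \<phi> y v) ` fibre n w"
      then obtain x where "x \<in> fibre n w" "y = \<phi> x v" by blast
      then show "y \<in> fibre n v" using liftD(3,4)[of n "ball w r" "\<lambda>x. x" "\<phi> x" v] \<phi> v by (simp add: fibre_def Om_def)
    next
      fix y assume y: "y \<in> fibre n v"
      obtain \<Psi> where \<Psi>: "lift n (ball w r) (\<lambda>x. x) \<Psi>" "\<Psi> v = y" using ex[OF v y] by blast
      have F: "\<Psi> w \<in> fibre n w" using liftD(3,4)[OF \<Psi>(1) wb] by (simp add: fibre_def Om_def)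
      have "\<phi> (\<Psi> w) v = \<Psi> v" by (rule uniq[OF _ \<Psi>(1) wb _ v]) (use \<phi> F in auto)
      then show "y \<in> (\<lambda>y. \<phi> y v) ` fibre n w" using F \<Psi>(2) by (intro image_eqI[of _ _ "\<Psi> w"]) auto
    qed
  qed
  then show ?thesis using that \<phi> by blast
qed

text \<open>The transfer of \<open>h\<close> under \<open>g ^^ n\<close>. The value type is open
  because real functions, gradients written as complex numbers, and \<open>ennreal\<close> densities
  all have to be summed.\<close>

definition fibre_sum :: "nat \<Rightarrow> (complex \<Rightarrow> 'a::comm_monoid_add) \<Rightarrow> complex \<Rightarrow> 'a" where
  "fibre_sum n h w = (\<Sum>y\<in>fibre n w. h y)"

lemma fibre_sum_lifts:
  assumes "\<And>v. v \<in> B \<Longrightarrow> bij_betw (\<lambda>y. \<phi> y v) F (fibre n v)" "v \<in> B"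
  shows "fibre_sum n h v = (\<Sum>y\<in>F. h (\<phi> y v))"
  unfolding fibre_sum_def using sum.reindex_bij_betw[OF assms(1)[OF assms(2)], of h] by simp

text \<open>With a real gradient written as a complex number, composition with a holomorphic branch
  multiplies it by the conjugate of the derivative of the branch, which is the inverse of
  \<open>deriv (g ^^ n) y\<close>.\<close>

abbreviation pull :: "nat \<Rightarrow> (complex \<Rightarrow> complex) \<Rightarrow> complex \<Rightarrow> complex" where
  "pull n h' \<equiv> (\<lambda>y. cnj (inverse (deriv (g ^^ n) y)) * h' y)"

lemma fibre_sum_derivative:
  assumes h: "\<And>y. (h has_derivative (\<lambda>v. h' y \<bullet> v)) (at y)" and w: "w \<in> Om 0"
  shows "(fibre_sum n h has_derivative (\<lambda>v. fibre_sum n (pull n h') w \<bullet> v)) (at w)"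
proof -
  obtain r where r: "0 < r" "ball w r \<subseteq> Om 0" using Om_open w by (rule openE)
  obtain \<phi> where \<phi>: "\<And>y. y \<in> fibre n w \<Longrightarrow> lift n (ball w r) (\<lambda>x. x) (\<phi> y)" "\<And>y. y \<in> fibre n w \<Longrightarrow> \<phi> y w = y"
    "\<And>v. v \<in> ball w r \<Longrightarrow> bij_betw (\<lambda>y. \<phi> y v) (fibre n w) (fibre n v)"
    using fibre_lifts[OF r] by blast
  have wb: "w \<in> ball w r" using r by simp
  have d: "((\<lambda>v. h (\<phi> y v)) has_derivative (\<lambda>v. pull n h' y \<bullet> v)) (at w)" if y: "y \<in> fibre n w" for y
  proof -
    have "(\<phi> y has_derivative (\<lambda>v. inverse (deriv (g ^^ n) (\<phi> y w)) * v)) (at w)"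
      using deriv_lift[OF \<phi>(1)[OF y] open_ball wb] by (simp add: has_field_derivative_def)
    then have "((\<lambda>v. h (\<phi> y v)) has_derivative (\<lambda>v. h' (\<phi> y w) \<bullet> (inverse (deriv (g ^^ n) (\<phi> y w)) * v))) (at w)"
      using has_derivative_compose[OF _ h] by blast
    then show ?thesis using \<phi>(2)[OF y] by (simp add: inner_complex_def algebra_simps)
  qed
  have "((\<lambda>v. \<Sum>y\<in>fibre n w. h (\<phi> y v)) has_derivative (\<lambda>v. \<Sum>y\<in>fibre n w. pull n h' y \<bullet> v)) (at w)"
    by (rule has_derivative_sum) (rule d)
  then have "((\<lambda>v. \<Sum>y\<in>fibre n w. h (\<phi> y v)) has_derivative (\<lambda>v. fibre_sum n (pull n h') w \<bullet> v)) (at w)"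
    by (simp only: fibre_sum_def inner_sum_left)
  then show ?thesis
    by (rule has_derivative_transform_within_open[OF _ open_ball wb]) (rule fibre_sum_lifts[OF \<phi>(3), symmetric])
qed

lemma fibre_sum_continuous:
  assumes h': "continuous_on UNIV h'" and w: "w \<in> Om 0"
  shows "isCont (fibre_sum n (pull n h')) w"
proof -
  obtain r where r: "0 < r" "ball w r \<subseteq> Om 0" using Om_open w by (rule openE)
  obtain \<phi> where \<phi>: "\<And>y. y \<in> fibre n w \<Longrightarrow> lift n (ball w r) (\<lambda>x. x) (\<phi> y)" "\<And>y. y \<in> fibre n w \<Longrightarrow> \<phi> y w = y"
    "\<And>v. v \<in> ball w r \<Longrightarrow> bij_betw (\<lambda>y. \<phi> y v) (fibre n w) (fibre n v)"
    using fibre_lifts[OF r] by blast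
  have wb: "w \<in> ball w r" using r by simp
  have c: "continuous_on (ball w r) (\<lambda>v. pull n h' (\<phi> y v))" if y: "y \<in> fibre n w" for y
  proof -
    have c1: "continuous_on (ball w r) (\<phi> y)" using liftD(2)[OF \<phi>(1)[OF y]] .
    have "continuous_on (Om n) (deriv (g ^^ n))"
      using holomorphic_on_imp_continuous_on[OF holomorphic_deriv[OF iterate_hol[of n 0] U_open]]
      by (rule continuous_on_subset) (auto simp: Om_def)
    then have c2: "continuous_on (ball w r) (\<lambda>v. deriv (g ^^ n) (\<phi> y v))"
      by (rule continuous_on_compose2[OF _ c1]) (use liftD(3)[OF \<phi>(1)[OF y]] in auto)
    have c3: "continuous_on (ball w r) (\<lambda>v. h' (\<phi> y v))"
      by (rule continuous_on_compose2[OF h' c1]) simp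
    have "deriv (g ^^ n) (\<phi> y v) \<noteq> 0" if "v \<in> ball w r" for v
      using liftD(3)[OF \<phi>(1)[OF y] that] iterate_deriv[of _ n 0] by (simp add: Om_def)
    then show ?thesis by (intro continuous_intros c2 c3) auto
  qed
  have "continuous_on (ball w r) (\<lambda>v. \<Sum>y\<in>fibre n w. pull n h' (\<phi> y v))" by (intro continuous_on_sum c)
  then have "continuous_on (ball w r) (fibre_sum n (pull n h'))"
    by (rule continuous_on_eq) (rule fibre_sum_lifts[OF \<phi>(3), symmetric])
  then show ?thesis using wb by (simp add: continuous_on_eq_continuous_at)
qed

text \<open>Over a small piece \<open>P\<close> the integrand sums the Jacobians of the branches
  where they take values in \<open>V\<close>. The branches have disjoint images, so the integral is
  the area of the part of \<open>V\<close> lying over \<open>P\<close>; pieces that partition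
  \<open>Om 0\<close> give disjoint parts of \<open>V\<close>.\<close>

lemma fibre_sum_energy:
  assumes V: "V \<in> sets borel" "bounded V"
  shows "(\<lambda>w. indicator (Om 0) w * fibre_sum n (\<lambda>y. indicator V y * ennreal ((norm (inverse (deriv (g ^^ n) y)))\<^sup>2)) w) \<in> borel_measurable lborel" (is ?meas)
    and "(\<integral>\<^sup>+w. indicator (Om 0) w * fibre_sum n (\<lambda>y. indicator V y * ennreal ((norm (inverse (deriv (g ^^ n) y)))\<^sup>2)) w \<partial>lborel) \<le> emeasure lborel V" (is ?le)
proof -
  define e where "e = (\<lambda>y. indicator V y * ennreal ((norm (inverse (deriv (g ^^ n) y)))\<^sup>2))"
  define M where "M = (\<lambda>P. {y\<in>Om n. (g ^^ n) y \<in> P} \<inter> V)"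
  have contn: "continuous_on (Om n) (g ^^ n)"
    using holomorphic_on_imp_continuous_on[OF iterate_hol[of n 0]] by (rule continuous_on_subset) (auto simp: Om_def)
  have Mset: "M P \<in> sets borel" if "P \<in> sets borel" for P
  proof -
    have "(\<lambda>y. indicator (Om n) y *\<^sub>R (g ^^ n) y) \<in> borel_measurable borel"
      by (rule borel_measurable_continuous_on_indicator[OF _ contn]) (use Om_open in auto)
    then have "(\<lambda>y. indicator (Om n) y *\<^sub>R (g ^^ n) y) -` P \<inter> space borel \<in> sets borel" using that by (rule measurable_sets)
    moreover have "M P = ((\<lambda>y. indicator (Om n) y *\<^sub>R (g ^^ n) y) -` P \<inter> space borel) \<inter> Om n \<inter> V" by (auto simp: M_def)
    ultimately show ?thesis using V(1) Om_open[of n] by (auto intro!: sets.Int)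
  qed
  have local: "(\<lambda>v. indicator P v * fibre_sum n e v) \<in> borel_measurable lborel \<and> (\<integral>\<^sup>+v. indicator P v * fibre_sum n e v \<partial>lborel) = emeasure lborel (M P)"
    if r: "0 < r" "ball w r \<subseteq> Om 0" and P: "P \<in> sets borel" "P \<subseteq> ball w r" for P w r
  proof -
    have wO: "w \<in> Om 0" using r by auto
    obtain \<phi> where \<phi>: "\<And>y. y \<in> fibre n w \<Longrightarrow> lift n (ball w r) (\<lambda>x. x) (\<phi> y)" "\<And>y. y \<in> fibre n w \<Longrightarrow> \<phi> y w = y"
      "\<And>v. v \<in> ball w r \<Longrightarrow> bij_betw (\<lambda>y. \<phi> y v) (fibre n w) (fibre n v)"
      using fibre_lifts[OF r] by blast
    define Q where "Q = (\<lambda>y. {v\<in>P. \<phi> y v \<in> V})"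
    have fin: "finite (fibre n w)" by (rule finite_fibre[OF wO])
    have Qset: "Q y \<in> sets borel" if y: "y \<in> fibre n w" for y
    proof -
      have "(\<lambda>v. indicator (ball w r) v *\<^sub>R \<phi> y v) \<in> borel_measurable borel"
        by (rule borel_measurable_continuous_on_indicator[OF _ liftD(2)[OF \<phi>(1)[OF y]]]) simp
      then have "(\<lambda>v. indicator (ball w r) v *\<^sub>R \<phi> y v) -` V \<inter> space borel \<in> sets borel" using V(1) by (rule measurable_sets)
      moreover have "Q y = ((\<lambda>v. indicator (ball w r) v *\<^sub>R \<phi> y v) -` V \<inter> space borel) \<inter> P"
        using P(2) by (auto simp: Q_def indicator_def)
      ultimately show ?thesis using P(1) by auto
    qed
    have Qsub: "Q y \<subseteq> ball w r" "\<phi> y ` Q y \<subseteq> V" for y using P(2) by (auto simp: Q_def)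
    have inj: "inj_on (\<phi> y) (ball w r)" if y: "y \<in> fibre n w" for y
      using liftD(4)[OF \<phi>(1)[OF y]] by (metis inj_onI)
    have im: "\<phi> y ` Q y \<in> sets borel"
      "(\<integral>\<^sup>+v. indicator (Q y) v * ennreal ((norm (deriv (\<phi> y) v))\<^sup>2) \<partial>lborel) = emeasure lborel (\<phi> y ` Q y)"
      if y: "y \<in> fibre n w" for y
      using nn_integral_holomorphic_image[OF open_ball liftD(1)[OF \<phi>(1)[OF y]] inj[OF y] Qset[OF y] Qsub(1) bounded_subset[OF V(2) Qsub(2)]]
      by auto
    have meas: "(\<lambda>v. indicator (Q y) v * ennreal ((norm (deriv (\<phi> y) v))\<^sup>2)) \<in> borel_measurable lborel" if y: "y \<in> fibre n w" for y
    proof -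
      have "continuous_on (ball w r) (deriv (\<phi> y))"
        by (rule holomorphic_on_imp_continuous_on[OF holomorphic_deriv[OF liftD(1)[OF \<phi>(1)[OF y]] open_ball]])
      then have "continuous_on (Q y) (deriv (\<phi> y))" using Qsub(1) by (rule continuous_on_subset)
      then have "(\<lambda>v. indicator (Q y) v *\<^sub>R deriv (\<phi> y) v) \<in> borel_measurable borel"
        by (intro borel_measurable_continuous_on_indicator) (use Qset[OF y] in auto)
      then have "(\<lambda>v. ennreal ((norm (indicator (Q y) v *\<^sub>R deriv (\<phi> y) v))\<^sup>2)) \<in> borel_measurable borel" by measurable
      moreover have "(\<lambda>v. ennreal ((norm (indicator (Q y) v *\<^sub>R deriv (\<phi> y) v))\<^sup>2)) = (\<lambda>v. indicator (Q y) v * ennreal ((norm (deriv (\<phi> y) v))\<^sup>2))"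
        by (auto simp: indicator_def fun_eq_iff)
      ultimately show ?thesis by (simp only: measurable_lborel2)
    qed
    have eq: "indicator P v * fibre_sum n e v = (\<Sum>y\<in>fibre n w. indicator (Q y) v * ennreal ((norm (deriv (\<phi> y) v))\<^sup>2))" for v
    proof (cases "v \<in> P")
      case True
      then have v: "v \<in> ball w r" using P(2) by blast
      have "fibre_sum n e v = (\<Sum>y\<in>fibre n w. e (\<phi> y v))" by (rule fibre_sum_lifts[OF \<phi>(3) v])
      also have "\<dots> = (\<Sum>y\<in>fibre n w. indicator (Q y) v * ennreal ((norm (deriv (\<phi> y) v))\<^sup>2))"
      proof (rule sum.cong[OF refl])
        fix y assume y: "y \<in> fibre n w"
        have "deriv (\<phi> y) v = inverse (deriv (g ^^ n) (\<phi> y v))"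
          by (rule DERIV_imp_deriv[OF deriv_lift[OF \<phi>(1)[OF y] open_ball v]])
        then show "e (\<phi> y v) = indicator (Q y) v * ennreal ((norm (deriv (\<phi> y) v))\<^sup>2)"
          using True by (simp add: e_def Q_def indicator_def)
      qed
      finally show ?thesis using True by simp
    next
      case False
      then show ?thesis by (simp add: Q_def)
    qed
    have MP: "M P = (\<Union>y\<in>fibre n w. \<phi> y ` Q y)"
    proof (intro equalityI subsetI)
      fix x assume x: "x \<in> M P"
      then have v: "(g ^^ n) x \<in> ball w r" "x \<in> fibre n ((g ^^ n) x)" using P(2) by (auto simp: M_def fibre_def Om_def)
      obtain y where y: "y \<in> fibre n w" "x = \<phi> y ((g ^^ n) x)"
        using \<phi>(3)[OF v(1)] v(2) unfolding bij_betw_def by blast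
      then have "(g ^^ n) x \<in> Q y" using x by (simp add: M_def Q_def)
      then show "x \<in> (\<Union>y\<in>fibre n w. \<phi> y ` Q y)" using y by blast
    next
      fix x assume "x \<in> (\<Union>y\<in>fibre n w. \<phi> y ` Q y)"
      then obtain y v where y: "y \<in> fibre n w" "v \<in> P" "x = \<phi> y v" "x \<in> V" by (auto simp: Q_def)
      then have v: "v \<in> ball w r" using P(2) by blast
      show "x \<in> M P" using liftD(3,4)[OF \<phi>(1)[OF y(1)] v] y by (simp add: M_def)
    qed
    have disj: "disjoint_family_on (\<lambda>y. \<phi> y ` Q y) (fibre n w)"
    proof (unfold disjoint_family_on_def, intro ballI impI)
      fix x y assume xy: "x \<in> fibre n w" "y \<in> fibre n w" "x \<noteq> y"
      show "\<phi> x ` Q x \<inter> \<phi> y ` Q y = {}"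
      proof (rule ccontr)
        assume "\<phi> x ` Q x \<inter> \<phi> y ` Q y \<noteq> {}"
        then obtain u v where uv: "u \<in> Q x" "v \<in> Q y" "\<phi> x u = \<phi> y v" by blast
        have b: "u \<in> ball w r" "v \<in> ball w r" using uv subsetD[OF Qsub(1)] by metis+
        have "u = v" using liftD(4)[OF \<phi>(1)[OF xy(1)] b(1)] liftD(4)[OF \<phi>(1)[OF xy(2)] b(2)] uv(3) by simp
        then show False using \<phi>(3)[OF b(1)] xy uv(3) unfolding bij_betw_def inj_on_def by blast
      qed
    qed
    have "(\<integral>\<^sup>+v. indicator P v * fibre_sum n e v \<partial>lborel) = (\<Sum>y\<in>fibre n w. \<integral>\<^sup>+v. indicator (Q y) v * ennreal ((norm (deriv (\<phi> y) v))\<^sup>2) \<partial>lborel)"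
      unfolding eq by (rule nn_integral_sum) (rule meas)
    also have "\<dots> = (\<Sum>y\<in>fibre n w. emeasure lborel (\<phi> y ` Q y))" by (rule sum.cong[OF refl]) (rule im(2))
    also have "\<dots> = emeasure lborel (\<Union>y\<in>fibre n w. \<phi> y ` Q y)"
      by (rule sum_emeasure[OF _ disj fin]) (use im(1) in auto)
    finally have "(\<integral>\<^sup>+v. indicator P v * fibre_sum n e v \<partial>lborel) = emeasure lborel (M P)" by (simp only: MP)
    moreover have "(\<lambda>v. indicator P v * fibre_sum n e v) \<in> borel_measurable lborel"
      unfolding eq by (rule borel_measurable_sum) (rule meas)
    ultimately show ?thesis by blast
  qed
  \<comment> \<open>Branches exist on discs only; Lindelof's theorem selects countably many, which
    are then made disjoint.\<close>
  define \<B> where "\<B> = {ball w r |w r. 0 < r \<and> ball w r \<subseteq> Om 0}"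
  have "\<And>S. S \<in> \<B> \<Longrightarrow> open S" by (auto simp: \<B>_def)
  then obtain \<C> where \<C>: "\<C> \<subseteq> \<B>" "countable \<C>" "\<Union>\<C> = \<Union>\<B>" by (rule Lindelof)
  have UB: "\<Union>\<B> = Om 0"
  proof (intro equalityI subsetI)
    fix w assume "w \<in> Om 0"
    then obtain r where "0 < r" "ball w r \<subseteq> Om 0" using Om_open openE by blast
    then have "ball w r \<in> \<B>" "w \<in> ball w r" by (auto simp: \<B>_def)
    then show "w \<in> \<Union>\<B>" by blast
  qed (auto simp: \<B>_def)
  have "?meas \<and> ?le"
  proof (cases "\<C> = {}")
    case True
    then have "Om 0 = {}" using \<C>(3) UB by simp
    then show ?thesis by simp
  next
    case False
    define B where "B = from_nat_into \<C>"
    have B: "B i \<in> \<B>" for i unfolding B_def using from_nat_into[OF False] \<C>(1) by blast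
    have UB': "(\<Union>i. B i) = Om 0"
      using range_from_nat_into[OF False \<C>(2)] \<C>(3) UB by (simp add: B_def)
    define P where "P = disjointed B"
    have "B i \<in> sets borel" for i
    proof -
      obtain w r where "B i = ball w r" using B[of i] unfolding \<B>_def by blast
      then show ?thesis by simp
    qed
    then have Bset: "range B \<subseteq> sets borel" by blast
    have Pset: "P i \<in> sets borel" for i using sets.range_disjointed_sets[OF Bset] by (auto simp: P_def)
    have Psub: "P i \<subseteq> B i" for i unfolding P_def by (rule disjointed_subset)
    have Pdis: "disjoint_family P" unfolding P_def by (rule disjoint_family_disjointed)
    have PU: "(\<Union>i. P i) = Om 0" using UN_disjointed_eq[of B] UB' by (simp add: P_def)
    have loc: "(\<lambda>v. indicator (P i) v * fibre_sum n e v) \<in> borel_measurable lborel \<and> (\<integral>\<^sup>+v. indicator (P i) v * fibre_sum n e v \<partial>lborel) = emeasure lborel (M (P i))" for i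
    proof -
      obtain w r where wr: "0 < r" "ball w r \<subseteq> Om 0" "B i = ball w r" using B[of i] unfolding \<B>_def by blast
      show ?thesis by (rule local[OF wr(1,2) Pset]) (use Psub[of i] wr(3) in simp)
    qed
    have ind: "indicator (Om 0) v * fibre_sum n e v = (\<Sum>i. indicator (P i) v * fibre_sum n e v)" for v
      using suminf_indicator[OF Pdis, of v] PU by simp
    have "(\<integral>\<^sup>+v. indicator (Om 0) v * fibre_sum n e v \<partial>lborel) = (\<Sum>i. \<integral>\<^sup>+v. indicator (P i) v * fibre_sum n e v \<partial>lborel)"
      unfolding ind by (rule nn_integral_suminf) (use loc in blast)
    also have "\<dots> = (\<Sum>i. emeasure lborel (M (P i)))" using loc by simp
    also have "\<dots> = emeasure lborel (\<Union>i. M (P i))"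
    proof (rule suminf_emeasure)
      show "range (\<lambda>i. M (P i)) \<subseteq> sets lborel" using Mset Pset by auto
      show "disjoint_family (\<lambda>i. M (P i))" using Pdis by (auto simp: disjoint_family_on_def M_def)
    qed
    also have "\<dots> \<le> emeasure lborel V" by (rule emeasure_mono) (use V(1) in \<open>auto simp: M_def\<close>)
    finally have le: "(\<integral>\<^sup>+v. indicator (Om 0) v * fibre_sum n e v \<partial>lborel) \<le> emeasure lborel V" .
    have "(\<lambda>v. indicator (Om 0) v * fibre_sum n e v) \<in> borel_measurable lborel"
      unfolding ind by (rule borel_measurable_suminf_order) (use loc in blast)
    then show ?thesis using le unfolding e_def by (rule conjI)
  qed
  then show ?meas ?le by auto
qed

text \<open>\<open>C\<close> may reach outside \<open>U n\<close>, so it is cut down to the part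
  over a compact neighbourhood \<open>D\<close> of \<open>K\<close>, compact by properness. The
  image of this part is compact and misses \<open>K\<close>, hence stays at a positive distance from
  it.\<close>

lemma fibre_avoids_near_K:
  assumes C: "compact C" "C \<inter> K = {}"
  obtains \<eta> where "0 < \<eta>" "\<And>x \<zeta>. \<lbrakk>x \<in> K; dist x \<zeta> < \<eta>\<rbrakk> \<Longrightarrow> fibre n \<zeta> \<inter> C = {}"
proof -
  obtain s where s: "0 < s" "(\<Union>x\<in>K. cball x s) \<subseteq> U 0"
    using compact_subset_open_imp_cball_epsilon_subset[OF compact_K U_open K_U] by blast
  define D where "D = (\<Union>x\<in>K. cball x s)"
  have D: "compact D" unfolding D_def by (rule compact_minkowski_sum_cball[OF compact_K])
  have DU: "D \<subseteq> U 0" using s(2) by (simp add: D_def)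
  have pre: "compact {x\<in>U n. (g ^^ n) x \<in> D}" using iterate_proper[OF D DU, of n] by simp
  define T where "T = (g ^^ n) ` ({x\<in>U n. (g ^^ n) x \<in> D} \<inter> C)"
  have "compact T" unfolding T_def
  proof (rule compact_continuous_image)
    show "continuous_on ({x\<in>U n. (g ^^ n) x \<in> D} \<inter> C) (g ^^ n)"
      using holomorphic_on_imp_continuous_on[OF iterate_hol[of n 0]] by (rule continuous_on_subset) auto
    show "compact ({x\<in>U n. (g ^^ n) x \<in> D} \<inter> C)" using pre C(1) by (rule compact_Int)
  qed
  then have "open (- T)" by (simp add: compact_imp_closed open_Compl)
  moreover have "K \<subseteq> - T" using iterate_K[of _ n 0] C(2) by (auto simp: T_def)
  ultimately obtain t where t: "0 < t" "(\<Union>x\<in>K. cball x t) \<subseteq> - T"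
    using compact_subset_open_imp_cball_epsilon_subset[OF compact_K] by blast
  show ?thesis
  proof (rule that[of "min s t"])
    show "0 < min s t" using s t by simp
    fix x \<zeta> assume x: "x \<in> K" "dist x \<zeta> < min s t"
    have "\<zeta> \<in> cball x s" "\<zeta> \<in> cball x t" using x(2) by auto
    then have "\<zeta> \<in> D" "\<zeta> \<in> (\<Union>x\<in>K. cball x t)" using x(1) by (auto simp only: D_def)
    then have \<zeta>: "\<zeta> \<in> D" "\<zeta> \<notin> T" using subsetD[OF t(2)] by blast+
    show "fibre n \<zeta> \<inter> C = {}"
    proof (rule ccontr)
      assume "fibre n \<zeta> \<inter> C \<noteq> {}"
      then obtain y where "y \<in> U n" "(g ^^ n) y = \<zeta>" "y \<in> C" by (auto simp: fibre_def)
      then have "\<zeta> \<in> T" using \<zeta>(1) unfolding T_def by blast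
      then show False using \<zeta>(2) by simp
    qed
  qed
qed

text \<open>\<open>J\<close> is sqrt (1 + F), where F sums a bump \<open>h\<close> over the fibre.
  By Cauchy-Schwarz |grad F|^2 is at most 16 \<rho>^2 F times the sum of the squared branch
  derivatives over the preimages in the disc; the square root divides this by 4 (1 + F), so the
  energy bound does not depend on the number of preimages.\<close>

lemma counting_function:
  assumes \<rho>: "0 < \<rho>" "cball z \<rho> \<inter> K = {}"
  obtains J :: "complex \<Rightarrow> real" and G \<eta>
  where "\<And>\<zeta>. \<zeta> \<in> U 0 \<Longrightarrow> (J has_derivative (\<lambda>v. G \<zeta> \<bullet> v)) (at \<zeta>)" "continuous_on (U 0) G"
    "(\<integral>\<^sup>+\<zeta>. indicator (U 0) \<zeta> * ennreal ((norm (G \<zeta>))\<^sup>2) \<partial>lborel) \<le> ennreal (4 * \<rho>\<^sup>2 * measure lborel (ball z \<rho>))"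
    "0 < \<eta>" "\<And>x \<zeta>. \<lbrakk>x \<in> K; dist x \<zeta> < \<eta>\<rbrakk> \<Longrightarrow> J \<zeta> = 1"
    "\<And>w Y. \<lbrakk>w \<in> Om 0; Y \<subseteq> fibre n w; Y \<subseteq> ball z (\<rho> / 2)\<rbrakk> \<Longrightarrow> sqrt (1 + real (card Y) * (3 * \<rho>\<^sup>2 / 4)\<^sup>2) \<le> J w"
proof -
  \<comment> \<open>The bump h = s^2 is supported in the closed disc of radius \<rho> and satisfies
    |grad h| <= 4 \<rho> sqrt h; this inequality is what the energy estimate rests on.\<close>
  define s where "s = (\<lambda>y::complex. max 0 (\<rho>\<^sup>2 - (norm (y - z))\<^sup>2))"
  define h where "h = (\<lambda>y. (s y)\<^sup>2)"
  define h' where "h' = (\<lambda>y::complex. (- 4 * s y) *\<^sub>R (y - z))"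
  define F where "F = fibre_sum n h"
  define Gr where "Gr = fibre_sum n (pull n h')"
  define J where "J = (\<lambda>w. sqrt (1 + F w))"
  define G where "G = (\<lambda>w. (inverse (2 * sqrt (1 + F w))) *\<^sub>R Gr w)"
  have s0: "0 \<le> s y" for y by (simp add: s_def)
  have sout: "s y = 0" if "y \<notin> ball z \<rho>" for y
  proof -
    have "\<rho> \<le> norm (y - z)" using that by (simp add: dist_norm norm_minus_commute)
    then have "\<rho>\<^sup>2 \<le> (norm (y - z))\<^sup>2" using \<rho>(1) by (intro power_mono) auto
    then show ?thesis by (simp add: s_def)
  qed
  have F0: "0 \<le> F w" for w unfolding F_def fibre_sum_def h_def by (intro sum_nonneg) simp
  \<comment> \<open>Squaring removes the corner of the positive part at 0, so \<open>h\<close> is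
    differentiable everywhere.\<close>
  have sq: "((\<lambda>t::real. (max 0 t)\<^sup>2) has_real_derivative 2 * max 0 t) (at t)" for t
  proof (cases "t = 0")
    case True
    have "((\<lambda>x::real. (max 0 x)\<^sup>2) has_real_derivative 0) (at 0)"
      unfolding has_field_derivative_def
    proof (rule has_derivativeI_sandwich[of 1])
      fix x :: real assume "x \<noteq> 0"
      then show "norm ((max 0 x)\<^sup>2 - (max 0 0)\<^sup>2 - 0 * (x - 0)) / norm (x - 0) \<le> norm x"
        by (auto simp: max_def power2_eq_square divide_simps)
    next
      show "((\<lambda>x::real. norm x) \<longlongrightarrow> 0) (at 0)" by (intro tendsto_eq_intros) auto
    qed (auto intro: bounded_linear_intros)
    then show ?thesis using True by simp
  next
    case False
    then consider "0 < t" | "t < 0" by linarith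
    then show ?thesis
    proof cases
      case 1
      have "((\<lambda>t::real. t\<^sup>2) has_real_derivative 2 * t) (at t)" by (auto intro!: derivative_eq_intros)
      then show ?thesis
        by (subst max_absorb2) (use 1 in \<open>auto intro: has_field_derivative_transform_within_open[of _ _ _ "{0<..}"]\<close>)
    next
      case 2
      have "((\<lambda>t::real. 0) has_real_derivative 0) (at t)" by simp
      then have "((\<lambda>t::real. (max 0 t)\<^sup>2) has_real_derivative 0) (at t)"
        by (rule has_field_derivative_transform_within_open[of _ _ _ "{..<0}"]) (use 2 in auto)
      then show ?thesis using 2 by simp
    qed
  qed
  have hd: "(h has_derivative (\<lambda>v. h' y \<bullet> v)) (at y)" for y
  proof -
    have "((\<lambda>y. \<rho>\<^sup>2 - (y - z) \<bullet> (y - z)) has_derivative (\<lambda>v. - 2 * ((y - z) \<bullet> v))) (at y)"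
      by (auto intro!: derivative_eq_intros simp: inner_commute)
    then have 1: "((\<lambda>y. \<rho>\<^sup>2 - (norm (y - z))\<^sup>2) has_derivative (\<lambda>v. - 2 * ((y - z) \<bullet> v))) (at y)"
      by (simp only: power2_norm_eq_inner)
    have 2: "((\<lambda>t::real. (max 0 t)\<^sup>2) has_derivative (\<lambda>u. 2 * s y * u)) (at (\<rho>\<^sup>2 - (norm (y - z))\<^sup>2))"
      using sq[of "\<rho>\<^sup>2 - (norm (y - z))\<^sup>2"] by (simp only: has_field_derivative_def s_def)
    have "((\<lambda>y. (max 0 (\<rho>\<^sup>2 - (norm (y - z))\<^sup>2))\<^sup>2) has_derivative (\<lambda>v. 2 * s y * (- 2 * ((y - z) \<bullet> v)))) (at y)"
      by (rule has_derivative_compose[OF 1 2])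
    then show ?thesis by (simp add: h_def s_def[abs_def] h'_def algebra_simps)
  qed
  have h'c: "continuous_on UNIV h'" unfolding h'_def s_def by (intro continuous_intros)
  obtain \<eta> where \<eta>: "0 < \<eta>" "\<And>x \<zeta>. \<lbrakk>x \<in> K; dist x \<zeta> < \<eta>\<rbrakk> \<Longrightarrow> fibre n \<zeta> \<inter> cball z \<rho> = {}"
    by (rule fibre_avoids_near_K[OF compact_cball \<rho>(2), where n = n]) (rule that; assumption)
  have near: "F \<zeta> = 0 \<and> Gr \<zeta> = 0" if "x \<in> K" "dist x \<zeta> < \<eta>" for x \<zeta>
  proof -
    have "s y = 0" if "y \<in> fibre n \<zeta>" for y
    proof (rule sout)
      show "y \<notin> ball z \<rho>" using \<eta>(2)[OF \<open>x \<in> K\<close> \<open>dist x \<zeta> < \<eta>\<close>] that ball_subset_cball[of z \<rho>] by blast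
    qed
    then show ?thesis by (simp add: F_def Gr_def fibre_sum_def h_def h'_def)
  qed
  \<comment> \<open>Inverse branches are available over \<open>Om 0\<close> only. At points of
    \<open>K\<close> differentiability holds because F vanishes nearby: preimages there avoid the
    support of the bump.\<close>
  have FG: "(F has_derivative (\<lambda>v. Gr w \<bullet> v)) (at w) \<and> isCont Gr w" if w: "w \<in> U 0" for w
  proof (cases "w \<in> K")
    case True
    have wb: "w \<in> ball w \<eta>" using \<eta>(1) by simp
    have "((\<lambda>_. 0) has_derivative (\<lambda>v. 0 \<bullet> v)) (at w)" by simp
    then have "(F has_derivative (\<lambda>v. 0 \<bullet> v)) (at w)"
      by (rule has_derivative_transform_within_open[OF _ open_ball wb]) (use near[OF True] in simp)
    moreover have "Gr w = 0" using near[OF True, of w] \<eta>(1) by simp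
    moreover have "continuous_on (ball w \<eta>) Gr"
      by (rule continuous_on_eq[OF continuous_on_const[of _ 0]]) (use near[OF True] in simp)
    ultimately show ?thesis using wb by (simp add: continuous_on_eq_continuous_at)
  next
    case False
    then have "w \<in> Om 0" using w by (simp add: Om_def)
    then show ?thesis unfolding F_def Gr_def using fibre_sum_derivative[OF hd] fibre_sum_continuous[OF h'c] by blast
  qed
  have Jd: "(J has_derivative (\<lambda>v. G w \<bullet> v)) (at w)" if w: "w \<in> U 0" for w
  proof -
    have "((\<lambda>w. sqrt (1 + F w)) has_derivative (\<lambda>v. inverse (sqrt (1 + F w)) / 2 * (0 + Gr w \<bullet> v))) (at w)"
      using F0[of w] FG[OF w] by (auto intro!: derivative_eq_intros simp: divide_simps)
    then show ?thesis by (simp add: J_def[abs_def] G_def field_simps)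
  qed
  have Gc: "continuous_on (U 0) G"
  proof (rule continuous_at_imp_continuous_on, intro ballI)
    fix w assume w: "w \<in> U 0"
    have "isCont F w" using FG[OF w] has_derivative_continuous by blast
    moreover have "sqrt (1 + F w) \<noteq> 0" using F0[of w] by simp
    ultimately show "isCont G w" unfolding G_def using FG[OF w] by (intro continuous_intros) auto
  qed
  define e where "e = (\<lambda>y. indicator (ball z \<rho>) y * ennreal ((norm (inverse (deriv (g ^^ n) y)))\<^sup>2))"
  have bound: "indicator (U 0) w * ennreal ((norm (G w))\<^sup>2) \<le> ennreal (4 * \<rho>\<^sup>2) * (indicator (Om 0) w * fibre_sum n e w)" for w
  proof (cases "w \<in> Om 0")
    case True
    define D where "D = (\<lambda>y. norm (inverse (deriv (g ^^ n) y)))"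
    have D0: "0 \<le> D y" for y by (simp add: D_def)
    define I where "I = (\<lambda>y. indicator (ball z \<rho>) y :: real)"
    have summand: "norm (pull n h' y) \<le> (4 * \<rho>) * ((I y * D y) * s y)" for y
    proof (cases "y \<in> ball z \<rho>")
      case True
      then have "norm (y - z) \<le> \<rho>" by (simp add: dist_norm norm_minus_commute)
      then have "D y * (4 * s y * norm (y - z)) \<le> D y * (4 * s y * \<rho>)" using s0 D0 by (intro mult_left_mono) auto
      moreover have "norm (pull n h' y) = D y * (4 * s y * norm (y - z))" using s0[of y] by (simp add: D_def h'_def norm_mult norm_inverse)
      ultimately show ?thesis using True by (simp add: I_def algebra_simps)
    next
      case False
      then show ?thesis using sout[of y] by (simp add: h'_def)
    qed
    have "norm (Gr w) \<le> (\<Sum>y\<in>fibre n w. norm (pull n h' y))" unfolding Gr_def fibre_sum_def by (rule norm_sum)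
    also have "\<dots> \<le> (\<Sum>y\<in>fibre n w. (4 * \<rho>) * ((I y * D y) * s y))" by (rule sum_mono) (rule summand)
    also have "\<dots> = (4 * \<rho>) * (\<Sum>y\<in>fibre n w. (I y * D y) * s y)" by (simp add: sum_distrib_left)
    finally have "(norm (Gr w))\<^sup>2 \<le> ((4 * \<rho>) * (\<Sum>y\<in>fibre n w. (I y * D y) * s y))\<^sup>2" by (rule power_mono) simp
    also have "\<dots> = (4 * \<rho>)\<^sup>2 * (\<Sum>y\<in>fibre n w. (I y * D y) * s y)\<^sup>2" by (simp only: power_mult_distrib)
    also have "\<dots> \<le> (4 * \<rho>)\<^sup>2 * ((\<Sum>y\<in>fibre n w. (I y * D y)\<^sup>2) * (\<Sum>y\<in>fibre n w. (s y)\<^sup>2))"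
      by (intro mult_left_mono Cauchy_Schwarz_ineq_sum) simp
    also have "(\<Sum>y\<in>fibre n w. (s y)\<^sup>2) = F w" by (simp add: F_def fibre_sum_def h_def)
    finally have Gr: "(norm (Gr w))\<^sup>2 \<le> (4 * \<rho>)\<^sup>2 * ((\<Sum>y\<in>fibre n w. (I y * D y)\<^sup>2) * F w)" .
    define \<Sigma> where "\<Sigma> = (\<Sum>y\<in>fibre n w. (I y * D y)\<^sup>2)"
    have \<Sigma>0: "0 \<le> \<Sigma>" unfolding \<Sigma>_def by (intro sum_nonneg) simp
    have "(norm (G w))\<^sup>2 = (norm (Gr w))\<^sup>2 / (4 * (1 + F w))"
      using F0[of w] by (simp add: G_def power_mult_distrib power_inverse divide_simps)
    also have "\<dots> \<le> ((4 * \<rho>)\<^sup>2 * (\<Sigma> * F w)) / (4 * (1 + F w))"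
      using Gr F0[of w] by (intro divide_right_mono) (auto simp: \<Sigma>_def)
    also have "\<dots> = 4 * \<rho>\<^sup>2 * \<Sigma> * (F w / (1 + F w))" using F0[of w] by (simp add: power_mult_distrib field_simps)
    also have "\<dots> \<le> 4 * \<rho>\<^sup>2 * \<Sigma> * 1" using F0[of w] \<Sigma>0 by (intro mult_left_mono) (auto simp: divide_simps)
    finally have le: "(norm (G w))\<^sup>2 \<le> 4 * \<rho>\<^sup>2 * \<Sigma>" by simp
    have "fibre_sum n e w = (\<Sum>y\<in>fibre n w. ennreal ((I y * D y)\<^sup>2))"
      unfolding fibre_sum_def by (rule sum.cong) (auto simp: e_def I_def D_def indicator_def)
    also have "\<dots> = ennreal \<Sigma>" unfolding \<Sigma>_def by (rule sum_ennreal) simp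
    finally have te: "fibre_sum n e w = ennreal \<Sigma>" .
    have "ennreal ((norm (G w))\<^sup>2) \<le> ennreal (4 * \<rho>\<^sup>2) * ennreal \<Sigma>"
      using le \<Sigma>0 by (simp add: ennreal_mult[symmetric] ennreal_leI)
    then show ?thesis using True te by (simp add: Om_def)
  next
    case False
    show ?thesis
    proof (cases "w \<in> U 0")
      case True
      then have "w \<in> K" using False by (simp add: Om_def)
      then have "G w = 0" using near[of w w] \<eta>(1) by (simp add: G_def)
      then show ?thesis by simp
    qed simp
  qed
  have m: "(\<lambda>w. indicator (Om 0) w * fibre_sum n e w) \<in> borel_measurable lborel"
    unfolding e_def by (rule fibre_sum_energy) auto
  have "(\<integral>\<^sup>+w. indicator (U 0) w * ennreal ((norm (G w))\<^sup>2) \<partial>lborel)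
      \<le> (\<integral>\<^sup>+w. ennreal (4 * \<rho>\<^sup>2) * (indicator (Om 0) w * fibre_sum n e w) \<partial>lborel)" by (rule nn_integral_mono) (rule bound)
  also have "\<dots> = ennreal (4 * \<rho>\<^sup>2) * (\<integral>\<^sup>+w. indicator (Om 0) w * fibre_sum n e w \<partial>lborel)" by (rule nn_integral_cmult[OF m])
  also have "\<dots> \<le> ennreal (4 * \<rho>\<^sup>2) * emeasure lborel (ball z \<rho>)"
    unfolding e_def by (intro mult_left_mono fibre_sum_energy) auto
  also have "\<dots> = ennreal (4 * \<rho>\<^sup>2 * measure lborel (ball z \<rho>))"
  proof -
    have "emeasure lborel (ball z \<rho>) = ennreal (measure lborel (ball z \<rho>))"
      by (rule emeasure_eq_ennreal_measure) (use emeasure_lborel_ball_finite[of z \<rho>] in simp)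
    then show ?thesis by (simp only: ennreal_mult[OF _ measure_nonneg, of "4 * \<rho>\<^sup>2"] mult_nonneg_nonneg zero_le_numeral zero_le_power2)
  qed
  finally have En: "(\<integral>\<^sup>+w. indicator (U 0) w * ennreal ((norm (G w))\<^sup>2) \<partial>lborel) \<le> ennreal (4 * \<rho>\<^sup>2 * measure lborel (ball z \<rho>))" .
  \<comment> \<open>On the disc of radius \<rho>/2 the function \<open>s\<close> is at least
    \<rho>^2 - (\<rho>/2)^2, so each point of \<open>Y\<close> adds at least the square of this
    number to F.\<close>
  have big: "sqrt (1 + real (card Y) * (3 * \<rho>\<^sup>2 / 4)\<^sup>2) \<le> J w" if "w \<in> Om 0" "Y \<subseteq> fibre n w" "Y \<subseteq> ball z (\<rho> / 2)" for w Y
  proof -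
    have "real (card Y) * (3 * \<rho>\<^sup>2 / 4)\<^sup>2 = (\<Sum>y\<in>Y. (3 * \<rho>\<^sup>2 / 4)\<^sup>2)" by simp
    also have "\<dots> \<le> (\<Sum>y\<in>Y. h y)"
    proof (rule sum_mono)
      fix y assume "y \<in> Y"
      then have "norm (y - z) \<le> \<rho> / 2" using that(3) by (force simp: dist_norm norm_minus_commute)
      then have "(norm (y - z))\<^sup>2 \<le> (\<rho> / 2)\<^sup>2" by (intro power_mono) auto
      moreover have "\<rho>\<^sup>2 - (norm (y - z))\<^sup>2 \<le> s y" by (simp add: s_def)
      ultimately have "3 * \<rho>\<^sup>2 / 4 \<le> s y" by (simp add: power_divide)
      then show "(3 * \<rho>\<^sup>2 / 4)\<^sup>2 \<le> h y" unfolding h_def by (intro power_mono) auto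
    qed
    also have "\<dots> \<le> F w" unfolding F_def fibre_sum_def
      by (rule sum_mono2[OF finite_fibre[OF that(1)] that(2)]) (simp add: h_def)
    finally show ?thesis by (simp add: J_def)
  qed
  have near1: "J \<zeta> = 1" if "x \<in> K" "dist x \<zeta> < \<eta>" for x \<zeta> using near[OF that] by (simp add: J_def)
  show ?thesis by (rule that[OF Jd Gc En \<eta>(1) near1 big])
qed

section \<open>Periodic points\<close>

text \<open>The branches given at \<open>p\<close> converge uniformly on the smaller disc, so one
  late index serves all \<open>w\<close> in it at once; uniqueness of lifts keeps the
  \<open>m\<close> values distinct over each \<open>w\<close>.\<close>

lemma many_germs_fibre:
  assumes m: "many_germs (\<lambda>_. z) n m p" and \<eta>: "0 < \<eta>" "ball p \<eta> \<subseteq> Om 0" and e: "0 < e"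
  obtains i where "\<And>w. w \<in> cball p (\<eta> / 2) \<Longrightarrow> \<exists>Y. Y \<subseteq> fibre (n i) w \<and> Y \<subseteq> ball z e \<and> card Y = m"
proof -
  have A: "(\<lambda>_::complex. z) holomorphic_on UNIV" by (rule holomorphic_on_const)
  have pb: "p \<in> ball p \<eta>" using \<eta>(1) by simp
  obtain y where y: "\<And>j. j < m \<Longrightarrow> germ (\<lambda>_. z) n p (y j)" "\<forall>\<^sub>F i in sequentially. inj_on (\<lambda>j. y j i) {..<m}"
    using m unfolding many_germs_def by blast
  define \<Phi> where "\<Phi> = (\<lambda>i j. SOME \<Phi>. lift (n i) (ball p \<eta>) (\<lambda>x. x) \<Phi> \<and> \<Phi> p = y j i)"
  have \<Phi>: "lift (n i) (ball p \<eta>) (\<lambda>x. x) (\<Phi> i j) \<and> \<Phi> i j p = y j i" if j: "j < m" for i j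
  proof -
    obtain \<Psi> where "lift (n i) (ball p \<eta>) (\<lambda>x. x) \<Psi>" "\<Psi> p = y j i"
      by (rule lift_exists[OF open_ball convex_imp_simply_connected[OF convex_ball] holomorphic_on_ident _ pb germ_value(1,2)[OF y(1)[OF j]]])
         (use \<eta>(2) in auto)
    then have "lift (n i) (ball p \<eta>) (\<lambda>x. x) \<Psi> \<and> \<Psi> p = y j i" by blast
    then show ?thesis unfolding \<Phi>_def by (rule someI[where P = "\<lambda>\<Phi>. lift (n i) (ball p \<eta>) (\<lambda>x. x) \<Phi> \<and> \<Phi> p = y j i"])
  qed
  have sub: "cball p (\<eta> / 2) \<subseteq> ball p \<eta>" using \<eta>(1) by auto
  have near: "\<forall>\<^sub>F i in sequentially. \<forall>x\<in>cball p (\<eta> / 2). dist (\<Phi> i j x) z < e" if j: "j < m" for j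
  proof (rule uniform_limit_near[OF germ_lift[OF open_ball connected_ball holomorphic_on_ident _ pb A y(1)[OF j] _ _ compact_cball sub] e])
    show "(\<lambda>x. x) ` ball p \<eta> \<subseteq> Om 0" using \<eta>(2) by simp
    show "lift (n i) (ball p \<eta>) (\<lambda>x. x) (\<Phi> i j)" "\<Phi> i j p = y j i" for i using \<Phi>[OF j] by auto
  qed
  have ev: "\<forall>\<^sub>F i in sequentially. \<forall>j\<in>{..<m}. \<forall>x\<in>cball p (\<eta> / 2). dist (\<Phi> i j x) z < e"
    by (rule eventually_ball_finite) (use near in auto)
  obtain i where "(\<forall>j\<in>{..<m}. \<forall>x\<in>cball p (\<eta> / 2). dist (\<Phi> i j x) z < e) \<and> inj_on (\<lambda>j. y j i) {..<m}"
    using eventually_happens'[OF sequentially_bot eventually_conj[OF ev y(2)]] by (rule exE)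
  then have inj: "inj_on (\<lambda>j. y j i) {..<m}" and i: "\<And>j x. j < m \<Longrightarrow> x \<in> cball p (\<eta> / 2) \<Longrightarrow> dist (\<Phi> i j x) z < e"
    by (simp_all del: mem_cball)
  show ?thesis
  proof (rule that)
    fix w assume w: "w \<in> cball p (\<eta> / 2)"
    then have wb: "w \<in> ball p \<eta>" using sub by blast
    define Y where "Y = (\<lambda>j. \<Phi> i j w) ` {..<m}"
    have "Y \<subseteq> fibre (n i) w"
    proof
      fix u assume "u \<in> Y"
      then obtain j where j: "j < m" "u = \<Phi> i j w" by (auto simp: Y_def)
      have l: "lift (n i) (ball p \<eta>) (\<lambda>x. x) (\<Phi> i j)" using \<Phi>[OF j(1)] by blast
      show "u \<in> fibre (n i) w" using liftD(3,4)[OF l wb] j(2) by (simp add: fibre_def Om_def)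
    qed
    moreover have "Y \<subseteq> ball z e" using i[OF _ w] by (auto simp: Y_def dist_commute)
    moreover have "inj_on (\<lambda>j. \<Phi> i j w) {..<m}"
    proof (rule inj_onI)
      fix j k assume jk: "j \<in> {..<m}" "k \<in> {..<m}" "\<Phi> i j w = \<Phi> i k w"
      have l: "lift (n i) (ball p \<eta>) (\<lambda>x. x) (\<Phi> i j)" "lift (n i) (ball p \<eta>) (\<lambda>x. x) (\<Phi> i k)" using \<Phi> jk(1,2) by auto
      have "\<Phi> i j p = \<Phi> i k p"
        by (rule lift_unique[OF l connected_ball wb jk(3) pb]) (use \<eta>(2) in \<open>auto intro: continuous_intros\<close>)
      then have "y j i = y k i" using \<Phi> jk(1,2) by simp
      then show "j = k" using inj_onD[OF inj] jk(1,2) by blast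
    qed
    then have "card Y = m" unfolding Y_def by (simp add: card_image)
    ultimately show "\<exists>Y. Y \<subseteq> fibre (n i) w \<and> Y \<subseteq> ball z e \<and> card Y = m" by blast
  qed
qed

text \<open>Once the disc is small, the walk loses the factor \<theta> = 1 - 1/d^2 per scale, with
  the Lipschitz constant of g o g as ratio of scales. The rate is sqrt \<theta> because the capacity
  estimate asks for even powers, and \<open>C\<close> absorbs the first \<open>k0\<close>
  scales.\<close>

lemma weights_decay:
  obtains L \<kappa> C where "1 < L" "0 < \<kappa>" "\<kappa> < 1" "0 \<le> C"
    "\<And>w k N \<zeta>. \<lbrakk>w \<in> K; k \<le> N\<rbrakk> \<Longrightarrow> (\<Sum>y\<in>{y\<in>backward w N. dist y \<zeta> < 2 * R / L ^ k}. wt N y) \<le> C * \<kappa> ^ (2 * k)"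
proof (cases "0 \<le> R")
  case R: True
  obtain r0 where r0: "0 < r0" "\<And>x w. \<lbrakk>x \<in> K; w \<in> K\<rbrakk> \<Longrightarrow> \<exists>y\<in>fib w. r0 \<le> dist x y" using fibres_spread by blast
  obtain L where L: "1 < L" "\<And>x y. \<lbrakk>x \<in> K; y \<in> K\<rbrakk> \<Longrightarrow> dist (g (g x)) (g (g y)) \<le> L * dist x y" using gg_Lipschitz by blast
  define \<theta> where "\<theta> = 1 - 1 / (real d * real d)"
  have "1 < real d * real d" using d2 by (intro less_1_mult) auto
  then have \<theta>: "0 < \<theta>" "\<theta> < 1" by (auto simp: \<theta>_def)
  obtain k0 where k0: "4 * R / r0 < L ^ k0" using real_arch_pow[OF L(1)] by blast
  define C where "C = inverse (\<theta> ^ k0)"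
  have \<theta>k: "sqrt \<theta> ^ (2 * k) = \<theta> ^ k" for k using \<theta> by (simp add: power_mult)
  show ?thesis
  proof (rule that[of L "sqrt \<theta>" C])
    show "1 < L" "0 < sqrt \<theta>" "sqrt \<theta> < 1" "0 \<le> C" using L \<theta> by (auto simp: C_def)
    fix w \<zeta> :: complex and k N :: nat assume w: "w \<in> K" and k: "k \<le> N"
    show "(\<Sum>y\<in>{y\<in>backward w N. dist y \<zeta> < 2 * R / L ^ k}. wt N y) \<le> C * sqrt \<theta> ^ (2 * k)"
    proof (cases "k0 \<le> k")
      case True
      have "L ^ (k - k0) * (2 * (2 * R / L ^ k)) = 4 * R / L ^ k0"
        using True L(1) by (simp add: power_diff field_simps)
      also have "\<dots> \<le> r0" using k0 r0(1) L(1) by (simp add: field_simps)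
      finally have le: "L ^ (k - k0) * (2 * (2 * R / L ^ k)) \<le> r0" .
      have "(\<Sum>y\<in>{y\<in>backward w N. dist y \<zeta> < 2 * R / L ^ k}. wt N y) \<le> (1 - 1 / (real d * real d)) ^ (k - k0)"
        by (rule wt_decay[OF w r0(2) L _ _ le]) (use k R L(1) in auto)
      also have "\<dots> = C * sqrt \<theta> ^ (2 * k)"
        unfolding \<theta>k C_def \<theta>_def[symmetric] using True \<theta> by (simp add: power_diff divide_inverse)
      finally show ?thesis .
    next
      case False
      have "(\<Sum>y\<in>{y\<in>backward w N. dist y \<zeta> < 2 * R / L ^ k}. wt N y) \<le> (\<Sum>y\<in>backward w N. wt N y)"
        by (rule sum_mono2[OF finite_backward[OF w]]) (auto simp: wt_nonneg)
      also have "\<dots> = C * \<theta> ^ k0" using sum_wt[OF w] \<theta> by (simp add: C_def)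
      also have "\<dots> \<le> C * \<theta> ^ k" using False \<theta> by (intro mult_left_mono power_decreasing) (auto simp: C_def)
      finally show ?thesis by (simp only: \<theta>k)
    qed
  qed
next
  case False
  show ?thesis
  \<comment> \<open>For negative \<open>R\<close> the discs are empty, so any admissible constants
    do.\<close>
  proof (rule that[of 2 "1/2" 0])
    fix w \<zeta> :: complex and k N :: nat
    have neg: "2 * R / 2 ^ k < 0" using False by (simp add: divide_neg_pos)
    have "\<not> dist y \<zeta> < 2 * R / 2 ^ k" for y using zero_le_dist[of y \<zeta>] neg by linarith
    then show "(\<Sum>y\<in>{y\<in>backward w N. dist y \<zeta> < 2 * R / 2 ^ k}. wt N y) \<le> 0 * (1/2) ^ (2 * k)" by simp
  qed auto
qed

text \<open>The disc about a frontier point \<open>a\<close>, the smaller disc \<open>D\<close> off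
  \<open>K\<close> and the decay constants are fixed first; only the iterate, the counting function
  and the time of the walk depend on \<open>m\<close>. The capacity estimate then bounds sqrt (1 + m
  q) independently of \<open>m\<close>.\<close>

lemma no_constant_germ:
  assumes germ: "germ (\<lambda>_. z) n w y" and z: "z \<notin> K"
  shows False
proof -
  obtain R where R: "0 < R" "(\<Union>x\<in>K. cball x R) \<subseteq> U 0"
    using compact_subset_open_imp_cball_epsilon_subset[OF compact_K U_open K_U] by blast
  obtain w0 where w0: "w0 \<in> frontier K" using frontier_K(1) by blast
  then have w0K: "w0 \<in> K" using frontier_K(2) by blast
  obtain a c where a: "a \<in> frontier K" "0 < c" "\<exists>\<^sub>\<infinity>N. c \<le> (\<Sum>y\<in>backward w0 N \<inter> ball a R. wt N y)"
    by (rule massive_ball[OF w0 R(1)])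
  have "ball a R \<subseteq> cball a R" by (rule ball_subset_cball)
  then have aR: "ball a R \<subseteq> U 0" using a(1) frontier_K(2) R(2) by blast
  \<comment> \<open>As \<open>a\<close> is on the frontier, the disc that carries mass of the walk
    also contains points outside \<open>K\<close>, over which preimages can be counted.\<close>
  obtain p where p: "p \<notin> K" "dist a p < R" using a(1) R(1) unfolding frontier_straddle by blast
  have "p \<in> ball a R \<inter> Om 0" using p aR by (auto simp: Om_def)
  then obtain \<eta> where \<eta>: "0 < \<eta>" "ball p \<eta> \<subseteq> ball a R \<inter> Om 0"
    by (rule openE[OF open_Int[OF open_ball Om_open]])
  have pO: "p \<in> Om 0" using \<open>p \<in> ball a R \<inter> Om 0\<close> by simp
  have \<eta>': "ball p \<eta> \<subseteq> Om 0" "ball p \<eta> \<subseteq> ball a R" using \<eta>(2) by auto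
  define D where "D = cball p (\<eta> / 2)"
  have Dsub: "D \<subseteq> ball p \<eta>" using \<eta>(1) by (auto simp: D_def)
  define \<mu> where "\<mu> = measure lborel D"
  have \<mu>: "0 < \<mu>" unfolding \<mu>_def D_def using content_cball_pos[of "\<eta> / 2" p] \<eta>(1) by simp
  have "open (- K)" using compact_K by (simp add: compact_imp_closed open_Compl)
  then obtain \<rho> where \<rho>: "0 < \<rho>" "cball z \<rho> \<subseteq> - K" using z open_contains_cball by blast
  have \<rho>': "cball z \<rho> \<inter> K = {}" using \<rho>(2) by blast
  obtain L \<kappa> C where L: "1 < L" and \<kappa>: "0 < \<kappa>" "\<kappa> < 1" and C: "0 \<le> C"
    and decay: "\<And>w k N \<zeta>. \<lbrakk>w \<in> K; k \<le> N\<rbrakk> \<Longrightarrow> (\<Sum>y\<in>{y\<in>backward w N. dist y \<zeta> < 2 * R / L ^ k}. wt N y) \<le> C * \<kappa> ^ (2 * k)"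
    by (rule weights_decay[of R]) (rule that; assumption)
  define E where "E = 4 * \<rho>\<^sup>2 * measure lborel (ball z \<rho>)"
  have E: "0 \<le> E" by (simp add: E_def)
  define M where "M = R * (\<mu> + L\<^sup>2 * C * E) / (1 - \<kappa>)"
  define q where "q = (3 * \<rho>\<^sup>2 / 4)\<^sup>2"
  have q: "0 < q" using \<rho>(1) by (simp add: q_def)
  have bound: "(sqrt (1 + real m * q) - 1) * c * \<mu> \<le> M" for m
  proof -
    obtain i where i: "\<And>w. w \<in> D \<Longrightarrow> \<exists>Y. Y \<subseteq> fibre (n i) w \<and> Y \<subseteq> ball z (\<rho> / 2) \<and> card Y = m"
      unfolding D_def using many_germs_fibre[OF constant_germ_many[OF germ z pO] \<eta>(1) \<eta>'(1), of "\<rho> / 2" m] \<rho>(1) by (metis half_gt_zero)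
    obtain J :: "complex \<Rightarrow> real" and G \<epsilon> where J: "\<And>\<zeta>. \<zeta> \<in> U 0 \<Longrightarrow> (J has_derivative (\<lambda>v. G \<zeta> \<bullet> v)) (at \<zeta>)"
      and G: "continuous_on (U 0) G"
      and En: "(\<integral>\<^sup>+\<zeta>. indicator (U 0) \<zeta> * ennreal ((norm (G \<zeta>))\<^sup>2) \<partial>lborel) \<le> ennreal (4 * \<rho>\<^sup>2 * measure lborel (ball z \<rho>))"
      and \<epsilon>: "0 < \<epsilon>" and near: "\<And>x \<zeta>. \<lbrakk>x \<in> K; dist x \<zeta> < \<epsilon>\<rbrakk> \<Longrightarrow> J \<zeta> = 1"
      and big: "\<And>w Y. \<lbrakk>w \<in> Om 0; Y \<subseteq> fibre (n i) w; Y \<subseteq> ball z (\<rho> / 2)\<rbrakk> \<Longrightarrow> sqrt (1 + real (card Y) * (3 * \<rho>\<^sup>2 / 4)\<^sup>2) \<le> J w"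
      by (rule counting_function[OF \<rho>(1) \<rho>', of "n i"]) (rule that; assumption)
    \<comment> \<open>The last scale 2 R / L^N has to be below the distance \<epsilon> from
      \<open>K\<close> within which J = 1; arbitrarily late times with mass at least
      \<open>c\<close> are available.\<close>
    obtain N0 where N0: "2 * R / \<epsilon> < L ^ N0" using real_arch_pow[OF L] by blast
    obtain N where N: "N0 < N" "c \<le> (\<Sum>y\<in>backward w0 N \<inter> ball a R. wt N y)" using a(3) unfolding INFM_nat by blast
    have "2 * R / \<epsilon> < L ^ N" using N0 N(1) L by (meson less_imp_le less_le_trans power_increasing)
    then have N\<epsilon>: "2 * R / L ^ N < \<epsilon>" using L \<epsilon> by (simp add: field_simps)
    define X where "X = backward w0 N \<inter> ball a R"
    have fin: "finite (backward w0 N)" by (rule finite_backward[OF w0K])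
    have XK: "X \<subseteq> K" using backward_sub[OF w0K] by (auto simp: X_def)
    have "(sqrt (1 + real m * q) - 1) * c * measure lborel D \<le> R * (measure lborel D + L\<^sup>2 * C * E) / (1 - \<kappa>)"
    proof (rule capacity_estimate[where B = "ball a R" and a = a and J = J and G = G and X = X and q = "wt N" and N = N])
      show "(J has_derivative (\<lambda>v. G \<zeta> \<bullet> v)) (at \<zeta>)" if "\<zeta> \<in> ball a R" for \<zeta> using J aR that by blast
      show "continuous_on (ball a R) G" using G aR by (rule continuous_on_subset)
      have "(\<integral>\<^sup>+\<zeta>. indicator (ball a R) \<zeta> * ennreal ((norm (G \<zeta>))\<^sup>2) \<partial>lborel) \<le> (\<integral>\<^sup>+\<zeta>. indicator (U 0) \<zeta> * ennreal ((norm (G \<zeta>))\<^sup>2) \<partial>lborel)"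
        by (intro nn_integral_mono mult_right_mono) (use aR in \<open>auto simp: indicator_def\<close>)
      then show "(\<integral>\<^sup>+\<zeta>. indicator (ball a R) \<zeta> * ennreal ((norm (G \<zeta>))\<^sup>2) \<partial>lborel) \<le> ennreal E"
        using En unfolding E_def by (rule order_trans)
      show "finite X" using fin by (simp add: X_def)
      show "sum (wt N) X \<le> 1"
        using sum_mono2[OF fin, of X "wt N"] sum_wt[OF w0K, of N] by (auto simp: X_def wt_nonneg)
      show "c \<le> sum (wt N) X" using N(2) by (simp add: X_def)
      show "D \<in> sets borel" by (simp add: D_def)
      show "D \<subseteq> ball a R" using Dsub \<eta>'(2) by blast
      show "0 \<le> sqrt (1 + real m * q) - 1" using q by simp
      show "1 + (sqrt (1 + real m * q) - 1) \<le> J w" if w: "w \<in> D" for w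
      proof -
        obtain Y where Y: "Y \<subseteq> fibre (n i) w" "Y \<subseteq> ball z (\<rho> / 2)" "card Y = m" using i[OF w] by blast
        have "w \<in> Om 0" using w Dsub \<eta>'(1) by blast
        then show ?thesis using big[OF _ Y(1,2)] Y(3) by (simp add: q_def)
      qed
      show "J \<zeta> = 1" if "x \<in> X" "dist x \<zeta> < 2 * R / L ^ N" for x \<zeta>
        by (rule near[of x]) (use that XK N\<epsilon> in auto)
      show "(\<Sum>x\<in>{x\<in>X. dist x \<zeta> < 2 * R / L ^ k}. wt N x) \<le> C * \<kappa> ^ (2 * k)" if "k < N" for k \<zeta>
      proof -
        have "(\<Sum>x\<in>{x\<in>X. dist x \<zeta> < 2 * R / L ^ k}. wt N x) \<le> (\<Sum>y\<in>{y\<in>backward w0 N. dist y \<zeta> < 2 * R / L ^ k}. wt N y)"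
          by (rule sum_mono2) (use fin in \<open>auto simp: X_def wt_nonneg\<close>)
        then show ?thesis using decay[OF w0K, of k N \<zeta>] that by simp
      qed
    qed (use R(1) L \<kappa> C E wt_nonneg in \<open>auto simp: X_def\<close>)
    then show ?thesis by (simp only: M_def \<mu>_def)
  qed
  \<comment> \<open>Chosen so that t * (c * \<mu>) = |M| + c * \<mu>, which exceeds
    \<open>M\<close>; then \<open>m\<close> is taken so large that sqrt (1 + m q) is at least 1 +
    t.\<close>
  define t where "t = \<bar>M\<bar> / (c * \<mu>) + 1"
  have t: "0 < t" using a(2) \<mu> by (simp add: t_def add_nonneg_pos)
  obtain m where m: "((1 + t)\<^sup>2 - 1) / q < real m" using reals_Archimedean2 by blast
  have "(1 + t)\<^sup>2 \<le> 1 + real m * q" using m q by (simp add: field_simps)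
  then have "1 + t \<le> sqrt (1 + real m * q)" by (rule real_le_rsqrt)
  then have "t * (c * \<mu>) \<le> (sqrt (1 + real m * q) - 1) * (c * \<mu>)" using a(2) \<mu> by (intro mult_right_mono) auto
  also have "\<dots> \<le> M" using bound[of m] by (simp add: mult.assoc)
  finally have "t * (c * \<mu>) \<le> M" .
  moreover have "t * (c * \<mu>) = \<bar>M\<bar> + c * \<mu>" using a(2) \<mu> by (simp add: t_def field_simps)
  ultimately show False using a(2) \<mu> by (smt (verit) mult_pos_pos)
qed

text \<open>Normality needs a bound for each branch at one point, and the fixed point supplies it: f
  i (x i) = x i is close to \<open>z\<close>, wherever else the branch may go.\<close>

lemma periodic_points_do_not_accumulate:
  assumes z: "z \<in> Om 0" and n: "filterlim n at_top sequentially"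
    and \<zeta>: "\<And>i. \<zeta> i \<in> U (n i)" "\<And>i. (g ^^ n i) (\<zeta> i) = \<zeta> i" "\<zeta> \<longlonglongrightarrow> z"
  shows False
proof -
  obtain R' where R': "0 < R'" "ball z R' \<subseteq> Om 0" using Om_open z by (rule openE)
  define R where "R = R' / 2"
  have R: "0 < R" "ball z (2 * R) \<subseteq> Om 0" using R' by (auto simp: R_def)
  have "\<forall>\<^sub>F i in sequentially. dist (\<zeta> i) z < R / 4" using tendstoD[OF \<zeta>(3), of "R / 4"] R by simp
  then obtain i0 where i0: "\<And>i. i0 \<le> i \<Longrightarrow> dist (\<zeta> i) z < R / 4" by (auto simp: eventually_sequentially)
  define x where "x = (\<lambda>i. \<zeta> (i + i0))"
  define m where "m = (\<lambda>i. n (i + i0))"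
  have xz: "dist (x i) z < R / 4" for i using i0[of "i + i0"] by (simp add: x_def)
  have xlim: "x \<longlonglongrightarrow> z" unfolding x_def by (rule LIMSEQ_ignore_initial_segment[OF \<zeta>(3)])
  have mlim: "filterlim m at_top sequentially" unfolding m_def by (rule filterlim_compose[OF n filterlim_add_const_nat_at_top])
  have xb: "x i \<in> ball z (2 * R)" for i using xz[of i] R(1) by (simp add: dist_commute)
  have xO: "x i \<in> Om (m i)" for i
  proof -
    have "x i \<in> Om 0" using xb R(2) by blast
    then show ?thesis using \<zeta>(1)[of "i + i0"] by (simp add: Om_def x_def m_def)
  qed
  have xfix: "(g ^^ m i) (x i) = x i" for i using \<zeta>(2) by (simp add: x_def m_def)
  have "\<exists>\<Phi>. lift (m i) (ball z (2 * R)) (\<lambda>v. v) \<Phi> \<and> \<Phi> (x i) = x i" for i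
  proof -
    obtain \<Phi> where "lift (m i) (ball z (2 * R)) (\<lambda>v. v) \<Phi>" "\<Phi> (x i) = x i"
      by (rule lift_exists[OF open_ball convex_imp_simply_connected[OF convex_ball] holomorphic_on_ident _ xb xO xfix])
         (use R(2) in auto)
    then show ?thesis by blast
  qed
  then have "\<exists>f. \<forall>i. lift (m i) (ball z (2 * R)) (\<lambda>v. v) (f i) \<and> f i (x i) = x i" by (intro choice allI)
  then obtain f where f: "\<And>i. lift (m i) (ball z (2 * R)) (\<lambda>v. v) (f i)" "\<And>i. f i (x i) = x i" by blast
  obtain a b where ab: "a \<in> K" "b \<in> K" "a \<noteq> b" by (rule K_two_points)
  obtain B where B: "\<And>h v. \<lbrakk>h holomorphic_on ball z R; \<And>x. x \<in> ball z R \<Longrightarrow> h x \<noteq> a \<and> h x \<noteq> b;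
      norm (h z) \<le> norm z + R; dist z v \<le> 3 / 4 * R\<rbrakk> \<Longrightarrow> norm (h v) \<le> B"
    by (rule omitting_two_values_bounded[OF ab(3), of "3/4" R z "norm z + R"]) (use R(1) in auto)
  define S where "S = ball z (R / 2)"
  have bnd: "norm (f i v) \<le> B" if v: "v \<in> S" for i v
  proof -
    \<comment> \<open>The translation moves x i, where the value is known, to the common centre
      \<open>z\<close> required by the Schottky bound. A point of \<open>S\<close> is moved to
      within R/2 + R/4 = 3R/4 of \<open>z\<close>, and the translated disc of radius R stays in the
      disc of radius 2R.\<close>
    define h where "h = (\<lambda>u. f i (u + (x i - z)))"
    have sh: "u + (x i - z) \<in> ball z (2 * R)" if u: "u \<in> ball z R" for u
    proof -
      have "dist z (u + (x i - z)) \<le> dist z u + dist (x i) z"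
        using norm_triangle_ineq4[of "z - u" "x i - z"] by (simp add: dist_norm algebra_simps)
      then show ?thesis using u xz[of i] R(1) by simp
    qed
    have "norm (h (v - (x i - z))) \<le> B"
    proof (rule B[of h])
      have "(f i \<circ> (\<lambda>u. u + (x i - z))) holomorphic_on ball z R"
        by (rule holomorphic_on_compose_gen[OF _ liftD(1)[OF f(1)]]) (auto intro!: holomorphic_intros simp del: mem_ball intro: sh)
      then show "h holomorphic_on ball z R" by (simp add: h_def o_def)
      show "h u \<noteq> a \<and> h u \<noteq> b" if "u \<in> ball z R" for u
        using liftD(3)[OF f(1) sh[OF that]] ab by (auto simp: h_def Om_def)
      have "norm (x i) \<le> norm z + dist (x i) z" using norm_triangle_ineq[of z "x i - z"] by (simp add: dist_norm)
      then show "norm (h z) \<le> norm z + R" using xz[of i] R(1) by (simp add: h_def f(2))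
      have "dist z (v - (x i - z)) \<le> dist z v + dist (x i) z"
        using norm_triangle_ineq[of "z - v" "x i - z"] by (simp add: dist_norm algebra_simps)
      then show "dist z (v - (x i - z)) \<le> 3 / 4 * R" using v xz[of i] by (simp add: S_def)
    qed
    then show ?thesis by (simp add: h_def)
  qed
  have S: "open S" "connected S" "convex S" "z \<in> S" "S \<subseteq> ball z (2 * R)" using R(1) by (auto simp: S_def)
  have SO: "S \<subseteq> Om 0" using S(5) R(2) by blast
  have fS: "lift (m i) S (\<lambda>v. v) (f i)" for i by (rule lift_subset[OF f(1) S(5)])
  define H where "H = {h. h holomorphic_on S \<and> (\<forall>v\<in>S. norm (h v) \<le> B)}"
  obtain \<phi> r where \<phi>: "\<phi> holomorphic_on S" and r: "strict_mono r" and lim: "\<And>v. v \<in> S \<Longrightarrow> (\<lambda>i. f (r i) v) \<longlonglongrightarrow> \<phi> v"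
    and unif: "\<And>Q. \<lbrakk>compact Q; Q \<subseteq> S\<rbrakk> \<Longrightarrow> uniform_limit Q (f \<circ> r) \<phi> sequentially"
  proof (rule Montel[OF S(1), of H f])
    show "h holomorphic_on S" if "h \<in> H" for h using that by (simp add: H_def)
    show "\<exists>B. \<forall>h\<in>H. \<forall>v\<in>Q. norm (h v) \<le> B" if "compact Q" "Q \<subseteq> S" for Q
      using that(2) by (intro exI[of _ B]) (auto simp: H_def)
    show "range f \<subseteq> H" using bnd liftD(1)[OF fS] by (auto simp: H_def)
  qed blast
  have unif': "\<forall>\<^sub>F i in sequentially. \<forall>v\<in>Q. dist (f (r i) v) (\<phi> v) < e" if "compact Q" "Q \<subseteq> S" "0 < e" for Q e
    using uniform_limit_near[OF unif[OF that(1,2)] that(3)] by simp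
  show False
  proof (cases "\<forall>v\<in>S. deriv \<phi> v = 0")
    case True
    have "(\<phi> has_field_derivative 0) (at v within S)" if "v \<in> S" for v
      using holomorphic_derivI[OF \<phi> S(1) that] True that by (metis has_field_derivative_at_within)
    then obtain c where c: "\<And>v. v \<in> S \<Longrightarrow> \<phi> v = c"
      using has_field_derivative_zero_constant[OF S(3), of \<phi>] by blast
    \<comment> \<open>The fixed points are values of the branches at points near \<open>z\<close>,
      where the convergence to the constant is uniform; hence the constant is
      \<open>z\<close>.\<close>
    have "(\<lambda>i. x (r i)) \<longlonglongrightarrow> c"
    proof (rule tendstoI)
      fix e :: real assume e: "0 < e"
      have sub: "cball z (R / 4) \<subseteq> S" using R(1) by (auto simp: S_def)
      show "\<forall>\<^sub>F i in sequentially. dist (x (r i)) c < e"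
        using unif'[OF compact_cball sub e]
      proof eventually_elim
        case (elim i)
        have xc: "x (r i) \<in> cball z (R / 4)" using xz[of "r i"] by (simp add: dist_commute)
        then have "dist (f (r i) (x (r i))) (\<phi> (x (r i))) < e" using elim by blast
        moreover have "\<phi> (x (r i)) = c" using c xc sub by blast
        ultimately show ?case by (simp add: f(2))
      qed
    qed
    moreover have "(\<lambda>i. x (r i)) \<longlonglongrightarrow> z" using LIMSEQ_subseq_LIMSEQ[OF xlim r] by (simp add: o_def)
    ultimately have cz: "c = z" by (rule LIMSEQ_unique)
    have "germ (\<lambda>_. z) (\<lambda>i. m (r i)) z (\<lambda>i. f (r i) z)"
      unfolding germ_def
    proof (intro exI[of _ "R / 2"] conjI exI[of _ "\<lambda>i. f (r i)"] allI ballI)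
      show "0 < R / 2" using R(1) by simp
      show "ball z (R / 2) \<subseteq> Om 0" using SO by (simp only: S_def)
      show "lift (m (r i)) (ball z (R / 2)) (\<lambda>v. v) (f (r i))" for i using fS by (simp only: S_def)
      show "(\<lambda>i. f (r i) v) \<longlonglongrightarrow> z" if "v \<in> ball z (R / 2)" for v
        using lim[of v] c[of v] that cz by (simp only: S_def)
    qed (rule refl)
    then show False using no_constant_germ z by (auto simp: Om_def)
  next
    case False
    then obtain v0 where v0: "v0 \<in> S" "deriv \<phi> v0 \<noteq> 0" by blast
    obtain e where e: "0 < e" "ball v0 e \<subseteq> S" "inj_on \<phi> (ball v0 e)"
      using has_complex_derivative_locally_injective[OF \<phi> v0(1) S(1) v0(2)] by blast
    \<comment> \<open>The sequence m need not be monotone; since it tends to infinity, a later index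
      with strictly larger order can still be chosen for each \<open>i\<close>.\<close>
    have "\<exists>j\<ge>i. m (r i) < m (r j)" for i
    proof -
      have "filterlim (\<lambda>j. m (r j)) at_top sequentially"
        by (rule filterlim_compose[OF mlim filterlim_subseq[OF r]])
      then have "\<forall>\<^sub>F j in sequentially. Suc (m (r i)) \<le> m (r j)" by (simp only: filterlim_at_top)
      then obtain N where "\<And>j. N \<le> j \<Longrightarrow> Suc (m (r i)) \<le> m (r j)" by (auto simp: eventually_sequentially)
      from this[of "max N i"] have "m (r i) < m (r (max N i))" by simp
      then show ?thesis by (intro exI[of _ "max N i"] conjI max.cobounded2)
    qed
    then have "\<exists>s. \<forall>i. i \<le> s i \<and> m (r i) < m (r (s i))" by (intro choice allI)
    then obtain s where s: "\<And>i. i \<le> s i" "\<And>i. m (r i) < m (r (s i))" by blast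
    have slim: "filterlim s at_top sequentially"
      by (rule filterlim_at_top_mono[OF filterlim_ident]) (simp add: s(1))
    define l where "l = (\<lambda>i. m (r (s i)) - m (r i))"
    \<comment> \<open>A branch of order m (r (s i)) followed by the iterate of order m (r i) is an
      inverse branch of the iterate of order \<open>l i\<close>. The iterate undoes the branch f (r
      i), and both branches have the limit \<phi>, so q i should be close to the identity.\<close>
    define q where "q = (\<lambda>i v. (g ^^ m (r i)) (f (r (s i)) v))"
    have ml: "m (r (s i)) = m (r i) + l i" for i using s(2)[of i] by (simp add: l_def)
    have fU: "f (r (s i)) v \<in> U (m (r i) + l i)" "f (r (s i)) v \<notin> K" if "v \<in> S" for i v
    proof -
      have "f (r (s i)) v \<in> U (m (r i) + l i) - K" using liftD(3)[OF fS[of "r (s i)"] that] unfolding ml Om_def .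
      then show "f (r (s i)) v \<in> U (m (r i) + l i)" "f (r (s i)) v \<notin> K" by blast+
    qed
    have ql: "lift (l i) S (\<lambda>v. v) (q i)" for i
      unfolding lift_def
    proof (intro conjI ballI)
      have "((g ^^ m (r i)) \<circ> f (r (s i))) holomorphic_on S"
        by (rule holomorphic_on_compose_gen[OF liftD(1)[OF fS] iterate_hol[of "m (r i)" "l i"]]) (use fU(1) in blast)
      then show "q i holomorphic_on S" by (simp add: q_def o_def)
      show "q i ` S \<subseteq> Om (l i)"
        using fU iterate_in[of _ "m (r i)" "l i"] iterate_K[of _ "m (r i)" "l i"] by (auto simp: q_def Om_def)
      fix v assume v: "v \<in> S"
      have "(g ^^ l i) (q i v) = (g ^^ (l i + m (r i))) (f (r (s i)) v)" by (simp add: q_def funpow_add)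
      also have "l i + m (r i) = m (r (s i))" by (simp add: ml)
      also have "(g ^^ m (r (s i))) (f (r (s i)) v) = v" using liftD(4)[OF fS v] .
      finally show "(g ^^ l i) (q i v) = v" .
    qed
    \<comment> \<open>The equation f (r i) u = f (r (s i)) v has a solution \<open>u\<close> near
      \<open>v\<close> by the minimum principle, because both branches are close to \<phi>, which is
      injective there. Applying the iterate of order m (r i) to both sides gives u = q i v.\<close>
    have qlim: "(\<lambda>i. q i v) \<longlonglongrightarrow> v" if v: "v \<in> ball v0 e" for v
    proof (rule tendstoI)
      fix \<epsilon> :: real assume \<epsilon>: "0 < \<epsilon>"
      obtain t' where t': "0 < t'" "cball v t' \<subseteq> ball v0 e"
        using open_contains_cball[THEN iffD1, OF open_ball, rule_format, OF v] by (elim exE conjE)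
      define t where "t = min t' (\<epsilon> / 2)"
      have t: "0 < t" "t < \<epsilon>" using t'(1) \<epsilon> by (auto simp: t_def)
      have te: "cball v t \<subseteq> ball v0 e" using t'(2) by (rule order_trans[rotated]) (simp add: t_def subset_cball)
      have tS: "cball v t \<subseteq> S" using te e(2) by blast
      have sS: "sphere v t \<subseteq> cball v t" by (simp add: sphere_cball)
      have "continuous_on (sphere v t) \<phi>"
        using holomorphic_on_imp_continuous_on[OF \<phi>] order_trans[OF sS tS] by (rule continuous_on_subset)
      then have "continuous_on (sphere v t) (\<lambda>u. dist (\<phi> u) (\<phi> v))" by (intro continuous_intros)
      moreover have "sphere v t \<noteq> {}" using t(1) by simp
      ultimately obtain u0 where u0: "u0 \<in> sphere v t" "\<And>u. u \<in> sphere v t \<Longrightarrow> dist (\<phi> u0) (\<phi> v) \<le> dist (\<phi> u) (\<phi> v)"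
        using continuous_attains_inf[OF compact_sphere, of v t "\<lambda>u. dist (\<phi> u) (\<phi> v)"] by blast
      define \<delta> where "\<delta> = dist (\<phi> u0) (\<phi> v) / 4"
      have "u0 \<noteq> v" using u0(1) t(1) by auto
      moreover have "u0 \<in> ball v0 e" using u0(1) sS te by blast
      ultimately have "\<phi> u0 \<noteq> \<phi> v" using inj_onD[OF e(3)] v by blast
      then have \<delta>: "0 < \<delta>" by (simp add: \<delta>_def)
      have ev: "\<forall>\<^sub>F i in sequentially. \<forall>u\<in>cball v t. dist (f (r i) u) (\<phi> u) < \<delta>" by (rule unif'[OF compact_cball tS \<delta>])
      have ev2: "\<forall>\<^sub>F i in sequentially. \<forall>u\<in>cball v t. dist (f (r (s i)) u) (\<phi> u) < \<delta>"
        using slim ev unfolding filterlim_iff by (elim allE impE)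
      show "\<forall>\<^sub>F i in sequentially. dist (q i v) v < \<epsilon>"
        using ev ev2
      proof eventually_elim
        case (elim i)
        define y where "y = f (r (s i)) v"
        have vc: "v \<in> cball v t" using t(1) by simp
        have yv: "dist y (\<phi> v) < \<delta>" using elim(2) vc unfolding y_def by blast
        have "\<exists>u. u \<in> ball v t \<and> f (r i) u - y = 0"
        proof (rule holomorphic_contract_to_zero[of v t "\<lambda>u. f (r i) u - y"])
          have "f (r i) holomorphic_on cball v t" using liftD(1)[OF fS] tS by (rule holomorphic_on_subset)
          then have hol: "(\<lambda>u. f (r i) u - y) holomorphic_on cball v t" by (intro holomorphic_intros)
          show "continuous_on (cball v t) (\<lambda>u. f (r i) u - y)" using hol by (rule holomorphic_on_imp_continuous_on)
          show "(\<lambda>u. f (r i) u - y) holomorphic_on ball v t" using hol ball_subset_cball by (rule holomorphic_on_subset)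
          show "0 < t" by (rule t(1))
          show "norm (f (r i) v - y) < norm (f (r i) u - y)" if u: "norm (v - u) = t" for u
          proof -
            have us: "u \<in> sphere v t" using u by (simp add: dist_norm)
            have "dist (f (r i) u) (\<phi> u) < \<delta>" using elim(1) us sS by blast
            moreover have "dist (f (r i) v) (\<phi> v) < \<delta>" using elim(1) vc by blast
            moreover have "4 * \<delta> \<le> dist (\<phi> u) (\<phi> v)" using u0(2)[OF us] by (simp add: \<delta>_def)
            moreover have "dist (\<phi> u) (\<phi> v) \<le> dist (f (r i) u) (\<phi> u) + dist (f (r i) u) y + dist y (\<phi> v)" by metric
            moreover have "dist (f (r i) v) y \<le> dist (f (r i) v) (\<phi> v) + dist y (\<phi> v)" by metric
            ultimately show ?thesis using yv by (simp only: dist_norm[symmetric])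
          qed
        qed blast
        then obtain u where u: "u \<in> ball v t" "f (r i) u = y" by auto
        have uS: "u \<in> S" using u(1) tS ball_subset_cball by blast
        have "q i v = (g ^^ m (r i)) (f (r i) u)" by (simp add: q_def y_def[symmetric] u(2))
        also have "\<dots> = u" by (rule liftD(4)[OF fS uS])
        finally show ?case using u(1) t(2) by (simp add: dist_commute)
      qed
    qed
    have "germ (\<lambda>v. v) l v0 (\<lambda>i. q i v0)"
      unfolding germ_def
    proof (intro exI[of _ e] conjI exI[of _ q] allI ballI)
      show "ball v0 e \<subseteq> Om 0" using e(2) SO by blast
      show "lift (l i) (ball v0 e) (\<lambda>v. v) (q i)" for i by (rule lift_subset[OF ql e(2)])
    qed (use e(1) qlim in auto)
    moreover have "1 \<le> l i" for i using s(2)[of i] by (simp add: l_def)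
    ultimately show False by (rule no_identity_germ)
  qed
qed

end

theorem theorem1p2:
  fixes g :: "complex \<Rightarrow> complex" and U :: "nat \<Rightarrow> complex set"
    and d :: nat and K :: "complex set"
  assumes "d \<ge> 2"
    and "BI_map d g U"
    and "K \<subseteq> (\<Inter>i. U i)"
    and "full_compact K"
    and "preimage_BI g U K = K"
    and "postcritical_set g U \<subseteq> K"
  shows "repelling_limit_set g U \<inter> (U 0 - K) = {}"
proof -
  interpret BI_system g U d K by (unfold_locales) (rule assms)+
  have False if z: "z \<in> repelling_limit_set g U" "z \<in> U 0 - K" for z
  proof -
    obtain m \<zeta> where *: "filterlim m at_top sequentially" "\<And>i. \<zeta> i \<in> repelling_set g U (m i)" "\<zeta> \<longlonglongrightarrow> z"
      using z(1) unfolding repelling_limit_set_def by blast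
    show False
      by (rule periodic_points_do_not_accumulate[OF _ *(1) _ _ *(3)])
         (use z(2) *(2) in \<open>auto simp: Om_def repelling_set_def\<close>)
  qed
  then show ?thesis by blast
qed

end
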